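(* Consider the model $y_t=\beta'X_t+\varepsilon_t$, $\varepsilon_t=\sum_{i=0}^\infty a_ie_{t-i}$ described in the context, and let $\hat\beta_n$ be an estimator of $\beta\in\mathbb R^p$. Assume: (1) One of the following holds: (i) $H<1/2$ and $\sigma>0$; (ii) $H=1/2$, $\sigma>0$ and $\sum_{j=0}^\infty|a_j|<\infty$; (iii) $1/2<H<1$. (2) The distribution function $G_0$ of $e_t$ is three times differentiable with bounded, continuous and integrable derivatives, and $\int x^4\,dG_0(x)<\infty$. (3) There are $p\times p$ constant (nonrandom, invertible) matrices $\delta_n$ such that, as $n\to\infty$: (a) $\delta_n^{-1}(\hat\beta_n-\beta)=O_p(1)$; (b) $\sigma_n^{-1}\sum_{t=1}^nE\|\delta_n'X_t\|=O(1)$; (c) $\sigma_n^{-1}\sum_{t=1}^nE\|\delta_n'X_t\|^2=o(1)$; (d) $\sigma_n^{-1}\sup_{x\in\mathbb R}\|\sum_{t=1}^nA_t(x)\delta_n'X_t\|=o_p(1)$. Then $$\sup_{x\in\mathbb R}\bigl|\hat K_n(x)-K_n(x)-R_nF'(x)\bigr|=o_p(1),$$ where $R_n=\sigma_n^{-1}(\hat\beta_n-\beta)'\sum_{t=1}^nX_t=O_p(1)$.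
   Context: Model: $y_t=\beta'X_t+\varepsilon_t$, $\varepsilon_t=\sum_{i=0}^\infty a_ie_{t-i}$, where $\{e_t\}$ is a sequence of i.i.d. mean-zero random variables with $\sigma_e^2=Ee_t^2<\infty$ and common distribution function $G_0$; $a_0=1$, $a_k=k^{H-3/2}L_0(k)$ for $k\ge1$ with $L_0$ slowly varying and $H<1$; $\sum_{i=1}^\infty a_i^2<\infty$. $\{X_t\}$ is a sequence of $p$-dimensional random vectors which are either measurable with respect to $\mathcal F_{t-1}=\sigma\{\varepsilon_{t-1},\varepsilon_{t-2},\dots\}$ or independent of $\{\varepsilon_t\}$. Notation: $F$ is the distribution function of $\varepsilon_t$; $\sigma_n^2=\operatorname{var}(\sum_{t=1}^n\varepsilon_t)$; when $\sum_j|a_j|<\infty$ the limit $\sigma^2=\lim_{n\to\infty}\sigma_n^2/n$ exists and is finite. $\xi_{t-1}=\sum_{i=1}^\infty a_ie_{t-i}$, so $\varepsilon_t=e_t+\xi_{t-1}$, and $A_t(x)=G_0'(x-\xi_{t-1})-E[G_0'(x-\xi_{t-1})]$. $\|M\|=[\operatorname{tr}(M'M)]^{1/2}$. Residuals: $\hat\varepsilon_t=y_t-\hat\beta_n'X_t$. Empirical processes: $$K_n(x)=\frac1{\sigma_n}\sum_{t=1}^n[I(\varepsilon_t\le x)-F(x)],\qquad \hat K_n(x)=\frac1{\sigma_n}\sum_{t=1}^n[I(\hat\varepsilon_t\le x)-F(x)].$$ *)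

theory Defs
  imports "HOL-Probability.Probability" "HOL-Library.Landau_Symbols"
begin

definition slowly_varying :: "(real \<Rightarrow> real) \<Rightarrow> bool" where
  "slowly_varying L \<longleftrightarrow>
     L \<in> borel_measurable borel \<and>
     eventually (\<lambda>x. L x > 0) at_top \<and>
     (\<forall>c>0. ((\<lambda>x. L (c * x) / L x) \<longlongrightarrow> 1) at_top)"

(* Measurability of every Z n is part of both notions below: the measure of a
   non-measurable event is 0 by convention, which would make them vacuous. *)

definition bounded_in_prob :: "'a measure \<Rightarrow> (nat \<Rightarrow> 'a \<Rightarrow> 'b::real_normed_vector) \<Rightarrow> bool" where
  "bounded_in_prob M Z \<longleftrightarrow>
     (\<forall>n. Z n \<in> borel_measurable M) \<and>
     (\<forall>\<eta>>0. \<exists>C. eventually (\<lambda>n. measure M {\<omega> \<in> space M. norm (Z n \<omega>) > C} < \<eta>) sequentially)"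

definition negligible_in_prob :: "'a measure \<Rightarrow> (nat \<Rightarrow> 'a \<Rightarrow> 'b::real_normed_vector) \<Rightarrow> bool" where
  "negligible_in_prob M Z \<longleftrightarrow>
     (\<forall>n. Z n \<in> borel_measurable M) \<and>
     (\<forall>\<eta>>0. (\<lambda>n. measure M {\<omega> \<in> space M. norm (Z n \<omega>) > \<eta>}) \<longlonglongrightarrow> 0)"

definition distribution_function :: "'a measure \<Rightarrow> ('a \<Rightarrow> real) \<Rightarrow> real \<Rightarrow> real" where
  "distribution_function M Z = cdf (distr M borel Z)"

definition generated_sigma :: "'a measure \<Rightarrow> (int \<Rightarrow> 'a \<Rightarrow> 'b::topological_space) \<Rightarrow> int set \<Rightarrow> 'a measure" where
  "generated_sigma M Z I =
     sigma (space M) (\<Union>i\<in>I. {Z i -` B \<inter> space M | B. B \<in> sets borel})"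

definition three_times_smooth :: "(real \<Rightarrow> real) \<Rightarrow> bool" where
  "three_times_smooth G \<longleftrightarrow>
     (\<forall>k<3. (\<forall>x. (deriv ^^ k) G field_differentiable (at x)) \<and>
            continuous_on UNIV ((deriv ^^ Suc k) G) \<and>
            bounded (range ((deriv ^^ Suc k) G)) \<and>
            integrable lborel ((deriv ^^ Suc k) G))"

definition eps :: "(nat \<Rightarrow> real) \<Rightarrow> (int \<Rightarrow> 'a \<Rightarrow> real) \<Rightarrow> int \<Rightarrow> 'a \<Rightarrow> real" where
  "eps a e t \<omega> = (\<Sum>i. a i * e (t - int i) \<omega>)"

(* xi a e s is \<xi>\<^sub>s, so the predictable part of eps a e t is xi a e (t - 1); the sum over
   i \<ge> 1 of a i * e (s + 1 - i) is re-indexed to start at 0. *)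
definition xi :: "(nat \<Rightarrow> real) \<Rightarrow> (int \<Rightarrow> 'a \<Rightarrow> real) \<Rightarrow> int \<Rightarrow> 'a \<Rightarrow> real" where
  "xi a e s \<omega> = (\<Sum>i. a (Suc i) * e (s + 1 - int (Suc i)) \<omega>)"

definition sigma_n :: "'a measure \<Rightarrow> (nat \<Rightarrow> real) \<Rightarrow> (int \<Rightarrow> 'a \<Rightarrow> real) \<Rightarrow> nat \<Rightarrow> real" where
  "sigma_n M a e n = sqrt (prob_space.variance M (\<lambda>\<omega>. \<Sum>t\<in>{1..int n}. eps a e t \<omega>))"

definition sigma_lim :: "'a measure \<Rightarrow> (nat \<Rightarrow> real) \<Rightarrow> (int \<Rightarrow> 'a \<Rightarrow> real) \<Rightarrow> real" where
  "sigma_lim M a e = sqrt (lim (\<lambda>n. (sigma_n M a e n)\<^sup>2 / real n))"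

definition G0 :: "'a measure \<Rightarrow> (int \<Rightarrow> 'a \<Rightarrow> real) \<Rightarrow> real \<Rightarrow> real" where
  "G0 M e = distribution_function M (e 0)"

(* eps a e is stationary when e is i.i.d., so time 0 stands for every t. *)
definition F_eps :: "'a measure \<Rightarrow> (nat \<Rightarrow> real) \<Rightarrow> (int \<Rightarrow> 'a \<Rightarrow> real) \<Rightarrow> real \<Rightarrow> real" where
  "F_eps M a e = distribution_function M (eps a e 0)"

definition A_dev :: "'a measure \<Rightarrow> (nat \<Rightarrow> real) \<Rightarrow> (int \<Rightarrow> 'a \<Rightarrow> real) \<Rightarrow> int \<Rightarrow> real \<Rightarrow> 'a \<Rightarrow> real" where
  "A_dev M a e t x \<omega> =
     deriv (G0 M e) (x - xi a e (t - 1) \<omega>) -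
     prob_space.expectation M (\<lambda>\<omega>'. deriv (G0 M e) (x - xi a e (t - 1) \<omega>'))"

definition residual ::
  "(int \<Rightarrow> 'a \<Rightarrow> real) \<Rightarrow> (int \<Rightarrow> 'a \<Rightarrow> real ^ 'p) \<Rightarrow> (nat \<Rightarrow> 'a \<Rightarrow> real ^ 'p) \<Rightarrow>
   nat \<Rightarrow> int \<Rightarrow> 'a \<Rightarrow> real" where
  "residual y X bhat n t \<omega> = y t \<omega> - bhat n \<omega> \<bullet> X t \<omega>"

definition K_proc :: "'a measure \<Rightarrow> (nat \<Rightarrow> real) \<Rightarrow> (int \<Rightarrow> 'a \<Rightarrow> real) \<Rightarrow> nat \<Rightarrow> real \<Rightarrow> 'a \<Rightarrow> real" where
  "K_proc M a e n x \<omega> =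
     1 / sigma_n M a e n *
     (\<Sum>t\<in>{1..int n}. of_bool (eps a e t \<omega> \<le> x) - F_eps M a e x)"

definition K_hat ::
  "'a measure \<Rightarrow> (nat \<Rightarrow> real) \<Rightarrow> (int \<Rightarrow> 'a \<Rightarrow> real) \<Rightarrow> (int \<Rightarrow> 'a \<Rightarrow> real) \<Rightarrow>
   (int \<Rightarrow> 'a \<Rightarrow> real ^ 'p) \<Rightarrow> (nat \<Rightarrow> 'a \<Rightarrow> real ^ 'p) \<Rightarrow> nat \<Rightarrow> real \<Rightarrow> 'a \<Rightarrow> real" where
  "K_hat M a e y X bhat n x \<omega> =
     1 / sigma_n M a e n *
     (\<Sum>t\<in>{1..int n}. of_bool (residual y X bhat n t \<omega> \<le> x) - F_eps M a e x)"

definition R_term ::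
  "'a measure \<Rightarrow> (nat \<Rightarrow> real) \<Rightarrow> (int \<Rightarrow> 'a \<Rightarrow> real) \<Rightarrow> (int \<Rightarrow> 'a \<Rightarrow> real ^ 'p) \<Rightarrow>
   real ^ 'p \<Rightarrow> (nat \<Rightarrow> 'a \<Rightarrow> real ^ 'p) \<Rightarrow> nat \<Rightarrow> 'a \<Rightarrow> real" where
  "R_term M a e X \<beta> bhat n \<omega> =
     1 / sigma_n M a e n * ((bhat n \<omega> - \<beta>) \<bullet> (\<Sum>t\<in>{1..int n}. X t \<omega>))"

end

theory Submission
  imports Defs "HOL-Real_Asymp.Real_Asymp"
begin

text \<open>Write \<open>Z\<^sub>t = \<delta>\<^sub>n' X\<^sub>t\<close> and \<open>u = \<delta>\<^sub>n\<inverse> (bhat n - \<beta>)\<close> for the normalised estimation error, so that the residual is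
  \<open>\<epsilon>\<^sub>t - u' Z\<^sub>t\<close> and \<open>u\<close> is bounded in probability. It suffices to control
  \<open>\<Sum>\<^sub>t (I(\<epsilon>\<^sub>t \<le> x + u' Z\<^sub>t) - I(\<epsilon>\<^sub>t \<le> x) - u' Z\<^sub>t F'(x))\<close> uniformly in \<open>x\<close> and in \<open>u\<close> in a ball.
  Conditioning on the past replaces the indicators by \<open>G\<^sub>0(\<cdot> - \<xi>\<^sub>t\<^sub>-\<^sub>1)\<close>; the conditional means are linearised
  by Taylor's formula, and hypotheses (3)(c), (3)(d) absorb the errors. For fixed \<open>(u, x)\<close> the martingale
  remainder has quadratic variation \<open>O(\<sigma>\<^sub>n)\<close> and bounded jumps, so by an exponential supermartingale it exceeds
  \<open>\<eta> \<sigma>\<^sub>n\<close> with probability at most \<open>exp (- c \<sigma>\<^sub>n)\<close>. Since \<open>\<sigma>\<^sub>n\<close> is at least of order \<open>\<surd>n\<close> in all three cases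
  of (1), a union bound over a grid of \<open>O(n\<^sup>2)\<close> points, combined with the monotonicity of indicators,
  gives uniformity. If the regressors are independent of the errors, the argument is run on the square of the
  probability space, where (3)(d) holds automatically.\<close>

text \<open>The union bound dictates an exponential inequality: with about \<open>n\<^sup>2\<close>
  grid points and \<sigma>_n possibly of order sqrt n only, Chebyshev's inequality gains just a
  factor O(1/\<sigma>_n) per point. Exponential bounds succeed because a difference of two
  indicators of half-lines has, given the past, variance at most the absolute value of its mean; the
  total is then of order 1 + \<Sum> |Z_t| instead of n. The grid is tuned to the budget \<sigma>_n.
  A mesh of 1/n costs K/n in each of n summands, hence a constant; stopping at n and -n leaves
  O(\<sigma>_n/n) expected changes; the net of vectors u keeps a fixed radius d, since d K \<Sum>
  |Z_t| is already a small multiple of \<sigma>_n. The bad event is described through the pairs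
  (Z_t, \<epsilon>_t) alone, without \<xi>: for these the independence hypothesis identifies the
  joint law with a product. \<open>suminf\<close>, \<open>lim\<close> and \<open>SUP\<close> are
  unspecified where convergence or boundedness fails. Hence the almost sure convergence of the
  series, the convergence of \<sigma>_n^2/n under short memory, and the boundedness of the families
  under each \<open>SUP\<close> are all proved.\<close>

section \<open>Slowly varying functions\<close>

text \<open>Pointwise convergence becomes smallness on a set of large measure by continuity from
  below. The threshold 3/2 is half the length of [0, 3], where two such sets, one of them shifted by
  at most 1, will be compared.\<close>

lemma measure_small_increment:
  fixes f :: "real \<Rightarrow> real" and y :: "nat \<Rightarrow> real"
  assumes [measurable]: "f \<in> borel_measurable borel"
    and lim: "\<And>u. ((\<lambda>x. f (x + u) - f x) \<longlongrightarrow> 0) at_top"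
    and y: "filterlim y at_top sequentially" and e: "e > 0"
  shows "eventually (\<lambda>n. measure lborel {v\<in>{0..2}. \<forall>m\<ge>n. \<bar>f (y m + v) - f (y m)\<bar> < e} > 3/2) sequentially"
proof -
  define V where "V n = {v\<in>{0..2::real}. \<forall>m\<ge>n. \<bar>f (y m + v) - f (y m)\<bar> < e}" for n
  have V[measurable]: "V n \<in> sets lborel" for n
    unfolding V_def by measurable
  have "(\<lambda>n. emeasure lborel (V n)) \<longlonglongrightarrow> emeasure lborel (\<Union>n. V n)"
  proof (rule Lim_emeasure_incseq)
    show "incseq V" unfolding V_def by (intro monoI) force
  qed (use V in auto)
  moreover have "(\<Union>n. V n) = {0..2}"
  proof -
    have "\<exists>n. v \<in> V n" if "v \<in> {0..2}" for v
    proof -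
      have "((\<lambda>m. f (y m + v) - f (y m)) \<longlongrightarrow> 0) sequentially"
        using filterlim_compose[OF lim y] .
      then have "eventually (\<lambda>m. dist (f (y m + v) - f (y m)) 0 < e) sequentially"
        using e by (rule tendstoD)
      then show ?thesis using that unfolding V_def eventually_sequentially by (auto simp: dist_real_def)
    qed
    then show ?thesis unfolding V_def by blast
  qed
  ultimately have "(\<lambda>n. emeasure lborel (V n)) \<longlonglongrightarrow> ennreal 2" by simp
  then have "(\<lambda>n. measure lborel (V n)) \<longlonglongrightarrow> 2"
  proof -
    assume *: "(\<lambda>n. emeasure lborel (V n)) \<longlonglongrightarrow> ennreal 2"
    have "emeasure lborel (V n) = ennreal (measure lborel (V n))" for n
    proof (rule emeasure_eq_ennreal_measure)
      have "emeasure lborel (V n) \<le> emeasure lborel {0..2::real}"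
        by (rule emeasure_mono) (auto simp: V_def)
      then show "emeasure lborel (V n) \<noteq> \<top>" by (auto simp: top_unique)
    qed
    with * have "(\<lambda>n. ennreal (measure lborel (V n))) \<longlonglongrightarrow> ennreal 2" by simp
    then show ?thesis by (subst (asm) tendsto_ennreal_iff) auto
  qed
  from order_tendstoD(1)[OF this, of "3/2"] show ?thesis unfolding V_def by simp
qed

text \<open>The uniform convergence theorem of slow variation in additive form. If it failed along
  x_n and u_n, the sets of v with small increments from x_n and from x_n + u_n would both have
  measure above 3/2. After translation by u_n the second still lies in [0, 3], so it meets the
  first, and a common point links f(x_n) with f(x_n + u_n) at a cost below e.\<close>

lemma slow_variation_uniform:
  fixes f :: "real \<Rightarrow> real"
  assumes [measurable]: "f \<in> borel_measurable borel"
    and lim: "\<And>u. ((\<lambda>x. f (x + u) - f x) \<longlongrightarrow> 0) at_top" and e: "e > 0"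
  shows "\<exists>x0. \<forall>x\<ge>x0. \<forall>u\<in>{0..1}. \<bar>f (x + u) - f x\<bar> < e"
proof (rule ccontr)
  assume "\<not> ?thesis"
  then have "\<forall>n::nat. \<exists>x u. x \<ge> real n \<and> u \<in> {0..1} \<and> \<bar>f (x + u) - f x\<bar> \<ge> e"
    by (metis not_le)
  then obtain x u where xu: "\<And>n::nat. x n \<ge> real n" "\<And>n. u n \<in> {0..1}" "\<And>n. \<bar>f (x n + u n) - f (x n)\<bar> \<ge> e"
    by metis
  have x: "filterlim x at_top sequentially"
    by (rule filterlim_at_top_mono[OF filterlim_real_sequentially]) (simp add: xu)
  have xu': "filterlim (\<lambda>n. x n + u n) at_top sequentially"
    by (rule filterlim_at_top_mono[OF x]) (use xu(2) in auto)
  define V where "V n = {v\<in>{0..2::real}. \<forall>m\<ge>n. \<bar>f (x m + v) - f (x m)\<bar> < e/2}" for n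
  define W where "W n = {v\<in>{0..2::real}. \<forall>m\<ge>n. \<bar>f (x m + u m + v) - f (x m + u m)\<bar> < e/2}" for n
  have [measurable]: "V n \<in> sets lborel" "W n \<in> sets lborel" for n
    unfolding V_def W_def by measurable
  have "eventually (\<lambda>n. measure lborel (V n) > 3/2 \<and> measure lborel (W n) > 3/2) sequentially"
    unfolding V_def W_def
    by (intro eventually_conj measure_small_increment x xu' lim) (use e in auto)
  then obtain n where n: "measure lborel (V n) > 3/2" "measure lborel (W n) > 3/2"
    by (auto simp: eventually_sequentially)
  let ?W = "(+) (u n) ` W n"
  have Wm: "?W \<in> sets lborel"
  proof -
    have "?W = (\<lambda>v. v - u n) -` W n \<inter> space borel" by force
    also have "\<dots> \<in> sets borel" using \<open>W n \<in> sets lborel\<close> by (intro measurable_sets[where A=borel]) auto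
    finally show ?thesis by simp
  qed
  have Wmeas: "measure lborel ?W = measure lborel (W n)"
  proof -
    have "measure lborel ?W = measure lebesgue ?W" by (rule measure_completion[symmetric]) (use Wm in simp)
    also have "\<dots> = measure lebesgue (W n)" by (rule measure_translation)
    also have "\<dots> = measure lborel (W n)" by (rule measure_completion) (use \<open>W n \<in> sets lborel\<close> in simp)
    finally show ?thesis .
  qed
  have "V n \<inter> ?W \<noteq> {}"
  proof
    assume disj: "V n \<inter> ?W = {}"
    have fin: "A \<in> fmeasurable lborel" if "A \<in> sets lborel" "A \<subseteq> {0..3::real}" for A
      by (rule fmeasurableI2[of "{0..3}"]) (use that in \<open>auto simp: fmeasurable_def\<close>)
    have sub: "V n \<subseteq> {0..3}" "?W \<subseteq> {0..3}" using xu(2)[of n] by (auto simp: V_def W_def)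
    have "measure lborel (V n \<union> ?W) = measure lborel (V n) + measure lborel ?W"
      by (intro measure_Un2[THEN trans] fin Wm sub) (use disj \<open>V n \<in> sets lborel\<close> in \<open>auto simp: Diff_triv Int_commute\<close>)
    moreover have "measure lborel (V n \<union> ?W) \<le> measure lborel {0..3::real}"
      by (rule measure_mono_fmeasurable) (use sub Wm \<open>V n \<in> sets lborel\<close> in \<open>auto simp: fmeasurable_def\<close>)
    ultimately show False using n Wmeas by simp
  qed
  then obtain w where "w \<in> W n" "u n + w \<in> V n" by auto
  then have "\<bar>f (x n + u n + w) - f (x n + u n)\<bar> < e/2" "\<bar>f (x n + (u n + w)) - f (x n)\<bar> < e/2"
    by (auto simp: V_def W_def)
  with xu(3)[of n] show False by (auto simp: add.assoc abs_if split: if_splits)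
qed

text \<open>Walk from x0 to x in unit steps, each costing less than e/2 by uniformity. The remaining
  e/2 * x eventually absorbs the initial value and the last partial step.\<close>

lemma slow_variation_sublinear:
  fixes f :: "real \<Rightarrow> real"
  assumes "f \<in> borel_measurable borel"
    and "\<And>u. ((\<lambda>x. f (x + u) - f x) \<longlongrightarrow> 0) at_top" and e: "e > 0"
  shows "eventually (\<lambda>x. \<bar>f x\<bar> \<le> e * x) at_top"
proof -
  obtain x0 where x0: "\<And>x u. x \<ge> x0 \<Longrightarrow> u \<in> {0..1} \<Longrightarrow> \<bar>f (x + u) - f x\<bar> < e/2"
    using slow_variation_uniform[OF assms(1,2), of "e/2"] e by (meson half_gt_zero)
  have step: "\<bar>f (x0 + real n)\<bar> \<le> \<bar>f x0\<bar> + real n * (e/2)" for n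
  proof (induction n)
    case (Suc n)
    have "\<bar>f (x0 + real n + 1) - f (x0 + real n)\<bar> < e/2" by (rule x0) auto
    moreover have "real (Suc n) * (e/2) = real n * (e/2) + e/2" by (simp add: field_simps)
    moreover have "x0 + real (Suc n) = x0 + real n + 1" by simp
    ultimately show ?case using Suc by (simp only:)
  qed simp
  have bound: "\<bar>f x\<bar> \<le> \<bar>f x0\<bar> + (x - x0 + 1) * (e/2)" if "x \<ge> x0" for x
  proof -
    define n where "n = nat \<lfloor>x - x0\<rfloor>"
    have n: "real n \<le> x - x0" "x - x0 - real n \<in> {0..1}" using that unfolding n_def by auto linarith+
    have "\<bar>f (x0 + real n + (x - x0 - real n)) - f (x0 + real n)\<bar> < e/2"
      by (rule x0) (use n in auto)
    moreover have "real n * (e/2) \<le> (x - x0) * (e/2)" using n e by (intro mult_right_mono) auto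
    moreover have "x0 + real n + (x - x0 - real n) = x" by simp
    moreover have "(x - x0 + 1) * (e/2) = (x - x0) * (e/2) + e/2" by (simp add: field_simps)
    ultimately show ?thesis using step[of n] by (simp only:)
  qed
  have "eventually (\<lambda>x. x \<ge> x0 \<and> \<bar>f x0\<bar> + (1 - x0) * (e/2) \<le> e/2 * x) at_top"
  proof (intro eventually_conj eventually_ge_at_top)
    have "filterlim (\<lambda>x. e/2 * x) at_top at_top"
      by (intro filterlim_tendsto_pos_mult_at_top[OF tendsto_const] filterlim_ident) (use e in auto)
    then show "eventually (\<lambda>x. \<bar>f x0\<bar> + (1 - x0) * (e/2) \<le> e/2 * x) at_top"
      unfolding filterlim_at_top by blast
  qed
  then show ?thesis
  proof eventually_elim
    case (elim x)
    moreover have "(x - x0 + 1) * (e/2) = e/2 * x + (1 - x0) * (e/2)" "e * x = e/2 * x + e/2 * x"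
      by (simp_all add: field_simps)
    ultimately show ?case using bound[of x] by linarith
  qed
qed

text \<open>Under f = ln \<circ> L \<circ> exp multiplicative slow variation becomes additive, and
  sublinear growth of f is exactly a power bound for L.\<close>

lemma slowly_varying_powr_bounds:
  assumes L: "slowly_varying L" and e: "e > 0"
  shows "eventually (\<lambda>x. x powr - e \<le> L x \<and> L x \<le> x powr e) at_top"
proof -
  have [measurable]: "L \<in> borel_measurable borel" and pos: "eventually (\<lambda>x. L x > 0) at_top"
    and ratio: "\<And>c. c > 0 \<Longrightarrow> ((\<lambda>x. L (c * x) / L x) \<longlongrightarrow> 1) at_top"
    using L by (auto simp: slowly_varying_def)
  define f where "f x = ln (L (exp x))" for x
  have [measurable]: "f \<in> borel_measurable borel" unfolding f_def by measurable
  have posf: "eventually (\<lambda>x. L (exp x) > 0) at_top"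
    using eventually_compose_filterlim[OF pos exp_at_top] .
  have "((\<lambda>x. f (x + u) - f x) \<longlongrightarrow> 0) at_top" for u
  proof -
    have "((\<lambda>x. ln (L (exp u * exp x) / L (exp x))) \<longlongrightarrow> ln 1) at_top"
      by (intro tendsto_ln filterlim_compose[OF ratio exp_at_top]) auto
    moreover have "eventually (\<lambda>x. L (exp (x + u)) > 0) at_top"
      by (rule eventually_compose_filterlim[OF posf]) real_asymp
    then have "eventually (\<lambda>x. ln (L (exp u * exp x) / L (exp x)) = f (x + u) - f x) at_top"
      using posf by eventually_elim (simp add: f_def ln_div exp_add mult.commute)
    ultimately show ?thesis by (simp add: tendsto_cong)
  qed
  from slow_variation_sublinear[OF _ this e]
  have "eventually (\<lambda>x. \<bar>f x\<bar> \<le> e * x) at_top" by simp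
  from eventually_compose_filterlim[OF this ln_at_top]
  have "eventually (\<lambda>x. \<bar>f (ln x)\<bar> \<le> e * ln x) at_top" .
  then show ?thesis using pos eventually_gt_at_top[of 0]
  proof eventually_elim
    case (elim x)
    then have "\<bar>ln (L x)\<bar> \<le> e * ln x" by (simp add: f_def)
    then have "exp (- (e * ln x)) \<le> exp (ln (L x)) \<and> exp (ln (L x)) \<le> exp (e * ln x)"
      by auto
    then show ?case using elim by (simp add: powr_def)
  qed
qed

lemma cesaro_mean:
  fixes d :: "nat \<Rightarrow> real"
  assumes "d \<longlonglongrightarrow> l"
  shows "(\<lambda>n. (\<Sum>k<n. d k) / real n) \<longlonglongrightarrow> l"
proof (rule LIMSEQ_I)
  fix r :: real assume r: "r > 0"
  obtain N where N: "\<And>k. k \<ge> N \<Longrightarrow> \<bar>d k - l\<bar> < r/2"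
    using LIMSEQ_D[OF assms, of "r/2"] r by auto
  define B where "B = (\<Sum>k<N. \<bar>d k - l\<bar>)"
  obtain m :: nat where m: "B / (r/2) < real m" using reals_Archimedean2 by blast
  show "\<exists>no. \<forall>n\<ge>no. norm ((\<Sum>k<n. d k) / real n - l) < r"
  proof (intro exI allI impI)
    fix n assume n: "n \<ge> max (Suc N) (Suc m)"
    then have n0: "real n > 0" by simp
    have "(\<Sum>k<n. d k) / real n - l = (\<Sum>k<n. d k - l) / real n"
      using n0 by (simp add: sum_subtractf field_simps)
    moreover have "\<bar>\<Sum>k<n. d k - l\<bar> \<le> (\<Sum>k<n. \<bar>d k - l\<bar>)" by (rule sum_abs)
    moreover have "(\<Sum>k<n. \<bar>d k - l\<bar>) = B + (\<Sum>k\<in>{N..<n}. \<bar>d k - l\<bar>)"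
      unfolding B_def using n by (subst sum.union_disjoint[symmetric]) (auto intro!: sum.cong)
    moreover have "(\<Sum>k\<in>{N..<n}. \<bar>d k - l\<bar>) \<le> (\<Sum>k\<in>{N..<n}. r/2)"
      by (intro sum_mono) (use N in \<open>auto intro: less_imp_le\<close>)
    moreover have "(\<Sum>k\<in>{N..<n}. r/2) \<le> real n * (r/2)" using r by simp
    moreover have "B < r/2 * real n"
    proof -
      have "B < r/2 * real m" using m r by (simp add: field_simps)
      also have "\<dots> \<le> r/2 * real n" using n r by (intro mult_left_mono) auto
      finally show ?thesis .
    qed
    moreover have "real n * (r/2) + r/2 * real n = r * real n" by (simp add: field_simps)
    ultimately have "\<bar>\<Sum>k<n. d k - l\<bar> < r * real n" by linarith
    then show "norm ((\<Sum>k<n. d k) / real n - l) < r"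
      using n0 \<open>_ = (\<Sum>k<n. d k - l) / real n\<close> by (simp add: field_simps)
  qed
qed

section \<open>Sums of the coefficients under short and long memory\<close>

lemma regularly_varying_abs_summable:
  fixes a :: "nat \<Rightarrow> real"
  assumes L: "slowly_varying L" and H: "H < 1/2"
    and a: "\<forall>k\<ge>1. a k = real k powr (H - 3/2) * L (real k)"
  shows "summable (\<lambda>k. \<bar>a k\<bar>)"
proof -
  \<comment> \<open>Half the gap between H and 1/2: a factor \<open>k powr e\<close> from L then
    leaves the exponent strictly below -1.\<close>
  define e where "e = (1/2 - H) / 2"
  have e: "e > 0" "H - 3/2 + e < -1" using H by (auto simp: e_def field_simps)
  have "eventually (\<lambda>k. real k powr - e \<le> L (real k) \<and> L (real k) \<le> real k powr e) sequentially"
    by (rule eventually_compose_filterlim[OF slowly_varying_powr_bounds[OF L e(1)] filterlim_real_sequentially])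
  then have "eventually (\<lambda>k. norm (\<bar>a k\<bar>) \<le> real k powr (H - 3/2 + e)) sequentially"
    using eventually_ge_at_top[of 1]
  proof eventually_elim
    case (elim k)
    then have "L (real k) \<ge> 0" by (meson powr_ge_zero order_trans)
    then show ?case using elim a
      by (auto simp: abs_mult powr_add intro!: mult_left_mono)
  qed
  then show ?thesis
    by (rule summable_comparison_test_ev) (use e in \<open>simp add: summable_real_powr_iff\<close>)
qed

text \<open>For H > 1/2 the coefficients eventually dominate those of the harmonic series, so the
  partial sums diverge to infinity. The value 1 is all that the lower bound for \<sigma>_n
  requires.\<close>

lemma regularly_varying_partial_sums_ge_1:
  fixes a :: "nat \<Rightarrow> real"
  assumes L: "slowly_varying L" and H: "1/2 < H"
    and a: "\<forall>k\<ge>1. a k = real k powr (H - 3/2) * L (real k)"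
  shows "eventually (\<lambda>m. (\<Sum>i\<le>m. a i) \<ge> 1) sequentially"
proof -
  \<comment> \<open>With this e the exponents H - 3/2 and -e add up to exactly -1.\<close>
  define e where "e = H - 1/2"
  have e: "e > 0" using H by (auto simp: e_def field_simps)
  have "eventually (\<lambda>k. real k powr - e \<le> L (real k) \<and> L (real k) \<le> real k powr e) sequentially"
    by (rule eventually_compose_filterlim[OF slowly_varying_powr_bounds[OF L e(1)] filterlim_real_sequentially])
  then have "eventually (\<lambda>k. a k \<ge> 1 / real k) sequentially"
    using eventually_ge_at_top[of 1]
  proof eventually_elim
    case (elim k)
    have "1 / real k = real k powr (H - 3/2) * real k powr (-e)"
    proof -
      have "real k powr (H - 3/2) * real k powr (-e) = real k powr (-1)"
        unfolding powr_add[symmetric] e_def by simp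
      then show ?thesis using elim by (simp add: powr_minus_divide)
    qed
    also have "\<dots> \<le> a k" using elim a by (auto intro!: mult_left_mono)
    finally show ?case .
  qed
  then obtain N where N: "\<And>k. k \<ge> N \<Longrightarrow> a k \<ge> 1 / real k" by (auto simp: eventually_sequentially)
  \<comment> \<open>Discards the finitely many coefficients whose sign is not controlled, so that
    nonnegative series can be used; the constant B below compensates for them.\<close>
  define c where "c k = (if k \<le> N then 0 else a k)" for k
  have cpos: "c k \<ge> 0" for k using N[of k] by (auto simp: c_def intro: order_trans[rotated])
  have "\<not> summable c"
  proof
    assume "summable c"
    moreover have "eventually (\<lambda>k. norm (1 / real k) \<le> c k) sequentially"
      using eventually_gt_at_top[of N] by eventually_elim (use N in \<open>auto simp: c_def\<close>)
    ultimately have "summable (\<lambda>k. 1 / real k)" by (rule summable_comparison_test_ev[rotated])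
    then show False using not_summable_harmonic[where 'a=real] by (simp add: inverse_eq_divide)
  qed
  then have "\<not> bounded (range (\<lambda>m. \<Sum>i<m. c i))"
    using cpos by (metis summableI_nonneg_bounded bounded_iff rangeI real_norm_def abs_le_D1)
  define B where "B = 1 + \<bar>\<Sum>i\<le>N. a i\<bar>"
  have "\<exists>m. (\<Sum>i<m. c i) > B"
  proof (rule ccontr)
    assume "\<nexists>m. (\<Sum>i<m. c i) > B"
    then have "\<And>m. (\<Sum>i<m. c i) \<le> B" by (auto simp: not_less)
    then have "summable c" using cpos by (intro summableI_nonneg_bounded[of c B]) auto
    with \<open>\<not> summable c\<close> show False by simp
  qed
  then obtain m0 where m0: "(\<Sum>i<m0. c i) > B" by blast
  have "eventually (\<lambda>m. m \<ge> max N m0) sequentially" by (rule eventually_ge_at_top)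
  then show ?thesis
  proof eventually_elim
    case (elim m)
    have "(\<Sum>i\<le>m. a i) = (\<Sum>i\<le>N. a i) + (\<Sum>i\<in>{N<..m}. a i)"
      using elim by (subst sum.union_disjoint[symmetric]) (auto intro!: sum.cong)
    also have "(\<Sum>i\<in>{N<..m}. a i) = (\<Sum>i\<le>m. c i)"
      by (rule sum.mono_neutral_cong_left) (auto simp: c_def)
    finally have "(\<Sum>i\<le>m. a i) = (\<Sum>i\<le>N. a i) + (\<Sum>i\<le>m. c i)" .
    moreover have "(\<Sum>i<m0. c i) \<le> (\<Sum>i\<le>m. c i)"
      by (intro sum_mono2) (use elim cpos in auto)
    ultimately show ?case using m0 unfolding B_def by linarith
  qed
qed

section \<open>Independence and series of independent random variables\<close>

lemma measurable_of_coarser: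
  assumes "f \<in> measurable N K" "space N = space M" "sets N \<subseteq> sets M"
  shows "f \<in> measurable M K"
  using assms by (auto simp: measurable_def)

text \<open>\<open>generated_sigma\<close> with an arbitrary index type, so that it serves both the
  processes indexed by integers and the sequences of summands indexed by naturals.\<close>

definition sigma_of :: "'a measure \<Rightarrow> ('i \<Rightarrow> 'a \<Rightarrow> 'b::topological_space) \<Rightarrow> 'i set \<Rightarrow> 'a measure" where
  "sigma_of M Z I = sigma (space M) (\<Union>i\<in>I. {Z i -` B \<inter> space M | B. B \<in> sets borel})"

lemma generated_sigma_eq: "generated_sigma = sigma_of"
  by (intro ext) (simp add: generated_sigma_def sigma_of_def)

lemma space_sigma_of [simp]: "space (sigma_of M Z I) = space M"
  unfolding sigma_of_def by (rule space_measure_of_conv)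

lemma sets_sigma_of:
  "sets (sigma_of M Z I) = sigma_sets (space M) (\<Union>i\<in>I. {Z i -` B \<inter> space M | B. B \<in> sets borel})"
  unfolding sigma_of_def by (rule sets_measure_of) auto

lemma measurable_sigma_of:
  fixes Z :: "'i \<Rightarrow> 'a \<Rightarrow> 'b::topological_space"
  assumes "i \<in> I" shows "Z i \<in> borel_measurable (sigma_of M Z I)"
proof (rule measurableI)
  fix B :: "'b set" assume "B \<in> sets borel"
  then show "Z i -` B \<inter> space (sigma_of M Z I) \<in> sets (sigma_of M Z I)"
    using assms unfolding sets_sigma_of space_sigma_of by (intro sigma_sets.Basic) blast
qed simp

lemma sigma_of_least:
  assumes "space N = space M" "\<And>i. i \<in> I \<Longrightarrow> Z i \<in> borel_measurable N"
  shows "sets (sigma_of M Z I) \<subseteq> sets N"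
  unfolding sets_sigma_of assms(1)[symmetric]
proof (rule sets.sigma_sets_subset)
  show "(\<Union>i\<in>I. {Z i -` B \<inter> space N |B. B \<in> sets borel}) \<subseteq> sets N"
    using measurable_sets[OF assms(2)] by blast
qed

lemma sigma_of_mono: "I \<subseteq> J \<Longrightarrow> sets (sigma_of M Z I) \<subseteq> sets (sigma_of M Z J)"
  by (rule sigma_of_least) (simp_all add: measurable_sigma_of subsetD)

lemma measurable_sigma_of_mono:
  "f \<in> measurable (sigma_of M Z I) K \<Longrightarrow> I \<subseteq> J \<Longrightarrow> f \<in> measurable (sigma_of M Z J) K"
  by (erule measurable_of_coarser) (simp_all add: sigma_of_mono)

section \<open>Independence of blocks and almost sure convergence of series\<close>

context prob_space
begin

lemma indep_vars_inj:
  assumes indep: "indep_vars (\<lambda>_. N) Z UNIV" and h: "inj h"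
  shows "indep_vars (\<lambda>_. N) (\<lambda>i. Z (h i)) UNIV"
proof -
  have rv: "random_variable N (Z i)" for i using indep by (simp add: indep_vars_def2)
  note ind = indep[unfolded indep_vars_def2, THEN conjunct2]
  have "indep_sets (\<lambda>i. {Z (h i) -` A \<inter> space M |A. A \<in> sets N}) UNIV"
  proof (rule indep_setsI)
    show "{Z (h i) -` A \<inter> space M |A. A \<in> sets N} \<subseteq> events" for i
      using measurable_sets[OF rv] by blast
    fix A J assume J: "J \<noteq> {}" "finite J" "\<forall>j\<in>J. A j \<in> {Z (h j) -` A \<inter> space M |A. A \<in> sets N}"
    have inv: "inv h (h j) = j" for j using h by simp
    have "prob (\<Inter>j\<in>h ` J. A (inv h j)) = (\<Prod>j\<in>h ` J. prob (A (inv h j)))"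
      by (rule indep_setsD[OF ind]) (use J inv in auto)
    also have "(\<Prod>j\<in>h ` J. prob (A (inv h j))) = (\<Prod>j\<in>J. prob (A j))"
      using inj_on_subset[OF h, of J] by (simp add: prod.reindex inv)
    finally show "prob (\<Inter>j\<in>J. A j) = (\<Prod>j\<in>J. prob (A j))" by (simp add: inv)
  qed
  then show ?thesis using rv by (simp add: indep_vars_def2)
qed

lemma indep_set_sigma_of:
  assumes "indep_vars (\<lambda>_. borel) Z UNIV" "A \<inter> B = {}"
  shows "indep_set (sets (sigma_of M Z A)) (sets (sigma_of M Z B))"
proof -
  have "indep_sets (\<lambda>j. sigma_sets (space M) (\<Union>i\<in>case_bool A B j. {Z i -` S \<inter> space M | S. S \<in> sets borel})) UNIV"
  proof (rule indep_sets_collect_sigma)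
    show "indep_sets (\<lambda>i. {Z i -` S \<inter> space M |S. S \<in> sets borel}) (\<Union> (range (case_bool A B)))"
      by (rule indep_sets_mono_index[OF subset_UNIV]) (use assms(1) in \<open>simp add: indep_vars_def2\<close>)
    show "Int_stable {Z i -` S \<inter> space M |S. S \<in> sets borel}" for i
    proof (rule Int_stableI)
      fix a b assume "a \<in> {Z i -` S \<inter> space M |S. S \<in> sets borel}" "b \<in> {Z i -` S \<inter> space M |S. S \<in> sets borel}"
      then obtain S T where "S \<in> sets borel" "T \<in> sets borel" "a \<inter> b = Z i -` (S \<inter> T) \<inter> space M" by blast
      then show "a \<inter> b \<in> {Z i -` S \<inter> space M |S. S \<in> sets borel}" by blast
    qed
    show "disjoint_family (case_bool A B)"
      using assms(2) by (auto simp: disjoint_family_on_def split: bool.splits)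
  qed
  then show ?thesis unfolding indep_set_def
    by (rule indep_sets_mono_sets) (auto simp: sets_sigma_of split: bool.splits)
qed

lemma indep_var_of_indep_set:
  assumes "indep_set (sets A) (sets B)" "space A = space M" "space B = space M"
    and "U \<in> measurable A S" "V \<in> measurable B T"
  shows "indep_var S U T V"
proof -
  have sub: "sets A \<subseteq> events" "sets B \<subseteq> events"
    using assms(1) by (auto dest: indep_setD_ev1 indep_setD_ev2)
  have "sigma_sets (space M) {U -` C \<inter> space M |C. C \<in> sets S} \<subseteq> sets A"
    unfolding assms(2)[symmetric] by (rule sets.sigma_sets_subset) (use measurable_sets[OF assms(4)] in blast)
  moreover have "sigma_sets (space M) {V -` C \<inter> space M |C. C \<in> sets T} \<subseteq> sets B"
    unfolding assms(3)[symmetric] by (rule sets.sigma_sets_subset) (use measurable_sets[OF assms(5)] in blast)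
  ultimately have "indep_set (sigma_sets (space M) {U -` C \<inter> space M |C. C \<in> sets S})
      (sigma_sets (space M) {V -` C \<inter> space M |C. C \<in> sets T})"
    using assms(1) unfolding indep_sets2_eq by blast
  moreover have "random_variable S U" "random_variable T V"
    using sub assms by (auto intro: measurable_of_coarser)
  ultimately show ?thesis by (simp add: indep_var_eq)
qed

lemma indep_var_disjoint:
  assumes "indep_vars (\<lambda>_. borel) Z UNIV" "A \<inter> B = {}"
    and "U \<in> measurable (sigma_of M Z A) S" "V \<in> measurable (sigma_of M Z B) T"
  shows "indep_var S U T V"
  by (rule indep_var_of_indep_set[OF indep_set_sigma_of[OF assms(1,2)]]) (use assms in auto)

text \<open>Unlike \<^term>\<open>indep_var\<close>, this allows random variables with values in different types.\<close>

lemma distr_pair_of_indep_set: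
  assumes ind: "indep_set (sets A) (sets B)" and sp: "space A = space M" "space B = space M"
    and U: "U \<in> measurable A S" and V: "V \<in> measurable B T"
  shows "distr M S U \<Otimes>\<^sub>M distr M T V = distr M (S \<Otimes>\<^sub>M T) (\<lambda>\<omega>. (U \<omega>, V \<omega>))"
proof -
  have [measurable]: "U \<in> measurable M S" "V \<in> measurable M T"
    using indep_setD_ev1[OF ind] indep_setD_ev2[OF ind] sp U V by (auto intro: measurable_of_coarser)
  interpret S: prob_space "distr M S U" by (rule prob_space_distr) simp
  interpret T: prob_space "distr M T V" by (rule prob_space_distr) simp
  show ?thesis
  proof (rule pair_measure_eqI)
    show "sigma_finite_measure (distr M S U)" "sigma_finite_measure (distr M T V)" ..
    show "sets (distr M S U \<Otimes>\<^sub>M distr M T V) = sets (distr M (S \<Otimes>\<^sub>M T) (\<lambda>\<omega>. (U \<omega>, V \<omega>)))"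
      by (simp cong: sets_pair_measure_cong)
    fix C D assume CD: "C \<in> sets (distr M S U)" "D \<in> sets (distr M T V)"
    have "(\<lambda>\<omega>. (U \<omega>, V \<omega>)) -` (C \<times> D) \<inter> space M = (U -` C \<inter> space M) \<inter> (V -` D \<inter> space M)" by auto
    moreover have "U -` C \<inter> space M \<in> sets A" "V -` D \<inter> space M \<in> sets B"
      using CD measurable_sets[OF U] measurable_sets[OF V] sp by auto
    ultimately show "emeasure (distr M S U) C * emeasure (distr M T V) D =
        emeasure (distr M (S \<Otimes>\<^sub>M T) (\<lambda>\<omega>. (U \<omega>, V \<omega>))) (C \<times> D)"
      using CD indep_setD[OF ind] by (simp add: emeasure_distr emeasure_eq_measure ennreal_mult')
  qed
qed

lemma prob_indep_conj:
  assumes "indep_var S U T V" "{x\<in>space S. P x} \<in> sets S" "{x\<in>space T. Q x} \<in> sets T"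
  shows "prob {\<omega>\<in>space M. P (U \<omega>) \<and> Q (V \<omega>)} = prob {\<omega>\<in>space M. P (U \<omega>)} * prob {\<omega>\<in>space M. Q (V \<omega>)}"
proof -
  have UV: "U \<in> measurable M S" "V \<in> measurable M T" using assms(1) by (auto dest: indep_var_rv1 indep_var_rv2)
  have e: "{\<omega>\<in>space M. P (U \<omega>) \<and> Q (V \<omega>)} = (\<lambda>x. (U x, V x)) -` ({x\<in>space S. P x} \<times> {x\<in>space T. Q x}) \<inter> space M"
    "{\<omega>\<in>space M. P (U \<omega>)} = U -` {x\<in>space S. P x} \<inter> space M"
    "{\<omega>\<in>space M. Q (V \<omega>)} = V -` {x\<in>space T. Q x} \<inter> space M"
    using UV[THEN measurable_space] by auto
  show ?thesis unfolding e by (rule indep_varD[OF assms])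
qed

text \<open>Decompose by the first k at which the partial sum exceeds 2c. The sum from k to n is
  independent of that event and stays within c with probability at least 1/2, in which case the full
  sum still exceeds c. Each first passage event thus costs a factor 2.\<close>

lemma ottaviani_inequality:
  fixes Y :: "nat \<Rightarrow> 'a \<Rightarrow> real"
  assumes indep: "indep_vars (\<lambda>_. borel) Y UNIV"
    and tail: "\<And>k. k \<le> n \<Longrightarrow> prob {\<omega>\<in>space M. \<bar>\<Sum>i\<in>{k..<n}. Y i \<omega>\<bar> > c} \<le> 1/2"
  shows "prob {\<omega>\<in>space M. \<exists>k\<le>n. \<bar>\<Sum>i<k. Y i \<omega>\<bar> > 2 * c} \<le> 2 * prob {\<omega>\<in>space M. \<bar>\<Sum>i<n. Y i \<omega>\<bar> > c}"
proof -
  have [measurable]: "Y i \<in> borel_measurable M" for i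
    using indep by (auto simp: indep_vars_def)
  define first where "first k \<omega> \<longleftrightarrow> \<bar>\<Sum>i<k. Y i \<omega>\<bar> > 2 * c \<and> (\<forall>j<k. \<bar>\<Sum>i<j. Y i \<omega>\<bar> \<le> 2 * c)" for k \<omega>
  define A where "A k = {\<omega>\<in>space M. first k \<omega>}" for k
  define B where "B k = {\<omega>\<in>space M. \<bar>\<Sum>i\<in>{k..<n}. Y i \<omega>\<bar> \<le> c}" for k
  have [measurable]: "A k \<in> events" "B k \<in> events" for k unfolding A_def B_def first_def by measurable
  have "\<not> (first j \<omega> \<and> first k \<omega>)" if "j \<noteq> k" for j k \<omega>
    using that by (cases j k rule: linorder_cases) (force simp: first_def)+
  then have disj: "disjoint_family_on A {..n}" "disjoint_family_on (\<lambda>k. A k \<inter> B k) {..n}"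
    unfolding disjoint_family_on_def A_def by blast+
  have AB: "prob (A k \<inter> B k) = prob (A k) * prob (B k)" if "k \<le> n" for k
  proof -
    let ?N = "sigma_of M Y {..<k}"
    have S: "(\<lambda>\<omega>. \<Sum>i<j. Y i \<omega>) \<in> borel_measurable ?N" if "j \<le> k" for j
      by (intro borel_measurable_sum measurable_sigma_of) (use that in auto)
    have "{\<omega>\<in>space ?N. first k \<omega>} = {\<omega>\<in>space ?N. \<bar>\<Sum>i<k. Y i \<omega>\<bar> > 2 * c} \<inter>
        {\<omega>\<in>space ?N. \<forall>j\<in>{..<k}. \<bar>\<Sum>i<j. Y i \<omega>\<bar> \<le> 2 * c}"
      unfolding first_def by auto
    also have "\<dots> \<in> sets ?N"
    proof (rule sets.Int)
      note [measurable] = S[OF order_refl]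
      show "{\<omega>\<in>space ?N. \<bar>\<Sum>i<k. Y i \<omega>\<bar> > 2 * c} \<in> sets ?N" by measurable
      show "{\<omega>\<in>space ?N. \<forall>j\<in>{..<k}. \<bar>\<Sum>i<j. Y i \<omega>\<bar> \<le> 2 * c} \<in> sets ?N"
      proof (rule sets.sets_Collect_finite_All)
        fix j assume "j \<in> {..<k}"
        then have [measurable]: "(\<lambda>\<omega>. \<Sum>i<j. Y i \<omega>) \<in> borel_measurable ?N" by (intro S) auto
        show "{\<omega>\<in>space ?N. \<bar>\<Sum>i<j. Y i \<omega>\<bar> \<le> 2 * c} \<in> sets ?N" by measurable
      qed auto
    qed
    finally have "{\<omega>\<in>space ?N. first k \<omega>} \<in> sets ?N" .
    \<comment> \<open>The first passage event is coded by a real indicator because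
      \<open>indep_var\<close> takes two variables with values in the same type.\<close>
    then have U: "indicator (A k) \<in> borel_measurable ?N" by (simp add: A_def)
    have V: "(\<lambda>\<omega>. \<Sum>i\<in>{k..<n}. Y i \<omega>) \<in> borel_measurable (sigma_of M Y {k..<n})"
      by (intro borel_measurable_sum measurable_sigma_of) auto
    have "indep_var borel (indicator (A k) :: 'a \<Rightarrow> real) borel (\<lambda>\<omega>. \<Sum>i\<in>{k..<n}. Y i \<omega>)"
      by (rule indep_var_disjoint[OF indep _ U V]) auto
    from prob_indep_conj[OF this, of "\<lambda>x. x = 1" "\<lambda>x. \<bar>x\<bar> \<le> c"]
    have "prob {\<omega>\<in>space M. indicator (A k) \<omega> = (1::real) \<and> \<bar>\<Sum>i\<in>{k..<n}. Y i \<omega>\<bar> \<le> c} =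
      prob {\<omega>\<in>space M. indicator (A k) \<omega> = (1::real)} * prob (B k)" by (simp add: B_def)
    moreover have "{\<omega>\<in>space M. indicator (A k) \<omega> = (1::real) \<and> \<bar>\<Sum>i\<in>{k..<n}. Y i \<omega>\<bar> \<le> c} = A k \<inter> B k"
      "{\<omega>\<in>space M. indicator (A k) \<omega> = (1::real)} = A k"
      by (auto simp: A_def B_def indicator_def)
    ultimately show ?thesis by simp
  qed
  have Bhalf: "prob (B k) \<ge> 1/2" if "k \<le> n" for k
  proof -
    have "B k = space M - {\<omega>\<in>space M. \<bar>\<Sum>i\<in>{k..<n}. Y i \<omega>\<bar> > c}" by (auto simp: B_def)
    then have "prob (B k) = 1 - prob {\<omega>\<in>space M. \<bar>\<Sum>i\<in>{k..<n}. Y i \<omega>\<bar> > c}"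
      by (simp add: prob_compl)
    then show ?thesis using tail[OF that] by simp
  qed
  have "{\<omega>\<in>space M. \<exists>k\<le>n. \<bar>\<Sum>i<k. Y i \<omega>\<bar> > 2 * c} \<subseteq> (\<Union>k\<le>n. A k)"
  proof safe
    fix \<omega> k assume k: "\<omega> \<in> space M" "k \<le> n" "\<bar>\<Sum>i<k. Y i \<omega>\<bar> > 2 * c"
    define m where "m = (LEAST k. \<bar>\<Sum>i<k. Y i \<omega>\<bar> > 2 * c)"
    have "\<bar>\<Sum>i<m. Y i \<omega>\<bar> > 2 * c" unfolding m_def using k(3) by (rule LeastI)
    moreover have "\<forall>j<m. \<not> \<bar>\<Sum>i<j. Y i \<omega>\<bar> > 2 * c" unfolding m_def using not_less_Least by blast
    moreover have "m \<le> k" unfolding m_def using k(3) by (rule Least_le)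
    ultimately show "\<omega> \<in> (\<Union>k\<le>n. A k)" using k by (auto simp: A_def first_def not_less intro!: bexI[of _ m])
  qed
  then have "prob {\<omega>\<in>space M. \<exists>k\<le>n. \<bar>\<Sum>i<k. Y i \<omega>\<bar> > 2 * c} \<le> prob (\<Union>k\<le>n. A k)"
    by (rule finite_measure_mono) measurable
  also have "\<dots> = (\<Sum>k\<le>n. prob (A k))"
    by (rule finite_measure_finite_Union) (use disj in auto)
  also have "\<dots> \<le> (\<Sum>k\<le>n. 2 * prob (A k \<inter> B k))"
  proof (rule sum_mono)
    fix k assume "k \<in> {..n}"
    then have "prob (A k) * (1/2) \<le> prob (A k) * prob (B k)" by (intro mult_left_mono Bhalf) auto
    then show "prob (A k) \<le> 2 * prob (A k \<inter> B k)" using AB \<open>k \<in> {..n}\<close> by simp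
  qed
  also have "\<dots> = 2 * prob (\<Union>k\<le>n. A k \<inter> B k)"
    unfolding sum_distrib_left[symmetric]
    by (subst finite_measure_finite_Union) (use disj in auto)
  also have "prob (\<Union>k\<le>n. A k \<inter> B k) \<le> prob {\<omega>\<in>space M. \<bar>\<Sum>i<n. Y i \<omega>\<bar> > c}"
  proof (rule finite_measure_mono)
    show "(\<Union>k\<le>n. A k \<inter> B k) \<subseteq> {\<omega>\<in>space M. \<bar>\<Sum>i<n. Y i \<omega>\<bar> > c}"
    proof safe
      fix \<omega> k assume k: "k \<le> n" "\<omega> \<in> A k" "\<omega> \<in> B k"
      have "(\<Sum>i<n. Y i \<omega>) = (\<Sum>i<k. Y i \<omega>) + (\<Sum>i\<in>{k..<n}. Y i \<omega>)"
        using k(1) by (subst sum.union_disjoint[symmetric]) (auto intro!: sum.cong)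
      with k show "\<bar>\<Sum>i<n. Y i \<omega>\<bar> > c" unfolding A_def B_def first_def by auto
    qed (auto simp: A_def)
  qed measurable
  finally show ?thesis by simp
qed

lemma expectation_sum_squared:
  fixes Y :: "'i \<Rightarrow> 'a \<Rightarrow> real"
  assumes indep: "indep_vars (\<lambda>_. borel) Y UNIV"
    and int: "\<And>i. integrable M (Y i)" and mean: "\<And>i. expectation (Y i) = 0"
    and sq: "\<And>i. integrable M (\<lambda>\<omega>. (Y i \<omega>)\<^sup>2)" and "finite I"
  shows "integrable M (\<lambda>\<omega>. (\<Sum>i\<in>I. Y i \<omega>)\<^sup>2)"
    and "expectation (\<lambda>\<omega>. (\<Sum>i\<in>I. Y i \<omega>)\<^sup>2) = (\<Sum>i\<in>I. expectation (\<lambda>\<omega>. (Y i \<omega>)\<^sup>2))"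
proof -
  have ind: "indep_var borel (Y i) borel (Y j)" if "i \<noteq> j" for i j
    by (rule indep_var_disjoint[OF indep, of "{i}" "{j}"]) (use that in \<open>auto intro: measurable_sigma_of\<close>)
  have int2: "integrable M (\<lambda>\<omega>. Y i \<omega> * Y j \<omega>)" for i j
    by (cases "i = j") (use sq[of i] indep_var_integrable[OF ind int int, of i j] in \<open>auto simp: power2_eq_square\<close>)
  have orth: "expectation (\<lambda>\<omega>. Y i \<omega> * Y j \<omega>) = (if i = j then expectation (\<lambda>\<omega>. (Y i \<omega>)\<^sup>2) else 0)" for i j
    using indep_var_lebesgue_integral[OF ind int int, of i j] by (auto simp: mean power2_eq_square)
  have e: "(\<Sum>i\<in>I. Y i \<omega>)\<^sup>2 = (\<Sum>i\<in>I. \<Sum>j\<in>I. Y i \<omega> * Y j \<omega>)" for \<omega>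
    by (simp add: power2_eq_square sum_product)
  show "integrable M (\<lambda>\<omega>. (\<Sum>i\<in>I. Y i \<omega>)\<^sup>2)" unfolding e using int2 by auto
  show "expectation (\<lambda>\<omega>. (\<Sum>i\<in>I. Y i \<omega>)\<^sup>2) = (\<Sum>i\<in>I. expectation (\<lambda>\<omega>. (Y i \<omega>)\<^sup>2))"
    unfolding e using int2 \<open>finite I\<close> by (simp add: orth)
qed

lemma expectation_zero_sum_tail:
  fixes S :: "'a \<Rightarrow> real"
  assumes [measurable]: "S \<in> borel_measurable M" and "integrable M (\<lambda>\<omega>. (S \<omega>)\<^sup>2)" "c > 0"
  shows "prob {\<omega>\<in>space M. \<bar>S \<omega>\<bar> > c} \<le> expectation (\<lambda>\<omega>. (S \<omega>)\<^sup>2) / c\<^sup>2"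
proof -
  have "prob {\<omega>\<in>space M. \<bar>S \<omega>\<bar> > c} \<le> prob {\<omega>\<in>space M. \<bar>S \<omega>\<bar> \<ge> c}"
    by (rule finite_measure_mono) auto
  also have "\<dots> \<le> expectation (\<lambda>\<omega>. (S \<omega>)\<^sup>2) / c\<^sup>2"
    by (rule second_moment_method) (use assms in auto)
  finally show ?thesis .
qed

text \<open>Kolmogorov's criterion. It is what gives \<open>eps\<close> a meaning:
  \<open>suminf\<close> is the limit of the partial sums only at points where the series converges,
  and convergence in mean square would not identify the two.\<close>

theorem indep_series_converges_AE:
  fixes Y :: "nat \<Rightarrow> 'a \<Rightarrow> real"
  assumes indep: "indep_vars (\<lambda>_. borel) Y UNIV"
    and int: "\<And>i. integrable M (Y i)" and mean: "\<And>i. expectation (Y i) = 0"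
    and sq: "\<And>i. integrable M (\<lambda>\<omega>. (Y i \<omega>)\<^sup>2)"
    and var: "summable (\<lambda>i. expectation (\<lambda>\<omega>. (Y i \<omega>)\<^sup>2))"
  shows "AE \<omega> in M. summable (\<lambda>i. Y i \<omega>)"
proof -
  have [measurable]: "Y i \<in> borel_measurable M" for i
    using indep by (auto simp: indep_vars_def)
  define v where "v i = expectation (\<lambda>\<omega>. (Y i \<omega>)\<^sup>2)" for i
  have v0: "v i \<ge> 0" for i unfolding v_def by simp
  define V where "V m = (\<Sum>i. v (i + m))" for m
  have V: "V \<longlonglongrightarrow> 0" unfolding V_def using suminf_exist_split2[OF var[folded v_def]] .
  have vs: "summable (\<lambda>i. v (i + m))" for m using var[folded v_def] by (rule summable_ignore_initial_segment)
  have sumV: "(\<Sum>i\<in>I. v (i + m)) \<le> V m" if "finite I" for I m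
    unfolding V_def by (rule sum_le_suminf[OF vs that]) (use v0 in auto)
  \<comment> \<open>Chebyshev's inequality with the tail variance V m supplies the hypothesis of
    Ottaviani's inequality for every finite block beyond m; letting the block grow gives the
    supremum over all k.\<close>
  have block: "prob {\<omega>\<in>space M. \<exists>k. \<bar>\<Sum>i<k. Y (i + m) \<omega>\<bar> > 2 * c} \<le> 2 * (V m / c\<^sup>2)"
    if c: "c > 0" and small: "V m / c\<^sup>2 \<le> 1/2" for m c
  proof -
    have indep': "indep_vars (\<lambda>_. borel) (\<lambda>i. Y (i + m)) UNIV"
      by (rule indep_vars_inj[OF indep]) (simp add: inj_def)
    have tail: "prob {\<omega>\<in>space M. \<bar>\<Sum>i\<in>I. Y (i + m) \<omega>\<bar> > c} \<le> V m / c\<^sup>2" if "finite I" for I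
    proof -
      note * = expectation_sum_squared[OF indep' int mean sq that]
      have "prob {\<omega>\<in>space M. \<bar>\<Sum>i\<in>I. Y (i + m) \<omega>\<bar> > c} \<le> expectation (\<lambda>\<omega>. (\<Sum>i\<in>I. Y (i + m) \<omega>)\<^sup>2) / c\<^sup>2"
        by (rule expectation_zero_sum_tail) (use * c in auto)
      also have "\<dots> \<le> V m / c\<^sup>2"
        unfolding *(2) using sumV[OF that, of m] by (intro divide_right_mono) (auto simp: v_def)
      finally show ?thesis .
    qed
    define D where "D n = {\<omega>\<in>space M. \<exists>k\<le>n. \<bar>\<Sum>i<k. Y (i + m) \<omega>\<bar> > 2 * c}" for n
    have "prob (D n) \<le> 2 * (V m / c\<^sup>2)" for n
    proof -
      have "prob (D n) \<le> 2 * prob {\<omega>\<in>space M. \<bar>\<Sum>i<n. Y (i + m) \<omega>\<bar> > c}"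
        unfolding D_def by (rule ottaviani_inequality[OF indep']) (use order_trans[OF tail small] in simp)
      then show ?thesis using tail[of "{..<n}"] by simp
    qed
    moreover have "(\<lambda>n. prob (D n)) \<longlonglongrightarrow> prob (\<Union>n. D n)"
    proof (rule finite_Lim_measure_incseq)
      show "range D \<subseteq> events" unfolding D_def by auto
      show "incseq D" unfolding D_def by (intro monoI) (auto intro: order_trans)
    qed
    ultimately have "prob (\<Union>n. D n) \<le> 2 * (V m / c\<^sup>2)"
      by (intro LIMSEQ_le_const2) auto
    moreover have "(\<Union>n. D n) = {\<omega>\<in>space M. \<exists>k. \<bar>\<Sum>i<k. Y (i + m) \<omega>\<bar> > 2 * c}"
      by (auto simp: D_def)
    ultimately show ?thesis by simp
  qed
  have "AE \<omega> in M. \<exists>m. \<forall>k. \<bar>\<Sum>i<k. Y (i + m) \<omega>\<bar> \<le> 2 * c" if c: "c > 0" for c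
  proof -
    define E where "E = {\<omega>\<in>space M. \<forall>m. \<exists>k. \<bar>\<Sum>i<k. Y (i + m) \<omega>\<bar> > 2 * c}"
    have [measurable]: "E \<in> events" unfolding E_def by measurable
    have lim: "(\<lambda>m. 2 * (V m / c\<^sup>2)) \<longlonglongrightarrow> 2 * (0 / c\<^sup>2)" by (intro tendsto_intros V) (use c in auto)
    have "eventually (\<lambda>m. V m < c\<^sup>2 / 2) sequentially"
      by (rule order_tendstoD(2)[OF V]) (use c in simp)
    then have "eventually (\<lambda>m. prob E \<le> 2 * (V m / c\<^sup>2)) sequentially"
    proof eventually_elim
      case (elim m)
      have "prob E \<le> prob {\<omega>\<in>space M. \<exists>k. \<bar>\<Sum>i<k. Y (i + m) \<omega>\<bar> > 2 * c}"
        by (rule finite_measure_mono) (auto simp: E_def)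
      also have "\<dots> \<le> 2 * (V m / c\<^sup>2)"
        by (rule block[OF c]) (use elim c in \<open>simp add: field_simps\<close>)
      finally show ?case .
    qed
    then have "prob E \<le> 0" using lim by (intro tendsto_lowerbound[OF lim[simplified]]) auto
    then have "prob E = 0" using measure_nonneg[of M E] by simp
    then have "AE \<omega> in M. \<omega> \<notin> E" by (subst (asm) prob_eq_0) auto
    then show ?thesis by (rule AE_mp) (auto simp: E_def not_less intro!: AE_I2)
  qed
  \<comment> \<open>Countably many tolerances 1/(r+1), so that a single null set serves them all and
    the Cauchy criterion applies pointwise.\<close>
  then have "AE \<omega> in M. \<forall>r::nat. \<exists>m. \<forall>k. \<bar>\<Sum>i<k. Y (i + m) \<omega>\<bar> \<le> 2 * inverse (real (Suc r))"
    by (subst AE_all_countable) auto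
  then show ?thesis
  proof (rule AE_mp, intro AE_I2 impI)
    fix \<omega> assume *: "\<forall>r::nat. \<exists>m. \<forall>k. \<bar>\<Sum>i<k. Y (i + m) \<omega>\<bar> \<le> 2 * inverse (real (Suc r))"
    show "summable (\<lambda>i. Y i \<omega>)"
    proof (rule summable_Cauchy[THEN iffD2], intro allI impI)
      fix e :: real assume "e > 0"
      then have "e / 4 > 0" by simp
      from reals_Archimedean[OF this] obtain r where r: "inverse (real (Suc r)) < e / 4" ..
      from *[rule_format, of r] obtain m where m: "\<forall>k. \<bar>\<Sum>i<k. Y (i + m) \<omega>\<bar> \<le> 2 * inverse (real (Suc r))" ..
      have seg: "(\<Sum>i<k. Y (i + m) \<omega>) = sum (\<lambda>i. Y i \<omega>) {m..<k + m}" for k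
        by (rule sum.reindex_bij_witness[of _ "\<lambda>i. i - m" "\<lambda>i. i + m"]) auto
      show "\<exists>N. \<forall>p\<ge>N. \<forall>q. norm (sum (\<lambda>i. Y i \<omega>) {p..<q}) < e"
      proof (intro exI allI impI)
        fix p q assume p: "m \<le> p"
        show "norm (sum (\<lambda>i. Y i \<omega>) {p..<q}) < e"
        proof (cases "p \<le> q")
          case True
          have "sum (\<lambda>i. Y i \<omega>) {m..<p} + sum (\<lambda>i. Y i \<omega>) {p..<q} = sum (\<lambda>i. Y i \<omega>) {m..<q}"
            using p True by (rule sum.atLeastLessThan_concat)
          then show ?thesis
            using seg[of "p - m"] seg[of "q - m"] m[rule_format, of "p - m"] m[rule_format, of "q - m"] r p True
            by (simp del: of_nat_Suc)
        qed (use \<open>e > 0\<close> in auto)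
      qed
    qed
  qed
qed

end

section \<open>Linear processes\<close>

lemma xi_eq_eps: "xi a e s = eps (\<lambda>i. a (Suc i)) e s"
  by (simp add: xi_def eps_def fun_eq_iff)

locale linear_process = prob_space M for M :: "'a measure" +
  fixes e :: "int \<Rightarrow> 'a \<Rightarrow> real"
  assumes e_indep: "indep_vars (\<lambda>_. borel) e UNIV"
    and e_ident: "\<And>t. distr M borel (e t) = distr M borel (e 0)"
    and e_integrable_0: "integrable M (e 0)" and e_mean_0: "expectation (e 0) = 0"
    and e_square_0: "integrable M (\<lambda>\<omega>. (e 0 \<omega>)\<^sup>2)"
begin

text \<open>Generated by the innovations, not by the \<epsilon>. It contains the \<sigma>-field of
  the past \<epsilon> and is independent of the next innovation at once, without inverting the
  linear filter.\<close>

abbreviation past :: "int \<Rightarrow> 'a measure" where "past t \<equiv> sigma_of M e {..t}"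

definition s2 :: real where "s2 = expectation (\<lambda>\<omega>. (e 0 \<omega>)\<^sup>2)"

lemma s2_nonneg: "s2 \<ge> 0" unfolding s2_def by simp

lemma e_measurable [measurable]: "e t \<in> borel_measurable M"
  using e_indep by (auto simp: indep_vars_def)

lemma e_transfer:
  fixes f :: "real \<Rightarrow> real"
  assumes [measurable]: "f \<in> borel_measurable borel"
  shows "integrable M (\<lambda>\<omega>. f (e t \<omega>)) \<longleftrightarrow> integrable M (\<lambda>\<omega>. f (e 0 \<omega>))"
    and "expectation (\<lambda>\<omega>. f (e t \<omega>)) = expectation (\<lambda>\<omega>. f (e 0 \<omega>))"
  using integrable_distr_eq[of "e t" M borel f] integrable_distr_eq[of "e 0" M borel f]
    integral_distr[of "e t" M borel f] integral_distr[of "e 0" M borel f] e_ident[of t] by auto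

lemma e_integrable: "integrable M (e t)" and e_mean: "expectation (e t) = 0"
  and e_square: "integrable M (\<lambda>\<omega>. (e t \<omega>)\<^sup>2)" and e_s2: "expectation (\<lambda>\<omega>. (e t \<omega>)\<^sup>2) = s2"
  using e_transfer[of "\<lambda>x. x" t] e_transfer[of "\<lambda>x. x\<^sup>2" t] e_integrable_0 e_mean_0 e_square_0
  by (auto simp: s2_def)

lemma past_subset_events: "sets (past t) \<subseteq> events"
  by (rule sigma_of_least) auto

lemma measurable_past: "f \<in> measurable (past t) K \<Longrightarrow> f \<in> measurable M K"
  by (erule measurable_of_coarser) (use past_subset_events in auto)

lemma e_measurable_past: "s \<le> t \<Longrightarrow> e s \<in> borel_measurable (past t)"
  by (rule measurable_sigma_of) simp

lemma measurable_past_mono: "f \<in> measurable (past s) K \<Longrightarrow> s \<le> t \<Longrightarrow> f \<in> measurable (past t) K"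
  by (erule measurable_sigma_of_mono) auto

lemma eps_measurable_past: "eps c e t \<in> borel_measurable (past t)"
  unfolding eps_def[abs_def]
  by (intro borel_measurable_suminf borel_measurable_times borel_measurable_const e_measurable_past) simp

lemma eps_measurable [measurable]: "eps c e t \<in> borel_measurable M"
  using eps_measurable_past by (rule measurable_past)

lemma xi_measurable_past: "xi a e t \<in> borel_measurable (past t)"
  unfolding xi_eq_eps by (rule eps_measurable_past)

lemma indep_terms: "indep_vars (\<lambda>_. borel) (\<lambda>i \<omega>. c i * e (t - int i) \<omega>) UNIV"
proof -
  have "indep_vars (\<lambda>_. borel) (\<lambda>i::nat. e (t - int i)) UNIV"
    by (rule indep_vars_inj[OF e_indep]) (simp add: inj_def)
  then show ?thesis
    by (rule indep_vars_compose2[where Y = "\<lambda>i x. c i * x" and N = "\<lambda>_. borel"]) simp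
qed

lemma term_moments:
  "integrable M (\<lambda>\<omega>. c * e t \<omega>)" "expectation (\<lambda>\<omega>. c * e t \<omega>) = 0"
  "integrable M (\<lambda>\<omega>. (c * e t \<omega>)\<^sup>2)" "expectation (\<lambda>\<omega>. (c * e t \<omega>)\<^sup>2) = s2 * c\<^sup>2"
  using e_integrable[of t] e_square[of t] by (auto simp: e_mean e_s2 power_mult_distrib)

lemma partial_sum_square:
  assumes "finite I"
  shows "integrable M (\<lambda>\<omega>. (\<Sum>i\<in>I. c i * e (t - int i) \<omega>)\<^sup>2)"
    and "expectation (\<lambda>\<omega>. (\<Sum>i\<in>I. c i * e (t - int i) \<omega>)\<^sup>2) = s2 * (\<Sum>i\<in>I. (c i)\<^sup>2)"
  using expectation_sum_squared[OF indep_terms term_moments(1,2,3) assms]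
  by (simp_all add: term_moments(4) sum_distrib_left)

lemma eps_summable_AE:
  assumes "summable (\<lambda>i. (c i)\<^sup>2)"
  shows "AE \<omega> in M. summable (\<lambda>i. c i * e (t - int i) \<omega>)"
  by (rule indep_series_converges_AE[OF indep_terms term_moments(1,2,3)])
     (simp add: term_moments(4) summable_mult assms)

lemma eps_split_AE:
  assumes "summable (\<lambda>i. (c i)\<^sup>2)"
  shows "AE \<omega> in M. eps c e t \<omega> = (\<Sum>i<N. c i * e (t - int i) \<omega>) + eps (\<lambda>i. c (i + N)) e (t - int N) \<omega>"
  using eps_summable_AE[OF assms, of t]
proof (rule AE_mp, intro AE_I2 impI)
  fix \<omega> assume "summable (\<lambda>i. c i * e (t - int i) \<omega>)"
  from suminf_split_initial_segment[OF this, of N]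
  show "eps c e t \<omega> = (\<Sum>i<N. c i * e (t - int i) \<omega>) + eps (\<lambda>i. c (i + N)) e (t - int N) \<omega>"
    unfolding eps_def by (simp add: algebra_simps)
qed

lemma eps_eq_e_plus_xi_AE:
  assumes "summable (\<lambda>i. (a i)\<^sup>2)" "a 0 = 1"
  shows "AE \<omega> in M. eps a e t \<omega> = e t \<omega> + xi a e (t - 1) \<omega>"
  using eps_split_AE[OF assms(1), of t 1] assms(2) by (simp add: xi_eq_eps)

text \<open>Fatou's lemma along the partial sums. Nonnegative integrals are used because square
  integrability of the limit is itself a consequence of this bound.\<close>

lemma eps_nn_second_moment:
  assumes c: "summable (\<lambda>i. (c i)\<^sup>2)"
  shows "(\<integral>\<^sup>+\<omega>. ennreal ((eps c e t \<omega>)\<^sup>2) \<partial>M) \<le> ennreal (s2 * (\<Sum>i. (c i)\<^sup>2))"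
proof -
  define P where "P N \<omega> = (\<Sum>i<N. c i * e (t - int i) \<omega>)" for N \<omega>
  have [measurable]: "P N \<in> borel_measurable M" for N unfolding P_def by measurable
  have bound: "(\<integral>\<^sup>+\<omega>. ennreal ((P N \<omega>)\<^sup>2) \<partial>M) \<le> ennreal (s2 * (\<Sum>i. (c i)\<^sup>2))" for N
  proof -
    have "(\<integral>\<^sup>+\<omega>. ennreal ((P N \<omega>)\<^sup>2) \<partial>M) = ennreal (expectation (\<lambda>\<omega>. (P N \<omega>)\<^sup>2))"
      by (rule nn_integral_eq_integral) (use partial_sum_square(1)[of "{..<N}"] in \<open>auto simp: P_def\<close>)
    also have "expectation (\<lambda>\<omega>. (P N \<omega>)\<^sup>2) = s2 * (\<Sum>i<N. (c i)\<^sup>2)"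
      unfolding P_def by (rule partial_sum_square) simp
    also have "\<dots> \<le> s2 * (\<Sum>i. (c i)\<^sup>2)"
      by (intro mult_left_mono sum_le_suminf c s2_nonneg) auto
    finally show ?thesis by (simp add: ennreal_leI)
  qed
  have "(\<integral>\<^sup>+\<omega>. ennreal ((eps c e t \<omega>)\<^sup>2) \<partial>M) = (\<integral>\<^sup>+\<omega>. liminf (\<lambda>N. ennreal ((P N \<omega>)\<^sup>2)) \<partial>M)"
  proof (rule nn_integral_cong_AE)
    show "AE \<omega> in M. ennreal ((eps c e t \<omega>)\<^sup>2) = liminf (\<lambda>N. ennreal ((P N \<omega>)\<^sup>2))"
      using eps_summable_AE[OF c, of t]
    proof (rule AE_mp, intro AE_I2 impI)
      fix \<omega> assume "summable (\<lambda>i. c i * e (t - int i) \<omega>)"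
      then have "(\<lambda>N. P N \<omega>) \<longlonglongrightarrow> eps c e t \<omega>" unfolding P_def eps_def by (rule summable_LIMSEQ)
      then have "(\<lambda>N. ennreal ((P N \<omega>)\<^sup>2)) \<longlonglongrightarrow> ennreal ((eps c e t \<omega>)\<^sup>2)"
        by (intro tendsto_ennrealI tendsto_power)
      then show "ennreal ((eps c e t \<omega>)\<^sup>2) = liminf (\<lambda>N. ennreal ((P N \<omega>)\<^sup>2))"
        by (intro lim_imp_Liminf[symmetric]) auto
    qed
  qed
  also have "\<dots> \<le> liminf (\<lambda>N. \<integral>\<^sup>+\<omega>. ennreal ((P N \<omega>)\<^sup>2) \<partial>M)"
    by (rule nn_integral_liminf) measurable
  also have "\<dots> \<le> ennreal (s2 * (\<Sum>i. (c i)\<^sup>2))"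
    by (rule Liminf_le) (auto intro!: always_eventually bound)
  finally show ?thesis .
qed

lemma eps_square_integrable:
  assumes c: "summable (\<lambda>i. (c i)\<^sup>2)"
  shows "integrable M (\<lambda>\<omega>. (eps c e t \<omega>)\<^sup>2)"
proof (rule integrableI_bounded)
  have "(\<integral>\<^sup>+\<omega>. ennreal (norm ((eps c e t \<omega>)\<^sup>2)) \<partial>M) \<le> ennreal (s2 * (\<Sum>i. (c i)\<^sup>2))"
    using eps_nn_second_moment[OF c] by simp
  also have "\<dots> < \<infinity>" by simp
  finally show "(\<integral>\<^sup>+\<omega>. ennreal (norm ((eps c e t \<omega>)\<^sup>2)) \<partial>M) < \<infinity>" .
qed measurable

lemma eps_second_moment_le:
  assumes c: "summable (\<lambda>i. (c i)\<^sup>2)"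
  shows "expectation (\<lambda>\<omega>. (eps c e t \<omega>)\<^sup>2) \<le> s2 * (\<Sum>i. (c i)\<^sup>2)"
proof -
  have "ennreal (expectation (\<lambda>\<omega>. (eps c e t \<omega>)\<^sup>2)) \<le> ennreal (s2 * (\<Sum>i. (c i)\<^sup>2))"
    using eps_nn_second_moment[OF c, of t] eps_square_integrable[OF c, of t]
    by (subst nn_integral_eq_integral[symmetric]) auto
  then show ?thesis by (rule ennreal_le_iff[THEN iffD1, rotated])
     (use s2_nonneg c in \<open>auto intro!: mult_nonneg_nonneg suminf_nonneg\<close>)
qed

lemma square_integrable_imp_integrable:
  fixes f :: "'a \<Rightarrow> real"
  assumes [measurable]: "f \<in> borel_measurable M" and "integrable M (\<lambda>\<omega>. (f \<omega>)\<^sup>2)"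
  shows "integrable M f"
proof (rule Bochner_Integration.integrable_bound[of _ "\<lambda>\<omega>. 1 + (f \<omega>)\<^sup>2"])
  have "\<bar>x\<bar> \<le> 1 + x\<^sup>2" for x :: real
  proof -
    have "0 \<le> (\<bar>x\<bar> - 1/2)\<^sup>2" by simp
    then show ?thesis by (simp add: power2_diff) (simp add: power2_eq_square)
  qed
  then show "AE \<omega> in M. norm (f \<omega>) \<le> norm (1 + (f \<omega>)\<^sup>2)" by (auto intro!: AE_I2)
qed (use assms in auto)

lemma expectation_square_le:
  fixes f :: "'a \<Rightarrow> real"
  assumes "f \<in> borel_measurable M" and "integrable M (\<lambda>\<omega>. (f \<omega>)\<^sup>2)"
  shows "(expectation f)\<^sup>2 \<le> expectation (\<lambda>\<omega>. (f \<omega>)\<^sup>2)"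
  using variance_positive[of f] variance_eq[OF square_integrable_imp_integrable[OF assms] assms(2)] by simp

lemma eps_integrable: "summable (\<lambda>i. (c i)\<^sup>2) \<Longrightarrow> integrable M (eps c e t)"
  by (rule square_integrable_imp_integrable) (auto intro: eps_square_integrable)

lemma partial_sum_moments:
  "integrable M (\<lambda>\<omega>. \<Sum>i<N. c i * e (t - int i) \<omega>)"
  "expectation (\<lambda>\<omega>. \<Sum>i<N. c i * e (t - int i) \<omega>) = 0"
  using term_moments(1) by (auto simp: Bochner_Integration.integral_sum e_mean)

text \<open>Splitting off N centred terms does not change the mean, while the squared mean of the
  rest is at most its second moment, which tends to 0 with N.\<close>

lemma eps_mean:
  assumes c: "summable (\<lambda>i. (c i)\<^sup>2)"
  shows "expectation (eps c e t) = 0"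
proof -
  have cN: "summable (\<lambda>i. (c (i + N))\<^sup>2)" for N using c by (rule summable_ignore_initial_segment)
  have "(expectation (eps c e t))\<^sup>2 \<le> s2 * (\<Sum>i. (c (i + N))\<^sup>2)" for N
  proof -
    have "expectation (eps c e t) = expectation (\<lambda>\<omega>. (\<Sum>i<N. c i * e (t - int i) \<omega>) + eps (\<lambda>i. c (i + N)) e (t - int N) \<omega>)"
      by (rule integral_cong_AE) (use eps_split_AE[OF c] in auto)
    also have "\<dots> = expectation (eps (\<lambda>i. c (i + N)) e (t - int N))"
      by (subst Bochner_Integration.integral_add) (auto simp: partial_sum_moments eps_integrable[OF cN])
    finally show ?thesis
      using order_trans[OF expectation_square_le[OF eps_measurable eps_square_integrable[OF cN]]
          eps_second_moment_le[OF cN]] by simp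
  qed
  moreover have "(\<lambda>N. s2 * (\<Sum>i. (c (i + N))\<^sup>2)) \<longlonglongrightarrow> s2 * 0"
    by (intro tendsto_intros suminf_exist_split2[OF c])
  ultimately have "(expectation (eps c e t))\<^sup>2 \<le> s2 * 0"
    by (intro LIMSEQ_le_const) auto
  then show ?thesis by simp
qed

text \<open>Fatou gives one inequality. For the other, a finite head is independent of the remaining
  tail, so the cross term vanishes and the second moment is at least that of the head.\<close>

lemma eps_second_moment:
  assumes c: "summable (\<lambda>i. (c i)\<^sup>2)"
  shows "expectation (\<lambda>\<omega>. (eps c e t \<omega>)\<^sup>2) = s2 * (\<Sum>i. (c i)\<^sup>2)"
proof (rule antisym[OF eps_second_moment_le[OF c]])
  have "s2 * (\<Sum>i<N. (c i)\<^sup>2) \<le> expectation (\<lambda>\<omega>. (eps c e t \<omega>)\<^sup>2)" for N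
  proof -
    define P where "P \<omega> = (\<Sum>i<N. c i * e (t - int i) \<omega>)" for \<omega>
    define R where "R = eps (\<lambda>i. c (i + N)) e (t - int N)"
    have cN: "summable (\<lambda>i. (c (i + N))\<^sup>2)" using c by (rule summable_ignore_initial_segment)
    have [measurable]: "P \<in> borel_measurable M" "R \<in> borel_measurable M" unfolding P_def R_def by measurable
    have int: "integrable M P" "integrable M R" "integrable M (\<lambda>\<omega>. (P \<omega>)\<^sup>2)" "integrable M (\<lambda>\<omega>. (R \<omega>)\<^sup>2)"
      unfolding P_def R_def by (auto simp: eps_integrable[OF cN] partial_sum_moments eps_square_integrable[OF cN] partial_sum_square)
    have ind: "indep_var borel P borel R"
    proof (rule indep_var_disjoint[OF e_indep])
      show "P \<in> borel_measurable (sigma_of M e {t - int N<..})" unfolding P_def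
        by (intro borel_measurable_sum borel_measurable_times borel_measurable_const measurable_sigma_of) auto
      show "R \<in> borel_measurable (sigma_of M e {..t - int N})" unfolding R_def by (rule eps_measurable_past)
    qed auto
    have PR: "integrable M (\<lambda>\<omega>. P \<omega> * R \<omega>)" "expectation (\<lambda>\<omega>. P \<omega> * R \<omega>) = 0"
      using indep_var_integrable[OF ind int(1,2)] indep_var_lebesgue_integral[OF ind int(1,2)]
      by (auto simp: P_def partial_sum_moments)
    have "expectation (\<lambda>\<omega>. (eps c e t \<omega>)\<^sup>2) = expectation (\<lambda>\<omega>. (P \<omega>)\<^sup>2 + (R \<omega>)\<^sup>2 + 2 * (P \<omega> * R \<omega>))"
    proof (rule integral_cong_AE)
      show "AE \<omega> in M. (eps c e t \<omega>)\<^sup>2 = (P \<omega>)\<^sup>2 + (R \<omega>)\<^sup>2 + 2 * (P \<omega> * R \<omega>)"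
        using eps_split_AE[OF c, of t N]
        by (rule AE_mp) (auto simp: P_def R_def power2_sum)
    qed measurable
    also have "\<dots> = expectation (\<lambda>\<omega>. (P \<omega>)\<^sup>2) + expectation (\<lambda>\<omega>. (R \<omega>)\<^sup>2)"
      using int PR by simp
    also have "\<dots> \<ge> expectation (\<lambda>\<omega>. (P \<omega>)\<^sup>2)" by simp
    also have "expectation (\<lambda>\<omega>. (P \<omega>)\<^sup>2) = s2 * (\<Sum>i<N. (c i)\<^sup>2)"
      unfolding P_def by (rule partial_sum_square) simp
    finally show ?thesis .
  qed
  moreover have "(\<lambda>N. s2 * (\<Sum>i<N. (c i)\<^sup>2)) \<longlonglongrightarrow> s2 * (\<Sum>i. (c i)\<^sup>2)"
    by (intro tendsto_intros summable_LIMSEQ c)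
  ultimately show "s2 * (\<Sum>i. (c i)\<^sup>2) \<le> expectation (\<lambda>\<omega>. (eps c e t \<omega>)\<^sup>2)"
    by (intro LIMSEQ_le_const2) auto
qed

text \<open>Strict stationarity: at every time t the process is the same measurable function of the
  shifted innovations, default values of divergent series included, and the law of the shifted
  sequence is one fixed product measure.\<close>

lemma distr_eps: "distr M borel (eps c e t) = distr M borel (eps c e 0)"
proof -
  let ?P = "\<Pi>\<^sub>M i\<in>(UNIV::nat set). (borel :: real measure)"
  define f where "f z = (\<Sum>i. c i * z i)" for z :: "nat \<Rightarrow> real"
  have [measurable]: "f \<in> borel_measurable ?P" unfolding f_def by measurable
  have D: "distr M ?P (\<lambda>\<omega>. \<lambda>i\<in>UNIV. e (s - int i) \<omega>) = (\<Pi>\<^sub>M i\<in>UNIV. distr M borel (e 0))" for s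
  proof -
    have "indep_vars (\<lambda>_. borel) (\<lambda>i::nat. e (s - int i)) UNIV"
      by (rule indep_vars_inj[OF e_indep]) (auto simp: inj_def)
    then have "distr M ?P (\<lambda>\<omega>. \<lambda>i\<in>UNIV. e (s - int i) \<omega>) = (\<Pi>\<^sub>M i\<in>UNIV. distr M borel (e (s - int i)))"
      by (subst (asm) indep_vars_iff_distr_eq_PiM) simp_all
    also have "(\<lambda>i. distr M borel (e (s - int i))) = (\<lambda>_. distr M borel (e 0))"
      by (intro ext) (rule e_ident)
    finally show ?thesis .
  qed
  have "distr M borel (eps c e s) = distr (\<Pi>\<^sub>M i\<in>(UNIV::nat set). distr M borel (e 0)) borel f" for s
    unfolding D[of s, symmetric] by (subst distr_distr) (auto simp: comp_def f_def eps_def[abs_def])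
  then show ?thesis by simp
qed

lemma eps_transfer:
  fixes f :: "real \<Rightarrow> real"
  assumes [measurable]: "f \<in> borel_measurable borel"
  shows "expectation (\<lambda>\<omega>. f (eps c e t \<omega>)) = expectation (\<lambda>\<omega>. f (eps c e 0 \<omega>))"
  using integral_distr[of "eps c e t" M borel f] integral_distr[of "eps c e 0" M borel f] distr_eps[of c t] by auto

text \<open>Plays the part of conditioning on the past: the innovation is integrated out against an
  independent copy while everything known before time t is frozen.\<close>

lemma nn_integral_innovation:
  fixes h :: "real \<times> 'b \<Rightarrow> ennreal"
  assumes W: "W \<in> measurable (past (t - 1)) N" and [measurable]: "h \<in> borel_measurable (borel \<Otimes>\<^sub>M N)"
  shows "(\<integral>\<^sup>+\<omega>. h (e t \<omega>, W \<omega>) \<partial>M) = (\<integral>\<^sup>+\<omega>. (\<integral>\<^sup>+\<omega>'. h (e 0 \<omega>', W \<omega>) \<partial>M) \<partial>M)"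
proof -
  have [measurable]: "W \<in> measurable M N" using W by (rule measurable_past)
  have D: "distr M borel (e t) \<Otimes>\<^sub>M distr M N W = distr M (borel \<Otimes>\<^sub>M N) (\<lambda>\<omega>. (e t \<omega>, W \<omega>))"
    by (rule distr_pair_of_indep_set[OF indep_set_sigma_of[OF e_indep, of "{t}" "{..t - 1}"]])
       (auto intro: measurable_sigma_of W)
  interpret W: prob_space "distr M N W" by (rule prob_space_distr) simp
  interpret E: prob_space "distr M borel (e 0)" by (rule prob_space_distr) simp
  interpret P: pair_sigma_finite "distr M borel (e 0)" "distr M N W" ..
  have "(\<integral>\<^sup>+\<omega>. h (e t \<omega>, W \<omega>) \<partial>M) = (\<integral>\<^sup>+z. h z \<partial>distr M (borel \<Otimes>\<^sub>M N) (\<lambda>\<omega>. (e t \<omega>, W \<omega>)))"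
    by (subst nn_integral_distr) auto
  also have "\<dots> = (\<integral>\<^sup>+z. h z \<partial>(distr M borel (e 0) \<Otimes>\<^sub>M distr M N W))"
    unfolding D[symmetric] e_ident[of t] ..
  also have "\<dots> = (\<integral>\<^sup>+w. (\<integral>\<^sup>+z. h (z, w) \<partial>distr M borel (e 0)) \<partial>distr M N W)"
    by (rule P.nn_integral_snd[symmetric]) simp
  also have "\<dots> = (\<integral>\<^sup>+\<omega>. (\<integral>\<^sup>+z. h (z, W \<omega>) \<partial>distr M borel (e 0)) \<partial>M)"
    by (subst nn_integral_distr) auto
  also have "\<dots> = (\<integral>\<^sup>+\<omega>. (\<integral>\<^sup>+\<omega>'. h (e 0 \<omega>', W \<omega>) \<partial>M) \<partial>M)"
    by (intro nn_integral_cong, subst nn_integral_distr) (auto intro!: measurable_Pair2)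
  finally show ?thesis .
qed

end

section \<open>The variance of the partial sums\<close>

text \<open>The coefficient of the innovation at time n - i in the sum of the \<epsilon>_t over 1
  \<le> t \<le> n; the index k stands for the observation at time n - k.\<close>

definition window :: "(nat \<Rightarrow> real) \<Rightarrow> nat \<Rightarrow> nat \<Rightarrow> real" where
  "window a n i = (\<Sum>k<n. if k \<le> i then a (i - k) else 0)"

lemma window_square_summable:
  assumes a: "summable (\<lambda>i. (a i)\<^sup>2)"
  shows "summable (\<lambda>i. (window a n i)\<^sup>2)"
proof (rule summable_comparison_test[OF _ summable_mult[OF summable_sum]])
  show "\<exists>N. \<forall>i\<ge>N. norm ((window a n i)\<^sup>2) \<le> real n * (\<Sum>k<n. (if k \<le> i then a (i - k) else 0)\<^sup>2)"
    unfolding window_def using sum_squared_le_sum_of_squares[where I = "{..<n}"] by (auto simp: mult.commute)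
  fix k assume "k \<in> {..<n}"
  show "summable (\<lambda>i. (if k \<le> i then a (i - k) else 0)\<^sup>2)"
    by (subst summable_iff_shift[of _ k, symmetric]) (use a in simp)
qed

lemma window_Suc_0: "n > 0 \<Longrightarrow> window a n 0 = a 0"
  unfolding window_def by (subst sum.remove[of _ 0]) auto

text \<open>The new latest observation contributes a_i, and the older ones are seen one step further
  back. This recurrence yields the increments of the variance.\<close>

lemma window_step: "window a (Suc n) i = a i + (if i = 0 then 0 else window a n (i - 1))"
proof (cases i)
  case 0
  then show ?thesis by (simp add: window_Suc_0)
next
  case (Suc j)
  have "window a (Suc n) i = a i + (\<Sum>k<n. if Suc k \<le> i then a (i - Suc k) else 0)"
    unfolding window_def by (subst sum.lessThan_Suc_shift) simp
  also have "(\<Sum>k<n. if Suc k \<le> i then a (i - Suc k) else 0) = window a n (i - 1)"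
    unfolding window_def by (rule sum.cong) (auto simp: Suc)
  finally show ?thesis using Suc by simp
qed

lemma window_eq_partial_sum: "i < n \<Longrightarrow> window a n i = (\<Sum>j\<le>i. a j)"
proof -
  assume "i < n"
  then have "window a n i = (\<Sum>k\<le>i. a (i - k))"
    unfolding window_def by (intro sum.mono_neutral_cong_right) auto
  also have "\<dots> = (\<Sum>j\<le>i. a j)"
    by (rule sum.reindex_bij_witness[of _ "\<lambda>j. i - j" "\<lambda>j. i - j"]) auto
  finally show ?thesis .
qed

lemma window_abs_le:
  assumes "summable (\<lambda>i. \<bar>a i\<bar>)"
  shows "\<bar>window a n i\<bar> \<le> (\<Sum>i. \<bar>a i\<bar>)"
proof -
  have "\<bar>window a n i\<bar> \<le> (\<Sum>k<n. \<bar>if k \<le> i then a (i - k) else 0\<bar>)"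
    unfolding window_def by (rule sum_abs)
  also have "\<dots> = (\<Sum>k\<in>{..<n} \<inter> {..i}. \<bar>a (i - k)\<bar>)"
    by (rule sum.mono_neutral_cong_right) auto
  also have "\<dots> = (\<Sum>j\<in>(\<lambda>k. i - k) ` ({..<n} \<inter> {..i}). \<bar>a j\<bar>)"
    by (rule sum.reindex_cong[symmetric, of "\<lambda>k. i - k"]) (auto simp: inj_on_def)
  also have "\<dots> \<le> (\<Sum>i. \<bar>a i\<bar>)"
    by (rule sum_le_suminf[OF assms]) auto
  finally show ?thesis .
qed

lemma abs_summable_imp_square_summable:
  fixes a :: "nat \<Rightarrow> real"
  assumes "summable (\<lambda>i. \<bar>a i\<bar>)" shows "summable (\<lambda>i. (a i)\<^sup>2)"
proof (rule summable_comparison_test_ev[OF _ assms])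
  have "(\<lambda>i. \<bar>a i\<bar>) \<longlonglongrightarrow> 0" using assms by (rule summable_LIMSEQ_zero)
  then have "eventually (\<lambda>i. \<bar>a i\<bar> < 1) sequentially" by (rule order_tendstoD) simp
  then show "eventually (\<lambda>i. norm ((a i)\<^sup>2) \<le> \<bar>a i\<bar>) sequentially"
  proof eventually_elim
    case (elim i)
    then have "\<bar>a i\<bar> * \<bar>a i\<bar> \<le> \<bar>a i\<bar> * 1" by (intro mult_left_mono) auto
    then show ?case by (simp add: power2_eq_square)
  qed
qed

text \<open>\<open>sigma_lim\<close> is defined by \<open>lim\<close> and carries information only
  if the sequence converges. The increments of the energy are \<Sum> a_i^2 plus twice the inner
  product of a with the shifted window; they converge by dominated convergence, since the windows
  are bounded by \<Sum> |a_i|, and their averages follow by Cesaro's theorem.\<close>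

lemma window_energy_mean_converges:
  assumes a: "summable (\<lambda>i. \<bar>a i\<bar>)"
  shows "convergent (\<lambda>n. (\<Sum>i. (window a n i)\<^sup>2) / real n)"
proof -
  note a2 = abs_summable_imp_square_summable[OF a]
  define A where "A = (\<Sum>i. \<bar>a i\<bar>)"
  \<comment> \<open>The window moved one place to the right with a zero in front, as it occurs in
    \<open>window_step\<close>.\<close>
  define w where "w n i = (if i = 0 then 0 else window a n (i - 1))" for n i
  define V where "V n = (\<Sum>i. (window a n i)\<^sup>2)" for n
  have A0: "A \<ge> 0" unfolding A_def by (rule suminf_nonneg[OF a]) simp
  have wA: "\<bar>w n i\<bar> \<le> A" for n i using window_abs_le[OF a, of n "i - 1"] A0 by (auto simp: w_def A_def)
  have aw: "norm (a i * w n i) \<le> \<bar>a i\<bar> * A" for n i by (auto simp: abs_mult intro!: mult_left_mono wA)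
  have aws: "summable (\<lambda>i. a i * w n i)" for n
    by (rule summable_comparison_test'[OF summable_mult2[OF a, of A]]) (use aw in auto)
  have w2: "summable (\<lambda>i. (w n i)\<^sup>2)" "(\<Sum>i. (w n i)\<^sup>2) = V n" for n
  proof -
    have *: "(\<lambda>i. (w n (Suc i))\<^sup>2) sums V n"
      unfolding V_def w_def using window_square_summable[OF a2, of n] by (simp add: summable_sums)
    then have "(\<lambda>i. (w n i)\<^sup>2) sums V n"
      by (subst (asm) sums_Suc_iff) (simp add: w_def)
    then show "summable (\<lambda>i. (w n i)\<^sup>2)" "(\<Sum>i. (w n i)\<^sup>2) = V n" by (auto simp: sums_iff)
  qed
  define d where "d n = (\<Sum>i. (a i)\<^sup>2) + 2 * (\<Sum>i. a i * w n i)" for n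
  have step: "V (Suc n) = V n + d n" for n
  proof -
    have "V (Suc n) = (\<Sum>i. (a i)\<^sup>2 + 2 * (a i * w n i) + (w n i)\<^sup>2)"
      unfolding V_def window_step w_def[symmetric] by (simp add: power2_sum algebra_simps)
    also have "\<dots> = (\<Sum>i. (a i)\<^sup>2 + 2 * (a i * w n i)) + (\<Sum>i. (w n i)\<^sup>2)"
      by (intro suminf_add[symmetric] summable_add summable_mult a2 aws w2)
    also have "(\<Sum>i. (a i)\<^sup>2 + 2 * (a i * w n i)) = (\<Sum>i. (a i)\<^sup>2) + (\<Sum>i. 2 * (a i * w n i))"
      by (intro suminf_add[symmetric] summable_mult a2 aws)
    also have "(\<Sum>i. 2 * (a i * w n i)) = 2 * (\<Sum>i. a i * w n i)"
      by (rule suminf_mult[OF aws])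
    finally show ?thesis using w2 by (simp add: d_def)
  qed
  have V: "V n = (\<Sum>k<n. d k)" for n
    by (induction n) (simp_all add: step, simp add: V_def window_def)
  \<comment> \<open>The limit of w n i for fixed i; the sequence even becomes constant as soon as n
    exceeds i.\<close>
  define W where "W i = (if i = 0 then 0 else \<Sum>j\<le>i-1. a j)" for i
  have "(\<lambda>n. \<Sum>i. a i * w n i) \<longlonglongrightarrow> (\<Sum>i. a i * W i)"
  proof (rule tannerys_theorem[THEN conjunct2, THEN conjunct2])
    show "(\<lambda>n. a i * w n i) \<longlonglongrightarrow> a i * W i" for i
    proof (intro tendsto_intros tendsto_eventually)
      show "eventually (\<lambda>n. w n i = W i) sequentially"
        using eventually_gt_at_top[of i] by eventually_elim (auto simp: w_def W_def window_eq_partial_sum)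
    qed
    show "eventually (\<lambda>(i, n). norm (a i * w n i) \<le> \<bar>a i\<bar> * A) (at_top \<times>\<^sub>F sequentially)"
      using aw by (auto intro!: always_eventually)
    show "summable (\<lambda>i. \<bar>a i\<bar> * A)" using a by (rule summable_mult2)
  qed simp
  then have "d \<longlonglongrightarrow> (\<Sum>i. (a i)\<^sup>2) + 2 * (\<Sum>i. a i * W i)"
    unfolding d_def by (intro tendsto_intros)
  from cesaro_mean[OF this] show ?thesis unfolding V_def[symmetric] V[symmetric] convergent_def by blast
qed

section \<open>Lower bounds for the standard deviation of the partial sums\<close>

context linear_process begin

lemma sum_eps_eq_window_AE:
  assumes a: "summable (\<lambda>i. (a i)\<^sup>2)"
  shows "AE \<omega> in M. (\<Sum>t\<in>{1..int n}. eps a e t \<omega>) = eps (window a n) e (int n) \<omega>"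
proof -
  have "AE \<omega> in M. \<forall>k::nat. summable (\<lambda>i. a i * e ((int n - int k) - int i) \<omega>)"
    unfolding AE_all_countable by (intro allI eps_summable_AE a)
  then show ?thesis
  proof (rule AE_mp, intro AE_I2 impI)
    fix \<omega> assume s: "\<forall>k::nat. summable (\<lambda>i. a i * e ((int n - int k) - int i) \<omega>)"
    \<comment> \<open>Padding the k-th series with k leading zeros aligns all of them on the same
      innovations, so that they can be added term by term.\<close>
    have "(\<lambda>j. (if k \<le> j then a (j - k) else 0) * e (int n - int j) \<omega>) sums eps a e (int n - int k) \<omega>" for k
    proof (subst sums_zero_iff_shift[of k, symmetric])
      show "(\<lambda>i. (if k \<le> i + k then a (i + k - k) else 0) * e (int n - int (i + k)) \<omega>) sums eps a e (int n - int k) \<omega>"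
        using summable_sums[OF s[rule_format, of k]] unfolding eps_def by (simp add: algebra_simps)
    qed auto
    then have "(\<lambda>j. \<Sum>k<n. (if k \<le> j then a (j - k) else 0) * e (int n - int j) \<omega>) sums (\<Sum>k<n. eps a e (int n - int k) \<omega>)"
      by (rule sums_sum)
    then have "(\<lambda>j. window a n j * e (int n - int j) \<omega>) sums (\<Sum>k<n. eps a e (int n - int k) \<omega>)"
      by (simp add: window_def sum_distrib_right)
    then have "eps (window a n) e (int n) \<omega> = (\<Sum>k<n. eps a e (int n - int k) \<omega>)"
      unfolding eps_def by (simp add: sums_iff)
    also have "\<dots> = (\<Sum>t\<in>{1..int n}. eps a e t \<omega>)"
      by (rule sum.reindex_bij_witness[of _ "\<lambda>t. nat (int n - t)" "\<lambda>k. int n - int k"]) auto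
    finally show "(\<Sum>t\<in>{1..int n}. eps a e t \<omega>) = eps (window a n) e (int n) \<omega>" by simp
  qed
qed

lemma sigma_n_square:
  assumes a: "summable (\<lambda>i. (a i)\<^sup>2)"
  shows "(sigma_n M a e n)\<^sup>2 = s2 * (\<Sum>i. (window a n i)\<^sup>2)"
proof -
  let ?S = "\<lambda>\<omega>. \<Sum>t\<in>{1..int n}. eps a e t \<omega>"
  note w = window_square_summable[OF a, of n]
  have m: "expectation ?S = expectation (eps (window a n) e (int n))"
    by (rule integral_cong_AE) (use sum_eps_eq_window_AE[OF a, of n] in auto)
  then have "variance ?S = expectation (\<lambda>\<omega>. (?S \<omega>)\<^sup>2)" by (simp add: eps_mean[OF w])
  also have "\<dots> = expectation (\<lambda>\<omega>. (eps (window a n) e (int n) \<omega>)\<^sup>2)"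
  proof (rule integral_cong_AE)
    show "AE \<omega> in M. (?S \<omega>)\<^sup>2 = (eps (window a n) e (int n) \<omega>)\<^sup>2"
      using sum_eps_eq_window_AE[OF a, of n] by (rule AE_mp) (auto intro!: AE_I2)
  qed auto
  also have "\<dots> = s2 * (\<Sum>i. (window a n i)\<^sup>2)" by (rule eps_second_moment[OF w])
  finally have "variance ?S = s2 * (\<Sum>i. (window a n i)\<^sup>2)" .
  moreover have "(sigma_n M a e n)\<^sup>2 = variance ?S"
    unfolding sigma_n_def by (rule real_sqrt_pow2[OF variance_positive])
  ultimately show ?thesis by simp
qed

lemma sigma_n_growth_short_memory:
  assumes a: "summable (\<lambda>i. \<bar>a i\<bar>)" and pos: "sigma_lim M a e > 0"
  shows "\<exists>c>0. eventually (\<lambda>n. sigma_n M a e n \<ge> c * sqrt (real n)) sequentially"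
proof -
  note a2 = abs_summable_imp_square_summable[OF a]
  define L where "L = lim (\<lambda>n. (sigma_n M a e n)\<^sup>2 / real n)"
  have L: "L > 0" using pos unfolding sigma_lim_def L_def[symmetric] by simp
  have "convergent (\<lambda>n. s2 * ((\<Sum>i. (window a n i)\<^sup>2) / real n))"
    by (intro convergent_mult convergent_const window_energy_mean_converges[OF a])
  then have "(\<lambda>n. (sigma_n M a e n)\<^sup>2 / real n) \<longlonglongrightarrow> L"
    unfolding L_def sigma_n_square[OF a2] by (simp add: convergent_LIMSEQ_iff)
  then have "eventually (\<lambda>n. (sigma_n M a e n)\<^sup>2 / real n > L / 2) sequentially"
    by (rule order_tendstoD) (use L in simp)
  then have "eventually (\<lambda>n. sigma_n M a e n \<ge> sqrt (L/2) * sqrt (real n)) sequentially"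
    using eventually_gt_at_top[of 0]
  proof eventually_elim
    case (elim n)
    then have "L / 2 * real n \<le> (sigma_n M a e n)\<^sup>2" by (simp add: field_simps)
    then have "sqrt (L / 2 * real n) \<le> sigma_n M a e n"
      by (rule real_le_lsqrt[rotated]) (use variance_positive in \<open>auto simp: sigma_n_def\<close>)
    then show ?case by (simp only: real_sqrt_mult)
  qed
  then show ?thesis using L by (intro exI[of _ "sqrt (L/2)"]) auto
qed

text \<open>For N \<le> i < n the window is a full partial sum of the coefficients, hence at least
  1, and there are at least n/2 such indices once n \<ge> 2N. This bound of order sqrt n is below
  the true rate under long memory, but it is what the union bound requires.\<close>

lemma sigma_n_growth_long_memory:
  assumes a: "summable (\<lambda>i. (a i)\<^sup>2)" and s2: "s2 > 0"
    and S: "eventually (\<lambda>m. (\<Sum>i\<le>m. a i) \<ge> 1) sequentially"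
  shows "\<exists>c>0. eventually (\<lambda>n. sigma_n M a e n \<ge> c * sqrt (real n)) sequentially"
proof -
  obtain N where N: "\<And>m. m \<ge> N \<Longrightarrow> (\<Sum>i\<le>m. a i) \<ge> 1" using S by (auto simp: eventually_sequentially)
  have "eventually (\<lambda>n. sigma_n M a e n \<ge> sqrt (s2/2) * sqrt (real n)) sequentially"
    using eventually_ge_at_top[of "2 * N"]
  proof eventually_elim
    case (elim n)
    have "real n / 2 \<le> (\<Sum>i\<in>{N..<n}. 1)" using elim by simp
    also have "\<dots> \<le> (\<Sum>i\<in>{N..<n}. (window a n i)\<^sup>2)"
      by (intro sum_mono) (simp add: window_eq_partial_sum one_le_power[OF N])
    also have "\<dots> \<le> (\<Sum>i. (window a n i)\<^sup>2)"
      by (intro sum_le_suminf window_square_summable a) auto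
    finally have "s2 * (real n / 2) \<le> (sigma_n M a e n)\<^sup>2"
      unfolding sigma_n_square[OF a] using s2 by (intro mult_left_mono) auto
    then have "sqrt (s2 * (real n / 2)) \<le> sigma_n M a e n"
      by (rule real_le_lsqrt[rotated]) (use variance_positive in \<open>auto simp: sigma_n_def\<close>)
    then show ?case by (simp add: real_sqrt_mult[symmetric])
  qed
  then show ?thesis using s2 by (intro exI[of _ "sqrt (s2/2)"]) auto
qed

text \<open>With zero variance the innovation would be 0 almost surely and its distribution function
  would jump at 0. Case (iii) of assumption (1) does not assume \<sigma> > 0, so smoothness has to
  exclude degeneracy there.\<close>

lemma s2_pos:
  assumes "isCont (G0 M e) 0"
  shows "s2 > 0"
proof (rule ccontr)
  assume "\<not> s2 > 0"
  then have "expectation (\<lambda>\<omega>. (e 0 \<omega>)\<^sup>2) = 0" using s2_nonneg by (simp only: s2_def)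
  then have z: "AE \<omega> in M. e 0 \<omega> = 0"
    by (subst (asm) integral_nonneg_eq_0_iff_AE) (use e_square_0 in auto)
  have G: "G0 M e x = prob {\<omega>\<in>space M. e 0 \<omega> \<le> x}" for x
    unfolding G0_def distribution_function_def cdf_def
    by (subst measure_distr) (auto intro!: arg_cong[where f = prob])
  have "G0 M e 0 = 1" unfolding G
    by (subst prob_Collect_eq_1) (use z in auto)
  moreover have "G0 M e x = 0" if "x < 0" for x unfolding G
    by (subst prob_Collect_eq_0) (use z that in auto)
  then have "(\<lambda>n. G0 M e (- inverse (real (Suc n)))) = (\<lambda>n. 0)" by auto
  moreover have "(\<lambda>n. G0 M e (- inverse (real (Suc n)))) \<longlonglongrightarrow> G0 M e (- 0)"
    by (rule isCont_tendsto_compose[where g = "G0 M e", OF _ tendsto_minus[OF LIMSEQ_inverse_real_of_nat]])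
      (use assms in simp)
  ultimately show False by (simp add: LIMSEQ_const_iff)
qed

end

section \<open>The exponential supermartingale\<close>

lemma measurable_of_bool [measurable (raw)]:
  assumes "Measurable.pred M P"
  shows "(\<lambda>\<omega>. of_bool (P \<omega>) :: real) \<in> borel_measurable M"
  using assms unfolding of_bool_def by measurable

text \<open>Since G has limits at both ends, its increments over a fixed step h vanish there; the
  linearization turns this into smallness of h * g(x).\<close>

lemma derivative_vanishes_at_infinity:
  fixes G g :: "real \<Rightarrow> real"
  assumes lin: "\<And>x h. \<bar>G (x + h) - G x - h * g x\<bar> \<le> L * h\<^sup>2" and L: "L \<ge> 0"
    and top: "(G \<longlongrightarrow> u) at_top" and bot: "(G \<longlongrightarrow> l) at_bot" and e: "e > 0"
  shows "\<exists>B>0. \<forall>x. \<bar>x\<bar> \<ge> B \<longrightarrow> \<bar>g x\<bar> \<le> e"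
proof -
  \<comment> \<open>Makes the remainder L * h^2 at most h * e/2, half of what is allowed before
    dividing by h.\<close>
  define h where "h = e / (2 * (L + 1))"
  have h: "h > 0" "L * h \<le> e/2" using e L by (auto simp: h_def field_simps)
  have g: "\<bar>g x\<bar> \<le> e" if "\<bar>G (x + h) - G x\<bar> \<le> h * (e/2)" for x
  proof -
    have "h * \<bar>g x\<bar> \<le> \<bar>G (x + h) - G x\<bar> + L * h\<^sup>2"
      using lin[of x h] h by (auto simp: abs_if zero_le_mult_iff split: if_splits)
    also have "\<dots> \<le> h * (e/2) + h * (e/2)"
      using that h by (intro add_mono) (auto simp: power2_eq_square mult.commute mult.left_commute)
    finally have "h * \<bar>g x\<bar> \<le> h * e" by (simp add: mult.commute)
    then show ?thesis using h by simp
  qed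
  have "((\<lambda>x. G (x + h) - G x) \<longlongrightarrow> u - u) at_top"
    by (intro tendsto_diff top filterlim_compose[OF top]) real_asymp
  then have "eventually (\<lambda>x. dist (G (x + h) - G x) (u - u) < h * (e/2)) at_top"
    by (rule tendstoD) (use h e in auto)
  then obtain B1 where B1: "\<And>x. x \<ge> B1 \<Longrightarrow> \<bar>G (x + h) - G x\<bar> \<le> h * (e/2)"
    by (auto simp: eventually_at_top_linorder dist_real_def intro: less_imp_le)
  have "((\<lambda>x. G (x + h) - G x) \<longlongrightarrow> l - l) at_bot"
    by (intro tendsto_diff bot filterlim_compose[OF bot]) real_asymp
  then have "eventually (\<lambda>x. dist (G (x + h) - G x) (l - l) < h * (e/2)) at_bot"
    by (rule tendstoD) (use h e in auto)
  then obtain B2 where B2: "\<And>x. x \<le> B2 \<Longrightarrow> \<bar>G (x + h) - G x\<bar> \<le> h * (e/2)"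
    by (auto simp: eventually_at_bot_linorder dist_real_def intro: less_imp_le)
  show ?thesis
  proof (intro exI[of _ "max 1 (max B1 (- B2))"] conjI allI impI)
    fix x :: real assume "max 1 (max B1 (- B2)) \<le> \<bar>x\<bar>"
    then have "x \<ge> B1 \<or> x \<le> B2" by linarith
    then show "\<bar>g x\<bar> \<le> e" using B1 B2 g by blast
  qed auto
qed

lemma exp_le_quadratic:
  fixes l :: real assumes "\<bar>l\<bar> \<le> 1" shows "exp l \<le> 1 + l + l\<^sup>2"
proof (cases "l \<ge> 0")
  case True then show ?thesis using exp_bound[of l] assms by simp
next
  case False
  have "1 + (- l) \<le> exp (- l)" by (rule exp_ge_add_one_self)
  then have "exp l \<le> 1 / (1 - l)" using False by (simp add: exp_minus field_simps)
  also have "1 / (1 - l) \<le> 1 + l + l\<^sup>2"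
  proof -
    \<comment> \<open>The point is the identity (1 + l + l^2)(1 - l) = 1 - l^3.\<close>
    have "l ^ 3 \<le> 0" using False by (simp add: power3_eq_cube mult_le_0_iff zero_le_mult_iff)
    then have "1 \<le> (1 + l + l\<^sup>2) * (1 - l)" by (simp add: algebra_simps power2_eq_square power3_eq_cube)
    then show ?thesis using False by (simp add: field_simps)
  qed
  finally show ?thesis .
qed

locale smooth_linear_process = linear_process M e
  for M :: "'a measure" and e :: "int \<Rightarrow> 'a \<Rightarrow> real" +
  fixes a :: "nat \<Rightarrow> real" and G g :: "real \<Rightarrow> real" and K L :: real
  assumes a_square: "summable (\<lambda>i. (a i)\<^sup>2)" and a_0: "a 0 = 1"
    and G_eq: "G = G0 M e"
    and G_deriv: "\<And>x. (G has_real_derivative g x) (at x)"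
    and g_bound: "\<And>x. \<bar>g x\<bar> \<le> K" and g_lipschitz: "\<And>x y. \<bar>g x - g y\<bar> \<le> L * \<bar>x - y\<bar>"
begin

abbreviation \<xi> :: "int \<Rightarrow> 'a \<Rightarrow> real" where "\<xi> \<equiv> xi a e"
abbreviation \<epsilon> :: "int \<Rightarrow> 'a \<Rightarrow> real" where "\<epsilon> \<equiv> eps a e"

lemma K_nonneg: "K \<ge> 0" using g_bound[of 0] by simp
lemma L_nonneg: "L \<ge> 0" using g_lipschitz[of 1 0] by simp

lemma a_tail_square: "summable (\<lambda>i. (a (Suc i))\<^sup>2)"
  using a_square by (subst summable_Suc_iff)

lemma xi_measurable [measurable]: "\<xi> t \<in> borel_measurable M"
  using xi_measurable_past by (rule measurable_past)

lemma G_measurable [measurable]: "G \<in> borel_measurable borel"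
  by (intro borel_measurable_continuous_onI continuous_at_imp_continuous_on ballI)
     (use G_deriv DERIV_isCont in blast)

lemma g_measurable [measurable]: "g \<in> borel_measurable borel"
proof -
  have "L-lipschitz_on UNIV g" using g_lipschitz L_nonneg by (auto simp: lipschitz_on_def dist_real_def)
  then show ?thesis by (intro borel_measurable_continuous_onI lipschitz_on_continuous_on)
qed

lemma G_mvt: "\<exists>z. G y - G x = (y - x) * g z \<and> \<bar>z - x\<bar> \<le> \<bar>y - x\<bar>"
proof (cases x y rule: linorder_cases)
  case less
  from MVT2[OF less, of G g] obtain z where "z > x" "z < y" "G y - G x = (y - x) * g z"
    using G_deriv by blast
  then show ?thesis by (intro exI[of _ z]) auto
next
  case greater
  from MVT2[OF greater, of G g] obtain z where "z > y" "z < x" "G x - G y = (x - y) * g z"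
    using G_deriv by blast
  then show ?thesis by (intro exI[of _ z]) (auto simp: algebra_simps)
qed auto

lemma G_lipschitz: "\<bar>G y - G x\<bar> \<le> K * \<bar>y - x\<bar>"
proof -
  obtain z where "G y - G x = (y - x) * g z" using G_mvt by blast
  then show ?thesis using mult_right_mono[OF g_bound[of z], of "\<bar>y - x\<bar>"] by (simp add: abs_mult mult.commute)
qed

lemma G_linearization: "\<bar>G (x + h) - G x - h * g x\<bar> \<le> L * h\<^sup>2"
proof -
  obtain z where z: "G (x + h) - G x = (x + h - x) * g z" "\<bar>z - x\<bar> \<le> \<bar>x + h - x\<bar>" using G_mvt by blast
  have "\<bar>h * (g z - g x)\<bar> \<le> \<bar>h\<bar> * (L * \<bar>h\<bar>)"
    unfolding abs_mult using g_lipschitz[of z x] mult_left_mono[OF z(2) L_nonneg]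
    by (intro mult_left_mono) auto
  then show ?thesis using z(1) by (simp add: algebra_simps power2_eq_square abs_mult[symmetric])
qed

lemma G_prob: "prob {\<omega>\<in>space M. e 0 \<omega> \<le> x} = G x"
  unfolding G_eq G0_def distribution_function_def cdf_def
  by (subst measure_distr) (auto intro!: arg_cong[where f = prob])

lemma expectation_of_bool:
  assumes "Measurable.pred M P" shows "expectation (\<lambda>\<omega>. of_bool (P \<omega>)) = prob {\<omega>\<in>space M. P \<omega>}"
proof -
  have "expectation (\<lambda>\<omega>. of_bool (P \<omega>)) = expectation (indicator {\<omega>\<in>space M. P \<omega>})"
    by (rule Bochner_Integration.integral_cong) (auto simp: indicator_def)
  also have "\<dots> = prob {\<omega>\<in>space M. P \<omega>}" using assms by simp
  finally show ?thesis .
qed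

lemma integrable_bounded:
  fixes f :: "'a \<Rightarrow> real"
  assumes "f \<in> borel_measurable M" "\<And>\<omega>. \<omega> \<in> space M \<Longrightarrow> \<bar>f \<omega>\<bar> \<le> B"
  shows "integrable M f"
  by (rule integrable_const_bound[of _ B]) (use assms in \<open>auto intro!: AE_I2\<close>)

lemma integrable_of_bool: "Measurable.pred M P \<Longrightarrow> integrable M (\<lambda>\<omega>. of_bool (P \<omega>) :: real)"
  by (rule integrable_bounded[of _ 1]) auto

text \<open>The difference J of the indicators takes values in {-1, 0, 1} and has a constant sign,
  determined by the order of x and y. Therefore the mean of |J| is |p|, where p is the mean of J,
  and the second order term is paid for by |p| rather than by 1. This is the source of the small
  quadratic variation.\<close>

lemma exp_increment:
  fixes l x y :: real
  assumes l: "0 \<le> l" "l \<le> 1"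
  shows "(\<integral>\<^sup>+\<omega>. ennreal (exp (l * (of_bool (e 0 \<omega> \<le> x) - of_bool (e 0 \<omega> \<le> y) - (G x - G y)) - l\<^sup>2 * \<bar>G x - G y\<bar>)) \<partial>M) \<le> 1"
proof -
  define J where "J \<omega> = (of_bool (e 0 \<omega> \<le> x) - of_bool (e 0 \<omega> \<le> y) :: real)" for \<omega>
  define p where "p = G x - G y"
  have [measurable]: "J \<in> borel_measurable M" unfolding J_def by measurable
  have intJ: "integrable M J" unfolding J_def by (intro Bochner_Integration.integrable_diff integrable_of_bool) auto
  have EJ: "expectation J = p" unfolding J_def p_def
    by (subst Bochner_Integration.integral_diff) (auto simp: expectation_of_bool G_prob intro!: integrable_of_bool)
  have EabsJ: "expectation (\<lambda>\<omega>. \<bar>J \<omega>\<bar>) = \<bar>p\<bar>"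
  proof (cases "y \<le> x")
    case True
    then have J0: "J \<omega> \<ge> 0" for \<omega> by (auto simp: J_def)
    then have "p \<ge> 0" unfolding EJ[symmetric] by simp
    then show ?thesis using EJ J0 by simp
  next
    case False
    then have J0: "J \<omega> \<le> 0" for \<omega> by (auto simp: J_def)
    then have "expectation (\<lambda>\<omega>. - J \<omega>) \<ge> 0" by (intro Bochner_Integration.integral_nonneg) simp
    then have "p \<le> 0" using EJ intJ by simp
    then show ?thesis using EJ J0 intJ by simp
  qed
  have bound: "exp (l * (J \<omega> - p) - l\<^sup>2 * \<bar>p\<bar>) \<le> (1 + l * J \<omega> + l\<^sup>2 * \<bar>J \<omega>\<bar>) * exp (- (l * p) - l\<^sup>2 * \<bar>p\<bar>)" for \<omega>
  proof -
    \<comment> \<open>As J is -1, 0 or 1, \<open>(l * J)\<^sup>2\<close> is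
      \<open>l\<^sup>2 * \<bar>J\<bar>\<close>, and the quadratic bound for exp is applied at l, -l
      or 0.\<close>
    have "exp (l * J \<omega>) \<le> 1 + l * J \<omega> + l\<^sup>2 * \<bar>J \<omega>\<bar>"
      using exp_le_quadratic[of l] exp_le_quadratic[of "-l"] l by (auto simp: J_def)
    moreover have "exp (l * (J \<omega> - p) - l\<^sup>2 * \<bar>p\<bar>) = exp (l * J \<omega>) * exp (- (l * p) - l\<^sup>2 * \<bar>p\<bar>)"
      by (simp add: exp_add[symmetric] algebra_simps)
    ultimately show ?thesis by (simp add: mult_right_mono)
  qed
  let ?b = "\<lambda>\<omega>. (1 + l * J \<omega> + l\<^sup>2 * \<bar>J \<omega>\<bar>) * exp (- (l * p) - l\<^sup>2 * \<bar>p\<bar>)"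
  have b0: "?b \<omega> \<ge> 0" for \<omega> by (rule order_trans[OF _ bound]) simp
  have "(\<integral>\<^sup>+\<omega>. ennreal (exp (l * (J \<omega> - p) - l\<^sup>2 * \<bar>p\<bar>)) \<partial>M) \<le> (\<integral>\<^sup>+\<omega>. ennreal (?b \<omega>) \<partial>M)"
    by (intro nn_integral_mono ennreal_leI bound)
  also have "\<dots> = ennreal (expectation ?b)"
    by (rule nn_integral_eq_integral) (use intJ b0 in \<open>auto intro!: AE_I2\<close>)
  also have "expectation ?b = (1 + (l * p + l\<^sup>2 * \<bar>p\<bar>)) * exp (- (l * p + l\<^sup>2 * \<bar>p\<bar>))"
    using intJ by (simp add: EJ EabsJ prob_space)
  also have "\<dots> \<le> exp (l * p + l\<^sup>2 * \<bar>p\<bar>) * exp (- (l * p + l\<^sup>2 * \<bar>p\<bar>))"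
    by (intro mult_right_mono) auto
  also have "\<dots> = 1" by (rule exp_minus_inverse)
  finally show ?thesis unfolding J_def p_def by (simp add: ennreal_leI)
qed

text \<open>The conditional mean, given the past, of the difference of the indicators at the
  predictable levels A and B, written out explicitly through G.\<close>

definition compensator :: "(int \<Rightarrow> 'a \<Rightarrow> real) \<Rightarrow> (int \<Rightarrow> 'a \<Rightarrow> real) \<Rightarrow> int \<Rightarrow> 'a \<Rightarrow> real" where
  "compensator A B t \<omega> = G (A t \<omega> - \<xi> (t - 1) \<omega>) - G (B t \<omega> - \<xi> (t - 1) \<omega>)"

text \<open>The conditional Laplace transform of each centred increment is at most
  \<^term>\<open>exp (l\<^sup>2 * \<bar>p\<bar>)\<close>, so that the exponential process below is a supermartingale.\<close>

lemma exp_supermartingale: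
  fixes A B :: "int \<Rightarrow> 'a \<Rightarrow> real"
  assumes l: "0 \<le> l" "l \<le> 1"
    and A: "\<And>t. t \<in> {1..int n} \<Longrightarrow> A t \<in> borel_measurable (past (t - 1))"
    and B: "\<And>t. t \<in> {1..int n} \<Longrightarrow> B t \<in> borel_measurable (past (t - 1))"
  shows "(\<integral>\<^sup>+\<omega>. ennreal (exp (\<Sum>t\<in>{1..int n}.
      l * (of_bool (\<epsilon> t \<omega> \<le> A t \<omega>) - of_bool (\<epsilon> t \<omega> \<le> B t \<omega>) - compensator A B t \<omega>)
      - l\<^sup>2 * \<bar>compensator A B t \<omega>\<bar>)) \<partial>M) \<le> 1"
proof -
  \<comment> \<open>The summand with \<epsilon>_t replaced by e_t + \<xi>_{t-1}, which agrees almost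
    surely and displays it as a function of the innovation and of quantities known at time t -
    1.\<close>
  define T where "T t \<omega> = l * (of_bool (e t \<omega> \<le> A t \<omega> - \<xi> (t - 1) \<omega>) - of_bool (e t \<omega> \<le> B t \<omega> - \<xi> (t - 1) \<omega>)
      - compensator A B t \<omega>) - l\<^sup>2 * \<bar>compensator A B t \<omega>\<bar>" for t \<omega>
  have AX: "(\<lambda>\<omega>. A t \<omega> - \<xi> (t - 1) \<omega>) \<in> borel_measurable (past (t - 1))"
       and BX: "(\<lambda>\<omega>. B t \<omega> - \<xi> (t - 1) \<omega>) \<in> borel_measurable (past (t - 1))" if "t \<in> {1..int n}" for t
    using A[OF that] B[OF that] xi_measurable_past[of a "t - 1"] by auto
  have T: "T t \<in> borel_measurable (past t)" if "t \<in> {1..int n}" for t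
  proof -
    have [measurable]: "(\<lambda>\<omega>. A t \<omega> - \<xi> (t - 1) \<omega>) \<in> borel_measurable (past t)"
      "(\<lambda>\<omega>. B t \<omega> - \<xi> (t - 1) \<omega>) \<in> borel_measurable (past t)" "e t \<in> borel_measurable (past t)"
      using measurable_past_mono[OF AX[OF that]] measurable_past_mono[OF BX[OF that]] e_measurable_past[of t t] by auto
    show ?thesis unfolding T_def[abs_def] compensator_def by measurable
  qed
  have main: "m \<le> n \<Longrightarrow> (\<integral>\<^sup>+\<omega>. ennreal (exp (\<Sum>t\<in>{1..int m}. T t \<omega>)) \<partial>M) \<le> 1" for m
  proof (induction m)
    case 0 then show ?case by (simp add: emeasure_space_1)
  next
    case (Suc m)
    define s where "s = int m + 1"
    have s: "s \<in> {1..int n}" "{1..int (Suc m)} = insert s {1..int m}" "s \<notin> {1..int m}" "s - 1 = int m"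
      using Suc.prems by (auto simp: s_def)
    \<comment> \<open>Everything at time s - 1 on which the next factor and the product so far
      depend: the accumulated exponent and the two levels relative to \<xi>.\<close>
    define W where "W \<omega> = (\<Sum>t\<in>{1..int m}. T t \<omega>, A s \<omega> - \<xi> (s - 1) \<omega>, B s \<omega> - \<xi> (s - 1) \<omega>)" for \<omega>
    define h where "h = (\<lambda>(z, w, x, y). ennreal (exp w) * ennreal (exp (l * (of_bool (z \<le> x) - of_bool (z \<le> y) - (G x - G y)) - l\<^sup>2 * \<bar>G x - G y\<bar>)))"
    have "(\<lambda>\<omega>. \<Sum>t\<in>{1..int m}. T t \<omega>) \<in> borel_measurable (past (s - 1))"
      by (rule borel_measurable_sum, rule measurable_past_mono[OF T]) (use s Suc.prems in auto)
    then have W: "W \<in> measurable (past (s - 1)) (borel \<Otimes>\<^sub>M borel \<Otimes>\<^sub>M borel)"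
      unfolding W_def[abs_def] using AX[OF s(1)] BX[OF s(1)] by (intro measurable_Pair) auto
    have hm: "h \<in> borel_measurable (borel \<Otimes>\<^sub>M borel \<Otimes>\<^sub>M borel \<Otimes>\<^sub>M borel)"
      unfolding h_def by measurable
    have "(\<integral>\<^sup>+\<omega>. ennreal (exp (\<Sum>t\<in>{1..int (Suc m)}. T t \<omega>)) \<partial>M) = (\<integral>\<^sup>+\<omega>. h (e s \<omega>, W \<omega>) \<partial>M)"
      unfolding s(2) using s(3) by (intro nn_integral_cong)
        (simp add: h_def W_def T_def compensator_def exp_add[symmetric] ennreal_mult'[symmetric] algebra_simps)
    also have "\<dots> = (\<integral>\<^sup>+\<omega>. (\<integral>\<^sup>+\<omega>'. h (e 0 \<omega>', W \<omega>) \<partial>M) \<partial>M)"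
      by (rule nn_integral_innovation[OF W hm])
    also have "\<dots> \<le> (\<integral>\<^sup>+\<omega>. ennreal (exp (\<Sum>t\<in>{1..int m}. T t \<omega>)) \<partial>M)"
    proof (rule nn_integral_mono)
      fix \<omega>
      define x y where "x = A s \<omega> - \<xi> (s - 1) \<omega>" and "y = B s \<omega> - \<xi> (s - 1) \<omega>"
      have "(\<integral>\<^sup>+\<omega>'. h (e 0 \<omega>', W \<omega>) \<partial>M) = ennreal (exp (\<Sum>t\<in>{1..int m}. T t \<omega>)) *
         (\<integral>\<^sup>+\<omega>'. ennreal (exp (l * (of_bool (e 0 \<omega>' \<le> x) - of_bool (e 0 \<omega>' \<le> y) - (G x - G y)) - l\<^sup>2 * \<bar>G x - G y\<bar>)) \<partial>M)"
        unfolding h_def W_def x_def[symmetric] y_def[symmetric] prod.case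
        by (rule nn_integral_cmult) measurable
      also have "\<dots> \<le> ennreal (exp (\<Sum>t\<in>{1..int m}. T t \<omega>)) * 1"
        by (intro mult_left_mono exp_increment l) auto
      finally show "(\<integral>\<^sup>+\<omega>'. h (e 0 \<omega>', W \<omega>) \<partial>M) \<le> ennreal (exp (\<Sum>t\<in>{1..int m}. T t \<omega>))" by simp
    qed
    also have "\<dots> \<le> 1" using Suc by simp
    finally show ?case .
  qed
  have "AE \<omega> in M. \<forall>t. \<epsilon> t \<omega> = e t \<omega> + \<xi> (t - 1) \<omega>"
    unfolding AE_all_countable by (intro allI eps_eq_e_plus_xi_AE a_square a_0)
  then have "(\<integral>\<^sup>+\<omega>. ennreal (exp (\<Sum>t\<in>{1..int n}.
      l * (of_bool (\<epsilon> t \<omega> \<le> A t \<omega>) - of_bool (\<epsilon> t \<omega> \<le> B t \<omega>) - compensator A B t \<omega>)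
      - l\<^sup>2 * \<bar>compensator A B t \<omega>\<bar>)) \<partial>M) = (\<integral>\<^sup>+\<omega>. ennreal (exp (\<Sum>t\<in>{1..int n}. T t \<omega>)) \<partial>M)"
    by (intro nn_integral_cong_AE) (auto simp: T_def le_diff_eq)
  then show ?thesis using main[of n] by simp
qed

text \<open>This is the density F' of \<epsilon>_t, as \<open>deriv_F_eps\<close> shows; by
  stationarity \<xi> may be taken at time 0.\<close>

definition f :: "real \<Rightarrow> real" where "f x = expectation (\<lambda>\<omega>. g (x - \<xi> 0 \<omega>))"

lemma xi_transfer:
  fixes u :: "real \<Rightarrow> real"
  assumes "u \<in> borel_measurable borel"
  shows "expectation (\<lambda>\<omega>. u (\<xi> t \<omega>)) = expectation (\<lambda>\<omega>. u (\<xi> 0 \<omega>))"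
  unfolding xi_eq_eps by (rule eps_transfer[OF assms])

lemma f_eq: "expectation (\<lambda>\<omega>. g (x - \<xi> t \<omega>)) = f x"
  unfolding f_def by (rule xi_transfer) measurable

lemma integrable_g_xi: "integrable M (\<lambda>\<omega>. g (x - \<xi> t \<omega>))"
  by (rule integrable_bounded[of _ K]) (auto simp: g_bound)

lemma f_bound: "\<bar>f x\<bar> \<le> K"
proof -
  have "\<bar>f x\<bar> \<le> expectation (\<lambda>\<omega>. \<bar>g (x - \<xi> 0 \<omega>)\<bar>)" unfolding f_def by (rule integral_abs_bound)
  also have "\<dots> \<le> K" by (rule integral_le_const) (use integrable_g_xi g_bound in \<open>auto intro!: AE_I2\<close>)
  finally show ?thesis .
qed

lemma f_lipschitz: "\<bar>f x - f y\<bar> \<le> L * \<bar>x - y\<bar>"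
proof -
  have "f x - f y = expectation (\<lambda>\<omega>. g (x - \<xi> 0 \<omega>) - g (y - \<xi> 0 \<omega>))"
    unfolding f_def by (rule Bochner_Integration.integral_diff[symmetric]) (rule integrable_g_xi)+
  also have "\<bar>\<dots>\<bar> \<le> expectation (\<lambda>\<omega>. \<bar>g (x - \<xi> 0 \<omega>) - g (y - \<xi> 0 \<omega>)\<bar>)"
    by (rule integral_abs_bound)
  also have "\<dots> \<le> L * \<bar>x - y\<bar>"
  proof (rule integral_le_const)
    show "integrable M (\<lambda>\<omega>. \<bar>g (x - \<xi> 0 \<omega>) - g (y - \<xi> 0 \<omega>)\<bar>)"
      by (intro integrable_abs Bochner_Integration.integrable_diff integrable_g_xi)
    show "AE \<omega> in M. \<bar>g (x - \<xi> 0 \<omega>) - g (y - \<xi> 0 \<omega>)\<bar> \<le> L * \<bar>x - y\<bar>"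
    proof (rule AE_I2)
      fix \<omega> show "\<bar>g (x - \<xi> 0 \<omega>) - g (y - \<xi> 0 \<omega>)\<bar> \<le> L * \<bar>x - y\<bar>"
        using g_lipschitz[of "x - \<xi> 0 \<omega>" "y - \<xi> 0 \<omega>"] by simp
    qed
  qed
  finally show ?thesis .
qed

lemma F_eps_prob: "F_eps M a e x = prob {\<omega>\<in>space M. \<epsilon> 0 \<omega> \<le> x}"
  unfolding F_eps_def distribution_function_def cdf_def
  by (subst measure_distr) (auto intro!: arg_cong[where f = prob])

lemma G_range: "0 \<le> G x" "G x \<le> 1"
  unfolding G_prob[symmetric] by simp_all

lemma integrable_G_xi: "integrable M (\<lambda>\<omega>. G (x - \<xi> t \<omega>))"
  by (rule integrable_bounded[of _ 1]) (use G_range in auto)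

lemma F_eps_eq: "F_eps M a e x = expectation (\<lambda>\<omega>. G (x - \<xi> (-1) \<omega>))"
proof -
  have "ennreal (F_eps M a e x) = (\<integral>\<^sup>+\<omega>. ennreal (of_bool (\<epsilon> 0 \<omega> \<le> x)) \<partial>M)"
    unfolding F_eps_prob expectation_of_bool[symmetric, of "\<lambda>\<omega>. \<epsilon> 0 \<omega> \<le> x", simplified]
    by (subst nn_integral_eq_integral) (auto intro!: integrable_of_bool simp: expectation_of_bool)
  also have "\<dots> = (\<integral>\<^sup>+\<omega>. (\<lambda>(z, w). ennreal (of_bool (z \<le> x - w))) (e 0 \<omega>, \<xi> (0 - 1) \<omega>) \<partial>M)"
    by (rule nn_integral_cong_AE)
       (use eps_eq_e_plus_xi_AE[OF a_square a_0, of 0] in \<open>auto simp: le_diff_eq\<close>)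
  also have "\<dots> = (\<integral>\<^sup>+\<omega>. (\<integral>\<^sup>+\<omega>'. (\<lambda>(z, w). ennreal (of_bool (z \<le> x - w))) (e 0 \<omega>', \<xi> (0 - 1) \<omega>) \<partial>M) \<partial>M)"
    by (rule nn_integral_innovation[OF xi_measurable_past]) measurable
  also have "\<dots> = (\<integral>\<^sup>+\<omega>. ennreal (G (x - \<xi> (-1) \<omega>)) \<partial>M)"
    unfolding prod.case
    by (intro nn_integral_cong, subst nn_integral_eq_integral)
       (auto intro!: integrable_of_bool simp: expectation_of_bool G_prob)
  also have "\<dots> = ennreal (expectation (\<lambda>\<omega>. G (x - \<xi> (-1) \<omega>)))"
    by (rule nn_integral_eq_integral) (auto simp: integrable_G_xi G_range)
  finally show ?thesis
    by (subst (asm) ennreal_inj) (auto simp: F_eps_prob G_range intro!: Bochner_Integration.integral_nonneg)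
qed

text \<open>The linearization of G, integrated over \<xi> with the same constant L. It yields both
  the derivative of F and, through the limits of F at infinity, the decay of f.\<close>

lemma F_eps_linearization: "\<bar>F_eps M a e (x + h) - F_eps M a e x - h * f x\<bar> \<le> L * h\<^sup>2"
proof -
  let ?D = "\<lambda>\<omega>. G (x - \<xi> (-1) \<omega> + h) - G (x - \<xi> (-1) \<omega>) - h * g (x - \<xi> (-1) \<omega>)"
  have i1: "integrable M (\<lambda>\<omega>. G (x - \<xi> (-1) \<omega> + h))"
    using integrable_G_xi[of "x + h" "-1"] by (simp add: algebra_simps)
  have int: "integrable M ?D" by (intro Bochner_Integration.integrable_diff integrable_mult_right i1 integrable_G_xi integrable_g_xi)
  have "F_eps M a e (x + h) - F_eps M a e x - h * f x = expectation ?D"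
    unfolding F_eps_eq f_eq[of x "-1", symmetric]
    using i1 integrable_G_xi[of x "-1"] integrable_g_xi[of x "-1"] by (simp add: algebra_simps)
  then have "\<bar>F_eps M a e (x + h) - F_eps M a e x - h * f x\<bar> = \<bar>expectation ?D\<bar>" by (rule arg_cong)
  moreover have "\<bar>expectation ?D\<bar> \<le> expectation (\<lambda>\<omega>. \<bar>?D \<omega>\<bar>)" by (rule integral_abs_bound)
  moreover have "expectation (\<lambda>\<omega>. \<bar>?D \<omega>\<bar>) \<le> L * h\<^sup>2"
  proof (rule integral_le_const)
    show "integrable M (\<lambda>\<omega>. \<bar>?D \<omega>\<bar>)" using int by (rule integrable_abs)
    show "AE \<omega> in M. \<bar>?D \<omega>\<bar> \<le> L * h\<^sup>2"
    proof (rule AE_I2)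
      fix \<omega> show "\<bar>?D \<omega>\<bar> \<le> L * h\<^sup>2" using G_linearization[of "x - \<xi> (-1) \<omega>" h] .
    qed
  qed
  ultimately show ?thesis by linarith
qed

lemma F_eps_has_derivative: "(F_eps M a e has_real_derivative f x) (at x)"
  unfolding DERIV_def
proof (rule tendstoI)
  fix r :: real assume r: "r > 0"
  have "eventually (\<lambda>h. norm (L * h) < r \<and> h \<noteq> 0) (at 0)"
  proof (intro eventually_conj)
    have "((\<lambda>h. L * h) \<longlongrightarrow> L * 0) (at 0)" by (intro tendsto_intros)
    from tendstoD[OF this r] show "eventually (\<lambda>h. norm (L * h) < r) (at 0)" by (simp add: dist_real_def)
    show "eventually (\<lambda>h. h \<noteq> 0) (at (0::real))" by (simp add: eventually_at_filter)
  qed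
  then show "eventually (\<lambda>h. dist ((F_eps M a e (x + h) - F_eps M a e x) / h) (f x) < r) (at 0)"
  proof eventually_elim
    case (elim h)
    have "\<bar>(F_eps M a e (x + h) - F_eps M a e x) / h - f x\<bar> = \<bar>F_eps M a e (x + h) - F_eps M a e x - h * f x\<bar> / \<bar>h\<bar>"
      using elim by (simp add: abs_divide[symmetric] diff_divide_distrib)
    also have "\<dots> \<le> L * h\<^sup>2 / \<bar>h\<bar>" by (intro divide_right_mono F_eps_linearization) simp
    also have "\<dots> = \<bar>L * h\<bar>" 
    proof -
      have "L * h\<^sup>2 = \<bar>L * h\<bar> * \<bar>h\<bar>" using L_nonneg by (simp add: abs_mult power2_eq_square)
      then show ?thesis using elim by simp
    qed
    finally show ?case using elim by (simp add: dist_real_def)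
  qed
qed

lemma deriv_F_eps: "deriv (F_eps M a e) x = f x"
  by (rule DERIV_imp_deriv[OF F_eps_has_derivative])

lemma g_vanishes: "r > 0 \<Longrightarrow> \<exists>B>0. \<forall>x. \<bar>x\<bar> \<ge> B \<longrightarrow> \<bar>g x\<bar> \<le> r"
proof (rule derivative_vanishes_at_infinity[OF G_linearization L_nonneg])
  interpret D: real_distribution "distr M borel (e 0)" by (rule real_distribution_distr) simp
  show "(G \<longlongrightarrow> 1) at_top" "(G \<longlongrightarrow> 0) at_bot"
    unfolding G_eq G0_def[abs_def] distribution_function_def
    by (rule D.cdf_lim_at_top_prob D.cdf_lim_at_bot)+
qed

lemma f_vanishes: "r > 0 \<Longrightarrow> \<exists>B>0. \<forall>x. \<bar>x\<bar> \<ge> B \<longrightarrow> \<bar>f x\<bar> \<le> r"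
proof (rule derivative_vanishes_at_infinity[OF F_eps_linearization L_nonneg])
  interpret D: real_distribution "distr M borel (\<epsilon> 0)" by (rule real_distribution_distr) simp
  show "(F_eps M a e \<longlongrightarrow> 1) at_top" "(F_eps M a e \<longlongrightarrow> 0) at_bot"
    unfolding F_eps_def[abs_def] distribution_function_def
    by (rule D.cdf_lim_at_top_prob D.cdf_lim_at_bot)+
qed

lemma A_dev_eq: "A_dev M a e t x \<omega> = g (x - \<xi> (t - 1) \<omega>) - f x"
proof -
  have "deriv (G0 M e) = g" using DERIV_imp_deriv[OF G_deriv] G_eq by auto
  then show ?thesis unfolding A_dev_def by (simp add: f_eq)
qed

end

section \<open>Reduction to a finite grid\<close>

text \<open>The term \<open>c * norm (z t)\<close> absorbs the change of u \<bullet> z_t when u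
  moves by at most |c|: the counts with c = d and c = -d enclose those of every u within distance d
  of v. With v = 0 and c = 0 this is the plain empirical count.\<close>

definition band_count :: "int set \<Rightarrow> (int \<Rightarrow> 'v::euclidean_space) \<Rightarrow> (int \<Rightarrow> real) \<Rightarrow> real \<Rightarrow> 'v \<Rightarrow> real \<Rightarrow> real" where
  "band_count I z \<epsilon> x v c = (\<Sum>t\<in>I. of_bool (\<epsilon> t \<le> x + v \<bullet> z t + c * norm (z t)))"

text \<open>Monotonicity of the indicators sandwiches the increment at \<open>(u, x)\<close> between increments at
  nodes of a finite grid; outside \<open>[-n, n]\<close> almost no indicator changes its value.\<close>

lemma oscillation_from_grid:
  fixes z :: "int \<Rightarrow> 'v::euclidean_space" and \<epsilon> :: "int \<Rightarrow> real" and f :: "real \<Rightarrow> real"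
  assumes n: "n > 0" and I: "finite I"
    and net: "\<And>u. norm u \<le> C \<Longrightarrow> \<exists>v\<in>U. norm (u - v) \<le> d \<and> norm v \<le> C" and C: "C \<ge> 0"
    and upper: "\<And>v j. v \<in> U \<Longrightarrow> j \<in> {- int (n\<^sup>2)..int (n\<^sup>2)} \<Longrightarrow>
      band_count I z \<epsilon> (real_of_int (j + 1) / real n) v d - band_count I z \<epsilon> (real_of_int j / real n) 0 0
        - (v \<bullet> (\<Sum>t\<in>I. z t)) * f (real_of_int j / real n) \<le> r"
    and lower: "\<And>v j. v \<in> U \<Longrightarrow> j \<in> {- int (n\<^sup>2)..int (n\<^sup>2)} \<Longrightarrow>
      band_count I z \<epsilon> (real_of_int (j + 1) / real n) 0 0 - band_count I z \<epsilon> (real_of_int j / real n) v (- d)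
        + (v \<bullet> (\<Sum>t\<in>I. z t)) * f (real_of_int j / real n) \<le> r"
    and tail: "(\<Sum>t\<in>I. of_bool (\<bar>\<epsilon> t\<bar> \<ge> real n / 2) + of_bool (C * norm (z t) \<ge> real n / 2)) \<le> r"
    and f: "\<And>x. \<bar>f x\<bar> \<le> K" "\<And>x y. \<bar>f x - f y\<bar> \<le> L * \<bar>x - y\<bar>" "\<And>x. \<bar>x\<bar> \<ge> real n \<Longrightarrow> \<bar>f x\<bar> \<le> q"
    and L: "L \<ge> 0" and u: "norm u \<le> C"
  shows "\<bar>(\<Sum>t\<in>I. of_bool (\<epsilon> t \<le> x + u \<bullet> z t) - of_bool (\<epsilon> t \<le> x)) - (u \<bullet> (\<Sum>t\<in>I. z t)) * f x\<bar>
    \<le> r + (d * K + C * L / real n + C * q) * (\<Sum>t\<in>I. norm (z t))"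
proof -
  define S where "S = (\<Sum>t\<in>I. norm (z t))"
  have S: "norm (\<Sum>t\<in>I. z t) \<le> S" "S \<ge> 0" unfolding S_def by (auto intro: norm_sum sum_nonneg)
  have inner_S: "\<bar>w \<bullet> (\<Sum>t\<in>I. z t)\<bar> \<le> c * S" if "norm w \<le> c" for w c
  proof -
    have "\<bar>w \<bullet> (\<Sum>t\<in>I. z t)\<bar> \<le> norm w * norm (\<Sum>t\<in>I. z t)" by (rule Cauchy_Schwarz_ineq2)
    also have "\<dots> \<le> c * S" using that S order_trans[OF norm_ge_zero that] by (intro mult_mono) auto
    finally show ?thesis .
  qed
  obtain v where v: "v \<in> U" "norm (u - v) \<le> d" "norm v \<le> C" using net[OF u] by blast
  have d: "d \<ge> 0" using v(2) norm_ge_zero order_trans by blast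
  have K: "K \<ge> 0" using f(1)[of 0] by simp
  have q: "q \<ge> 0" using f(3)[of "real n"] by simp
  let ?D = "\<Sum>t\<in>I. of_bool (\<epsilon> t \<le> x + u \<bullet> z t) - of_bool (\<epsilon> t \<le> x) :: real"
  let ?u = "(u \<bullet> (\<Sum>t\<in>I. z t)) * f x"
  have parts: "0 \<le> d * K * S" "0 \<le> C * L / real n * S" "0 \<le> C * q * S"
    using d K C L q S by simp_all
  have split: "(d * K + C * L / real n + C * q) * S = d * K * S + C * L / real n * S + C * q * S"
    by (simp add: distrib_right)
  show ?thesis unfolding S_def[symmetric]
  proof (cases "\<bar>x\<bar> \<le> real n")
    case True
    define j where "j = \<lfloor>real n * x\<rfloor>"
    define x0 x1 where "x0 = real_of_int j / real n" and "x1 = real_of_int (j + 1) / real n"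
    have jx: "real_of_int j \<le> real n * x" "real n * x < real_of_int j + 1" unfolding j_def by linarith+
    have x01': "x0 \<le> x" "x \<le> x1" "x1 - x0 = 1 / real n"
      using jx n unfolding x0_def x1_def
      by (simp_all add: pos_divide_le_eq pos_le_divide_eq mult.commute diff_divide_distrib[symmetric])
    then have x01: "x0 \<le> x" "x \<le> x1" "\<bar>x - x0\<bar> \<le> 1 / real n" by linarith+
    have j: "j \<in> {- int (n\<^sup>2)..int (n\<^sup>2)}"
    proof -
      have "\<bar>real n * x\<bar> \<le> real n * real n" unfolding abs_mult using True by (intro mult_mono) auto
      then have b: "real n * x \<le> of_int (int (n\<^sup>2))" "of_int (- int (n\<^sup>2)) \<le> real n * x"
        by (auto simp: power2_eq_square abs_le_iff)
      have "\<lfloor>real n * x\<rfloor> \<le> int (n\<^sup>2)" using floor_mono[OF b(1)] by (simp only: floor_of_int)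
      moreover have "- int (n\<^sup>2) \<le> \<lfloor>real n * x\<rfloor>" using b(2) by (simp only: le_floor_iff)
      ultimately show ?thesis unfolding j_def by simp
    qed
    have band: "\<bar>u \<bullet> z t - v \<bullet> z t\<bar> \<le> d * norm (z t)" for t
    proof -
      have "\<bar>(u - v) \<bullet> z t\<bar> \<le> norm (u - v) * norm (z t)" by (rule Cauchy_Schwarz_ineq2)
      also have "\<dots> \<le> d * norm (z t)" using v(2) by (intro mult_right_mono) auto
      finally show ?thesis by (simp add: inner_diff_left)
    qed
    have lin: "\<bar>?u - (v \<bullet> (\<Sum>t\<in>I. z t)) * f x0\<bar> \<le> d * K * S + C * L / real n * S"
    proof -
      \<comment> \<open>The linear term is moved to the grid in two stages, first from u to v and
        then from x to x0.\<close>
      have "?u - (v \<bullet> (\<Sum>t\<in>I. z t)) * f x0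
        = ((u - v) \<bullet> (\<Sum>t\<in>I. z t)) * f x + (v \<bullet> (\<Sum>t\<in>I. z t)) * (f x - f x0)"
        by (simp add: algebra_simps inner_diff_left)
      moreover have "\<bar>((u - v) \<bullet> (\<Sum>t\<in>I. z t)) * f x\<bar> \<le> (d * S) * K"
        unfolding abs_mult using inner_S[OF v(2)] f(1)[of x] d S by (intro mult_mono) auto
      moreover have "\<bar>(v \<bullet> (\<Sum>t\<in>I. z t)) * (f x - f x0)\<bar> \<le> (C * S) * (L * (1 / real n))"
        unfolding abs_mult using inner_S[OF v(3)] C S L
          order_trans[OF f(2)[of x x0] mult_left_mono[OF x01(3) L]] by (intro mult_mono) auto
      ultimately show ?thesis by (simp add: mult.commute mult.left_commute)
    qed
    have "?D \<le> band_count I z \<epsilon> x1 v d - band_count I z \<epsilon> x0 0 0"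
      unfolding band_count_def sum_subtractf[symmetric]
    proof (rule sum_mono)
      fix t
      have "x + u \<bullet> z t \<le> x1 + v \<bullet> z t + d * norm (z t)" using band[of t] x01 by (auto simp: abs_le_iff)
      then show "of_bool (\<epsilon> t \<le> x + u \<bullet> z t) - of_bool (\<epsilon> t \<le> x)
        \<le> of_bool (\<epsilon> t \<le> x1 + v \<bullet> z t + d * norm (z t)) - (of_bool (\<epsilon> t \<le> x0 + 0 \<bullet> z t + 0 * norm (z t)) :: real)"
        using x01 by (auto simp: of_bool_def)
    qed
    then have up: "?D \<le> (v \<bullet> (\<Sum>t\<in>I. z t)) * f x0 + r"
      using upper[OF v(1) j] unfolding x0_def x1_def by linarith
    have "- ?D \<le> band_count I z \<epsilon> x1 0 0 - band_count I z \<epsilon> x0 v (- d)"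
      unfolding band_count_def sum_subtractf[symmetric] sum_negf[symmetric]
    proof (rule sum_mono)
      fix t
      have "x + u \<bullet> z t \<ge> x0 + v \<bullet> z t + (- d) * norm (z t)" using band[of t] x01 by (auto simp: abs_le_iff)
      then show "- (of_bool (\<epsilon> t \<le> x + u \<bullet> z t) - of_bool (\<epsilon> t \<le> x))
        \<le> of_bool (\<epsilon> t \<le> x1 + 0 \<bullet> z t + 0 * norm (z t)) - (of_bool (\<epsilon> t \<le> x0 + v \<bullet> z t + (- d) * norm (z t)) :: real)"
        using x01 by (auto simp: of_bool_def)
    qed
    then have lo: "- ?D \<le> r - (v \<bullet> (\<Sum>t\<in>I. z t)) * f x0"
      using lower[OF v(1) j] unfolding x0_def x1_def by linarith
    show "\<bar>?D - ?u\<bar> \<le> r + (d * K + C * L / real n + C * q) * S"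
      unfolding split using up lo lin parts by (simp only: abs_le_iff) linarith
  next
    case False
    have "\<bar>?D\<bar> \<le> (\<Sum>t\<in>I. of_bool (\<bar>\<epsilon> t\<bar> \<ge> real n / 2) + of_bool (C * norm (z t) \<ge> real n / 2))"
    proof (rule order_trans[OF sum_abs sum_mono])
      fix t
      have "\<bar>u \<bullet> z t\<bar> \<le> norm u * norm (z t)" by (rule Cauchy_Schwarz_ineq2)
      also have "\<dots> \<le> C * norm (z t)" using u by (intro mult_right_mono) auto
      finally have uz: "\<bar>u \<bullet> z t\<bar> \<le> C * norm (z t)" .
      show "\<bar>of_bool (\<epsilon> t \<le> x + u \<bullet> z t) - of_bool (\<epsilon> t \<le> x)\<bar>
        \<le> of_bool (\<bar>\<epsilon> t\<bar> \<ge> real n / 2) + (of_bool (C * norm (z t) \<ge> real n / 2) :: real)"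
      proof (cases "\<bar>\<epsilon> t\<bar> \<ge> real n / 2 \<or> C * norm (z t) \<ge> real n / 2")
        case True
        then show ?thesis by (auto simp: of_bool_def)
      next
        case noT: False
        \<comment> \<open>Here |x| > n, while the shift and \<epsilon>_t are both below n/2 in
          absolute value, so x and the shifted x lie on the same side of \<epsilon>_t.\<close>
        then have "(\<epsilon> t \<le> x + u \<bullet> z t) \<longleftrightarrow> (\<epsilon> t \<le> x)" using False uz by (auto simp: abs_if split: if_splits)
        then show ?thesis by simp
      qed
    qed
    then have "\<bar>?D\<bar> \<le> r" using tail by simp
    moreover have "\<bar>?u\<bar> \<le> (C * S) * q"
      unfolding abs_mult using inner_S[OF u] f(3)[of x] False C S by (intro mult_mono) auto
    ultimately show "\<bar>?D - ?u\<bar> \<le> r + (d * K + C * L / real n + C * q) * S"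
      unfolding split using parts by (simp add: mult.commute mult.left_commute)
  qed
qed

lemma finite_net:
  fixes C d :: real
  assumes "d > 0"
  shows "\<exists>U :: 'v::euclidean_space set. finite U \<and> (\<forall>v\<in>U. norm v \<le> C) \<and> (\<forall>u. norm u \<le> C \<longrightarrow> (\<exists>v\<in>U. norm (u - v) \<le> d))"
proof -
  have "cball (0::'v) C \<subseteq> (\<Union>x\<in>cball 0 C. ball x d)" using assms by force
  then obtain U where U: "finite U" "U \<subseteq> cball 0 C" "cball (0::'v) C \<subseteq> (\<Union>x\<in>U. ball x d)"
    using compactE_image[OF compact_cball, of "cball (0::'v) C" "\<lambda>x. ball x d"] by (metis open_ball)
  show ?thesis
  proof (intro exI[of _ U] conjI ballI allI impI)
    fix u :: 'v assume "norm u \<le> C"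
    then obtain v where "v \<in> U" "u \<in> ball v d" using U(3) by force
    then show "\<exists>v\<in>U. norm (u - v) \<le> d" by (auto simp: dist_norm norm_minus_commute intro!: bexI[of _ v])
  qed (use U in auto)
qed

section \<open>Oscillation of the residual empirical process\<close>

text \<open>Here p_t is the conditional mean of a bracketing increment, and the sign \<sigma>
  handles the upper and the lower bracket together. The three errors come from mesh and net radius,
  from the quadratic Taylor remainder, and from g fluctuating around f0, which is the quantity in
  (3)(d). The second bound controls the quadratic variation.\<close>

lemma compensator_estimates:
  fixes z :: "int \<Rightarrow> 'v::euclidean_space" and y p :: "int \<Rightarrow> real"
  assumes n: "n > 0" and I: "I = {1..int n}"
    and G_lip: "\<And>x y. \<bar>G y - G x\<bar> \<le> K * \<bar>y - x\<bar>"
    and G_lin: "\<And>x h. \<bar>G (x + h) - G x - h * g x\<bar> \<le> L * h\<^sup>2"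
    and L: "L \<ge> 0" and v: "norm v \<le> C" and \<sigma>: "\<bar>\<sigma>\<bar> = 1"
    and p: "\<And>t. \<bar>p t - \<sigma> * (G (x0 + v \<bullet> z t - y t) - G (x0 - y t))\<bar> \<le> K * (1 / real n + d * norm (z t))"
  shows "\<bar>(\<Sum>t\<in>I. p t) - \<sigma> * ((v \<bullet> (\<Sum>t\<in>I. z t)) * f0)\<bar>
      \<le> K * (1 + d * (\<Sum>t\<in>I. norm (z t))) + L * C\<^sup>2 * (\<Sum>t\<in>I. (norm (z t))\<^sup>2)
        + C * norm (\<Sum>t\<in>I. (g (x0 - y t) - f0) *\<^sub>R z t)" (is "?A \<le> _")
    and "(\<Sum>t\<in>I. \<bar>p t\<bar>) \<le> K * (1 + (C + d) * (\<Sum>t\<in>I. norm (z t)))"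
proof -
  have C: "C \<ge> 0" using v norm_ge_zero order_trans by blast
  have K: "K \<ge> 0" using G_lip[of 0 1] by simp
  have vz: "\<bar>v \<bullet> z t\<bar> \<le> C * norm (z t)" for t
    using order_trans[OF Cauchy_Schwarz_ineq2 mult_right_mono[OF v norm_ge_zero]] .
  define D where "D t = G (x0 + v \<bullet> z t - y t) - G (x0 - y t)" for t
  have Kn: "(\<Sum>t\<in>I. K * (1 / real n + c * norm (z t))) = K * (1 + c * (\<Sum>t\<in>I. norm (z t)))" for c
    using n unfolding I by (simp add: sum_distrib_left[symmetric] sum.distrib)
  have D_lin: "\<bar>D t - v \<bullet> z t * g (x0 - y t)\<bar> \<le> L * C\<^sup>2 * (norm (z t))\<^sup>2" for t
  proof -
    have "\<bar>D t - v \<bullet> z t * g (x0 - y t)\<bar> \<le> L * (v \<bullet> z t)\<^sup>2"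
      using G_lin[of "x0 - y t" "v \<bullet> z t"] by (simp add: D_def algebra_simps)
    also have "(v \<bullet> z t)\<^sup>2 \<le> (C * norm (z t))\<^sup>2" using vz[of t] C by (intro abs_le_square_iff[THEN iffD1]) simp
    finally show ?thesis using L by (simp add: mult_left_mono power_mult_distrib mult.assoc)
  qed
  have D_abs: "\<bar>D t\<bar> \<le> K * (C * norm (z t))" for t
  proof -
    have "\<bar>D t\<bar> \<le> K * \<bar>v \<bullet> z t\<bar>" using G_lip[of "x0 + v \<bullet> z t - y t" "x0 - y t"] by (simp add: D_def)
    also have "\<dots> \<le> K * (C * norm (z t))" using vz K by (intro mult_left_mono)
    finally show ?thesis .
  qed
  have e1: "\<bar>\<Sum>t\<in>I. p t - \<sigma> * D t\<bar> \<le> K * (1 + d * (\<Sum>t\<in>I. norm (z t)))"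
    unfolding Kn[symmetric] by (rule order_trans[OF sum_abs sum_mono]) (use p in \<open>simp add: D_def\<close>)
  have e2: "\<bar>\<Sum>t\<in>I. D t - v \<bullet> z t * g (x0 - y t)\<bar> \<le> L * C\<^sup>2 * (\<Sum>t\<in>I. (norm (z t))\<^sup>2)"
    unfolding sum_distrib_left by (rule order_trans[OF sum_abs sum_mono]) (rule D_lin)
  have e3: "\<bar>\<Sum>t\<in>I. v \<bullet> z t * (g (x0 - y t) - f0)\<bar> \<le> C * norm (\<Sum>t\<in>I. (g (x0 - y t) - f0) *\<^sub>R z t)"
  proof -
    have "(\<Sum>t\<in>I. v \<bullet> z t * (g (x0 - y t) - f0)) = v \<bullet> (\<Sum>t\<in>I. (g (x0 - y t) - f0) *\<^sub>R z t)"
      by (simp add: inner_sum_right mult.commute)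
    also have "\<bar>\<dots>\<bar> \<le> norm v * norm (\<Sum>t\<in>I. (g (x0 - y t) - f0) *\<^sub>R z t)" by (rule Cauchy_Schwarz_ineq2)
    also have "\<dots> \<le> C * norm (\<Sum>t\<in>I. (g (x0 - y t) - f0) *\<^sub>R z t)" by (intro mult_right_mono v) simp
    finally show ?thesis .
  qed
  \<comment> \<open>Bracket to exact displacement, exact displacement to its linear part, and linear
    part to its mean slope f0.\<close>
  have "(\<Sum>t\<in>I. p t) - \<sigma> * ((v \<bullet> (\<Sum>t\<in>I. z t)) * f0) = (\<Sum>t\<in>I. p t - \<sigma> * D t)
     + \<sigma> * ((\<Sum>t\<in>I. D t - v \<bullet> z t * g (x0 - y t)) + (\<Sum>t\<in>I. v \<bullet> z t * (g (x0 - y t) - f0)))"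
    by (simp add: sum_subtractf sum.distrib inner_sum_right sum_distrib_left sum_distrib_right algebra_simps)
  then have "?A \<le> \<bar>\<Sum>t\<in>I. p t - \<sigma> * D t\<bar> + \<bar>\<sigma>\<bar> * (\<bar>\<Sum>t\<in>I. D t - v \<bullet> z t * g (x0 - y t)\<bar>
      + \<bar>\<Sum>t\<in>I. v \<bullet> z t * (g (x0 - y t) - f0)\<bar>)"
    by (simp only:) (intro order_trans[OF abs_triangle_ineq] add_mono order_refl,
        simp only: abs_mult \<sigma> mult_1 abs_triangle_ineq)
  then have "?A \<le> \<bar>\<Sum>t\<in>I. p t - \<sigma> * D t\<bar> + (\<bar>\<Sum>t\<in>I. D t - v \<bullet> z t * g (x0 - y t)\<bar>
      + \<bar>\<Sum>t\<in>I. v \<bullet> z t * (g (x0 - y t) - f0)\<bar>)"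
    by (simp only: \<sigma> mult_1)
  also have "\<dots> \<le> K * (1 + d * (\<Sum>t\<in>I. norm (z t))) + (L * C\<^sup>2 * (\<Sum>t\<in>I. (norm (z t))\<^sup>2)
        + C * norm (\<Sum>t\<in>I. (g (x0 - y t) - f0) *\<^sub>R z t))"
    by (intro add_mono e1 e2 e3)
  finally show "?A \<le> K * (1 + d * (\<Sum>t\<in>I. norm (z t))) + L * C\<^sup>2 * (\<Sum>t\<in>I. (norm (z t))\<^sup>2)
        + C * norm (\<Sum>t\<in>I. (g (x0 - y t) - f0) *\<^sub>R z t)"
    by (simp only: add.assoc)
  have "\<bar>p t\<bar> \<le> K * (1 / real n + (C + d) * norm (z t))" for t
  proof -
    have "\<bar>p t\<bar> \<le> \<bar>p t - \<sigma> * D t\<bar> + \<bar>\<sigma> * D t\<bar>" by linarith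
    also have "\<dots> \<le> K * (1 / real n + d * norm (z t)) + K * (C * norm (z t))"
      using p[of t] D_abs[of t] by (intro add_mono) (simp_all add: abs_mult \<sigma> D_def)
    finally show ?thesis by (simp add: algebra_simps)
  qed
  then show "(\<Sum>t\<in>I. \<bar>p t\<bar>) \<le> K * (1 + (C + d) * (\<Sum>t\<in>I. norm (z t)))"
    unfolding Kn[symmetric] by (rule sum_mono)
qed

lemma (in prob_space) markov_sum:
  fixes Q :: "'i \<Rightarrow> 'a \<Rightarrow> real"
  assumes "\<And>i. i \<in> I \<Longrightarrow> integrable M (Q i)" "\<And>i \<omega>. i \<in> I \<Longrightarrow> 0 \<le> Q i \<omega>"
    and "(\<Sum>i\<in>I. expectation (Q i)) \<le> r * c" and c: "c > 0"
  shows "{\<omega>\<in>space M. (\<Sum>i\<in>I. Q i \<omega>) > c} \<in> events"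
    and "prob {\<omega>\<in>space M. (\<Sum>i\<in>I. Q i \<omega>) > c} \<le> r"
proof -
  have int: "integrable M (\<lambda>\<omega>. \<Sum>i\<in>I. Q i \<omega>)" using assms by auto
  then have [measurable]: "(\<lambda>\<omega>. \<Sum>i\<in>I. Q i \<omega>) \<in> borel_measurable M" by auto
  show "{\<omega>\<in>space M. (\<Sum>i\<in>I. Q i \<omega>) > c} \<in> events" by measurable
  have "prob {\<omega>\<in>space M. (\<Sum>i\<in>I. Q i \<omega>) > c} \<le> prob {\<omega>\<in>space M. (\<Sum>i\<in>I. Q i \<omega>) \<ge> c}"
    by (rule finite_measure_mono) auto
  also have "\<dots> \<le> expectation (\<lambda>\<omega>. \<Sum>i\<in>I. Q i \<omega>) / c"
    by (rule integral_Markov_inequality_measure[OF int sets.empty_sets]) (use assms in \<open>auto intro!: AE_I2 sum_nonneg\<close>)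
  also have "expectation (\<lambda>\<omega>. \<Sum>i\<in>I. Q i \<omega>) = (\<Sum>i\<in>I. expectation (Q i))"
    by (rule Bochner_Integration.integral_sum) (use assms in auto)
  also have "\<dots> / c \<le> r" using assms(3) c by (simp add: field_simps)
  finally show "prob {\<omega>\<in>space M. (\<Sum>i\<in>I. Q i \<omega>) > c} \<le> r" .
qed

text \<open>Z n t stands for \<open>transpose (\<delta> n) *v X t\<close> and s n for \<sigma>_n;
  the moment conditions are (3)(b) and (3)(c) cleared of denominators. They concern the regressors
  alone and can therefore be carried over to a product space.\<close>

locale displacement_array = prob_space M for M :: "'a measure" +
  fixes Z :: "nat \<Rightarrow> int \<Rightarrow> 'a \<Rightarrow> 'v::euclidean_space" and s :: "nat \<Rightarrow> real" and B c :: real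
  assumes Z_measurable: "\<And>n t. n > 0 \<Longrightarrow> t \<in> {1..int n} \<Longrightarrow> Z n t \<in> borel_measurable M"
    and Z_integrable: "\<And>n t. n > 0 \<Longrightarrow> t \<in> {1..int n} \<Longrightarrow> integrable M (\<lambda>\<omega>. norm (Z n t \<omega>))"
    and Z_square_integrable: "\<And>n t. n > 0 \<Longrightarrow> t \<in> {1..int n} \<Longrightarrow> integrable M (\<lambda>\<omega>. (norm (Z n t \<omega>))\<^sup>2)"
    and c_pos: "c > 0" and s_growth: "eventually (\<lambda>n. s n \<ge> c * sqrt (real n)) sequentially"
    and Z_mean: "eventually (\<lambda>n. (\<Sum>t\<in>{1..int n}. expectation (\<lambda>\<omega>. norm (Z n t \<omega>))) \<le> B * s n) sequentially"
    and Z_square: "\<And>r. r > 0 \<Longrightarrow> eventually (\<lambda>n. (\<Sum>t\<in>{1..int n}. expectation (\<lambda>\<omega>. (norm (Z n t \<omega>))\<^sup>2)) \<le> r * s n) sequentially"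

lemma eventually_ge_of_sqrt_growth:
  fixes s :: "nat \<Rightarrow> real"
  assumes "c > 0" "eventually (\<lambda>n. s n \<ge> c * sqrt (real n)) sequentially"
  shows "eventually (\<lambda>n. s n \<ge> r) sequentially"
proof -
  have "filterlim (\<lambda>n. c * sqrt (real n)) at_top sequentially" using assms(1) by real_asymp
  then have "eventually (\<lambda>n. c * sqrt (real n) \<ge> r) sequentially" by (simp add: filterlim_at_top)
  with assms(2) show ?thesis by eventually_elim linarith
qed

text \<open>The process \<open>Y\<^sub>t\<close> stands for \<open>\<xi>\<^sub>t\<^sub>-\<^sub>1\<close>. The locale is abstract in the probability space
  because the case of regressors independent of the errors is treated on the square of \<open>M\<close>: the joint law of
  \<open>X\<close> and \<open>\<epsilon>\<close> is known to be a product, but for that of \<open>X\<close> and \<open>\<xi>\<close> one would have to invert the filter.\<close>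

locale regression_array = displacement_array M Z s B c
  for M :: "'a measure" and Z :: "nat \<Rightarrow> int \<Rightarrow> 'a \<Rightarrow> 'v::euclidean_space" and s B c +
  fixes E Y :: "int \<Rightarrow> 'a \<Rightarrow> real" and G g f :: "real \<Rightarrow> real" and K L V :: real
  assumes E_measurable [measurable]: "\<And>t. E t \<in> borel_measurable M"
    and Y_measurable [measurable]: "\<And>t. Y t \<in> borel_measurable M"
    and G_measurable [measurable]: "G \<in> borel_measurable borel"
    and G_lip: "\<And>x y. \<bar>G y - G x\<bar> \<le> K * \<bar>y - x\<bar>"
    and G_lin: "\<And>x h. \<bar>G (x + h) - G x - h * g x\<bar> \<le> L * h\<^sup>2"
    and f_bound: "\<And>x. \<bar>f x\<bar> \<le> K" and f_lip: "\<And>x y. \<bar>f x - f y\<bar> \<le> L * \<bar>x - y\<bar>"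
    and f_vanish: "\<And>r. r > 0 \<Longrightarrow> \<exists>b>0. \<forall>x. \<bar>x\<bar> \<ge> b \<longrightarrow> \<bar>f x\<bar> \<le> r"
    and exp_ineq: "\<And>n l v1 c1 x1 v2 c2 x2. n > 0 \<Longrightarrow> 0 \<le> l \<Longrightarrow> l \<le> 1 \<Longrightarrow>
      (\<integral>\<^sup>+\<omega>. ennreal (exp (\<Sum>t\<in>{1..int n}.
         l * (of_bool (E t \<omega> \<le> x1 + v1 \<bullet> Z n t \<omega> + c1 * norm (Z n t \<omega>))
              - of_bool (E t \<omega> \<le> x2 + v2 \<bullet> Z n t \<omega> + c2 * norm (Z n t \<omega>))
              - (G (x1 + v1 \<bullet> Z n t \<omega> + c1 * norm (Z n t \<omega>) - Y t \<omega>) - G (x2 + v2 \<bullet> Z n t \<omega> + c2 * norm (Z n t \<omega>) - Y t \<omega>)))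
         - l\<^sup>2 * \<bar>G (x1 + v1 \<bullet> Z n t \<omega> + c1 * norm (Z n t \<omega>) - Y t \<omega>) - G (x2 + v2 \<bullet> Z n t \<omega> + c2 * norm (Z n t \<omega>) - Y t \<omega>)\<bar>)) \<partial>M) \<le> 1"
    and E_square: "\<And>t. integrable M (\<lambda>\<omega>. (E t \<omega>)\<^sup>2)" "\<And>t. expectation (\<lambda>\<omega>. (E t \<omega>)\<^sup>2) \<le> V"
    and linear_small: "\<And>r \<theta>. r > 0 \<Longrightarrow> \<theta> > 0 \<Longrightarrow> eventually (\<lambda>n. \<exists>N\<in>events. prob N \<le> \<theta> \<and>
      (\<forall>\<omega>\<in>space M - N. \<forall>x. norm (\<Sum>t\<in>{1..int n}. (g (x - Y t \<omega>) - f x) *\<^sub>R Z n t \<omega>) \<le> r * s n)) sequentially"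
begin

definition level :: "nat \<Rightarrow> real \<Rightarrow> 'v \<Rightarrow> real \<Rightarrow> int \<Rightarrow> 'a \<Rightarrow> real" where
  "level n x v d t \<omega> = x + v \<bullet> Z n t \<omega> + d * norm (Z n t \<omega>)"

definition drift :: "nat \<Rightarrow> real \<Rightarrow> 'v \<Rightarrow> real \<Rightarrow> real \<Rightarrow> 'v \<Rightarrow> real \<Rightarrow> int \<Rightarrow> 'a \<Rightarrow> real" where
  "drift n x1 v1 c1 x2 v2 c2 t \<omega> = G (level n x1 v1 c1 t \<omega> - Y t \<omega>) - G (level n x2 v2 c2 t \<omega> - Y t \<omega>)"

lemma level_measurable: "n > 0 \<Longrightarrow> t \<in> {1..int n} \<Longrightarrow> level n x v d t \<in> borel_measurable M"
  using Z_measurable[of n t] unfolding level_def[abs_def] by measurable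

lemma drift_measurable:
  "n > 0 \<Longrightarrow> t \<in> {1..int n} \<Longrightarrow> drift n x1 v1 c1 x2 v2 c2 t \<in> borel_measurable M"
  using level_measurable[of n t x1 v1 c1] level_measurable[of n t x2 v2 c2]
  unfolding drift_def[abs_def] by measurable

definition deviation :: "nat \<Rightarrow> real \<Rightarrow> 'v \<Rightarrow> real \<Rightarrow> real \<Rightarrow> 'v \<Rightarrow> real \<Rightarrow> 'a \<Rightarrow> real" where
  "deviation n x1 v1 c1 x2 v2 c2 \<omega> = (\<Sum>t\<in>{1..int n}.
     of_bool (E t \<omega> \<le> level n x1 v1 c1 t \<omega>) - of_bool (E t \<omega> \<le> level n x2 v2 c2 t \<omega>) - drift n x1 v1 c1 x2 v2 c2 t \<omega>)"

text \<open>For the linear process this dominates the predictable quadratic variation of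
  \<open>deviation\<close>, since a difference of indicators with one sign and conditional mean p
  has conditional variance |p| - p^2.\<close>

definition variation :: "nat \<Rightarrow> real \<Rightarrow> 'v \<Rightarrow> real \<Rightarrow> real \<Rightarrow> 'v \<Rightarrow> real \<Rightarrow> 'a \<Rightarrow> real" where
  "variation n x1 v1 c1 x2 v2 c2 \<omega> = (\<Sum>t\<in>{1..int n}. \<bar>drift n x1 v1 c1 x2 v2 c2 t \<omega>\<bar>)"

lemma deviation_measurable: "n > 0 \<Longrightarrow> deviation n x1 v1 c1 x2 v2 c2 \<in> borel_measurable M"
proof -
  assume n: "n > 0"
  have "(\<lambda>\<omega>. of_bool (E t \<omega> \<le> level n x1 v1 c1 t \<omega>) - of_bool (E t \<omega> \<le> level n x2 v2 c2 t \<omega>)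
      - drift n x1 v1 c1 x2 v2 c2 t \<omega>) \<in> borel_measurable M" if t: "t \<in> {1..int n}" for t
  proof -
    note [measurable] = level_measurable[OF n t] drift_measurable[OF n t]
    show ?thesis by measurable
  qed
  then show ?thesis unfolding deviation_def[abs_def] by (intro borel_measurable_sum)
qed

lemma variation_measurable: "n > 0 \<Longrightarrow> variation n x1 v1 c1 x2 v2 c2 \<in> borel_measurable M"
  unfolding variation_def[abs_def] by (intro borel_measurable_sum borel_measurable_abs drift_measurable)

text \<open>Exponential Markov inequality on the event where the random variation is under control;
  the rate l remains free for later.\<close>

lemma deviation_tail:
  assumes n: "n > 0" and l: "0 \<le> l" "l \<le> 1"
  shows "prob {\<omega>\<in>space M. deviation n x1 v1 c1 x2 v2 c2 \<omega> > r \<and> variation n x1 v1 c1 x2 v2 c2 \<omega> \<le> b}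
    \<le> exp (- l * r + l\<^sup>2 * b)"
proof -
  let ?D = "deviation n x1 v1 c1 x2 v2 c2" and ?V = "variation n x1 v1 c1 x2 v2 c2"
  note [measurable] = deviation_measurable[OF n] variation_measurable[OF n]
  define Q where "Q = {\<omega>\<in>space M. ?D \<omega> > r \<and> ?V \<omega> \<le> b}"
  have [measurable]: "Q \<in> events" unfolding Q_def by measurable
  have one: "(\<integral>\<^sup>+\<omega>. ennreal (exp (l * ?D \<omega> - l\<^sup>2 * ?V \<omega>)) \<partial>M) \<le> 1"
    using exp_ineq[OF n l, of x1 v1 c1 x2 v2 c2]
    by (simp only: deviation_def variation_def drift_def level_def sum_subtractf sum_distrib_left right_diff_distrib)
  have "ennreal (prob Q) = (\<integral>\<^sup>+\<omega>. indicator Q \<omega> \<partial>M)" by (simp add: emeasure_eq_measure)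
  also have "\<dots> \<le> (\<integral>\<^sup>+\<omega>. ennreal (exp (- l * r + l\<^sup>2 * b)) * ennreal (exp (l * ?D \<omega> - l\<^sup>2 * ?V \<omega>)) \<partial>M)"
  proof (rule nn_integral_mono)
    fix \<omega>
    show "indicator Q \<omega> \<le> ennreal (exp (- l * r + l\<^sup>2 * b)) * ennreal (exp (l * ?D \<omega> - l\<^sup>2 * ?V \<omega>))"
    proof (cases "\<omega> \<in> Q")
      case True
      then have "l * r \<le> l * ?D \<omega>" "l\<^sup>2 * ?V \<omega> \<le> l\<^sup>2 * b"
        using l by (auto simp: Q_def intro!: mult_left_mono)
      then have "0 \<le> (- l * r + l\<^sup>2 * b) + (l * ?D \<omega> - l\<^sup>2 * ?V \<omega>)" by linarith
      then have "1 \<le> exp (- l * r + l\<^sup>2 * b) * exp (l * ?D \<omega> - l\<^sup>2 * ?V \<omega>)"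
        unfolding exp_add[symmetric] by simp
      then have "ennreal 1 \<le> ennreal (exp (- l * r + l\<^sup>2 * b) * exp (l * ?D \<omega> - l\<^sup>2 * ?V \<omega>))"
        by (rule ennreal_leI)
      then show ?thesis using True by (simp add: ennreal_mult')
    qed simp
  qed
  also have "\<dots> = ennreal (exp (- l * r + l\<^sup>2 * b)) * (\<integral>\<^sup>+\<omega>. ennreal (exp (l * ?D \<omega> - l\<^sup>2 * ?V \<omega>)) \<partial>M)"
    by (rule nn_integral_cmult) measurable
  also have "\<dots> \<le> ennreal (exp (- l * r + l\<^sup>2 * b)) * 1" by (intro mult_left_mono one) simp
  finally show ?thesis unfolding Q_def by (simp add: ennreal_le_iff)
qed

end

section \<open>Bracketing increments and the exceptional set of samples\<close>

context regression_array begin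

lemma K_nonneg: "K \<ge> 0" using f_bound[of 0] by simp
lemma L_nonneg: "L \<ge> 0" using f_lip[of 1 0] by simp

lemma band_count_diff:
  "band_count {1..int n} (\<lambda>t. Z n t \<omega>) (\<lambda>t. E t \<omega>) x1 v1 c1 - band_count {1..int n} (\<lambda>t. Z n t \<omega>) (\<lambda>t. E t \<omega>) x2 v2 c2
   = deviation n x1 v1 c1 x2 v2 c2 \<omega> + (\<Sum>t\<in>{1..int n}. drift n x1 v1 c1 x2 v2 c2 t \<omega>)"
  by (simp add: band_count_def deviation_def level_def sum_subtractf)

lemma upper_drift:
  assumes d: "d \<ge> 0" and x: "x1 - x0 = 1 / real n"
  shows "\<bar>drift n x1 v d x0 0 0 t \<omega> - 1 * (G (x0 + v \<bullet> Z n t \<omega> - Y t \<omega>) - G (x0 - Y t \<omega>))\<bar>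
    \<le> K * (1 / real n + d * norm (Z n t \<omega>))"
proof -
  have "drift n x1 v d x0 0 0 t \<omega> - 1 * (G (x0 + v \<bullet> Z n t \<omega> - Y t \<omega>) - G (x0 - Y t \<omega>))
     = G (x1 + v \<bullet> Z n t \<omega> + d * norm (Z n t \<omega>) - Y t \<omega>) - G (x0 + v \<bullet> Z n t \<omega> - Y t \<omega>)"
    by (simp add: drift_def level_def)
  also have "\<bar>\<dots>\<bar> \<le> K * \<bar>x1 + v \<bullet> Z n t \<omega> + d * norm (Z n t \<omega>) - Y t \<omega> - (x0 + v \<bullet> Z n t \<omega> - Y t \<omega>)\<bar>" by (rule G_lip)
  also have "x1 + v \<bullet> Z n t \<omega> + d * norm (Z n t \<omega>) - Y t \<omega> - (x0 + v \<bullet> Z n t \<omega> - Y t \<omega>) = 1 / real n + d * norm (Z n t \<omega>)"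
    using x by simp
  also have "\<bar>1 / real n + d * norm (Z n t \<omega>)\<bar> = 1 / real n + d * norm (Z n t \<omega>)" using d by simp
  finally show ?thesis .
qed

text \<open>The lower bracket subtracts the displaced count, so the leading term carries the sign
  -1; the mesh is paid for at one level and the net radius at the other.\<close>

lemma lower_drift:
  assumes d: "d \<ge> 0" and x: "x1 - x0 = 1 / real n"
  shows "\<bar>drift n x1 0 0 x0 v (- d) t \<omega> - (- 1) * (G (x0 + v \<bullet> Z n t \<omega> - Y t \<omega>) - G (x0 - Y t \<omega>))\<bar>
    \<le> K * (1 / real n + d * norm (Z n t \<omega>))"
proof -
  let ?a = "G (x1 - Y t \<omega>) - G (x0 - Y t \<omega>)"
  let ?b = "G (x0 + v \<bullet> Z n t \<omega> - Y t \<omega>) - G (x0 + v \<bullet> Z n t \<omega> + (- d) * norm (Z n t \<omega>) - Y t \<omega>)"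
  have "drift n x1 0 0 x0 v (- d) t \<omega> - (- 1) * (G (x0 + v \<bullet> Z n t \<omega> - Y t \<omega>) - G (x0 - Y t \<omega>)) = ?a + ?b"
    by (simp add: drift_def level_def)
  also have "\<bar>?a + ?b\<bar> \<le> K * (1 / real n) + K * (d * norm (Z n t \<omega>))"
  proof (rule order_trans[OF abs_triangle_ineq add_mono])
    show "\<bar>?a\<bar> \<le> K * (1 / real n)" using G_lip[of "x1 - Y t \<omega>" "x0 - Y t \<omega>"] x by simp
    show "\<bar>?b\<bar> \<le> K * (d * norm (Z n t \<omega>))"
      using G_lip[of "x0 + v \<bullet> Z n t \<omega> - Y t \<omega>" "x0 + v \<bullet> Z n t \<omega> + (- d) * norm (Z n t \<omega>) - Y t \<omega>"] d
      by (simp add: abs_mult)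
  qed
  finally show ?thesis by (simp add: distrib_left)
qed

text \<open>Regressors and errors up to time n, without \<xi>. A bad set in this space can be moved
  between M and its square, because both induce the same law on it when regressors and errors are
  independent.\<close>

definition samples :: "nat \<Rightarrow> ((int \<Rightarrow> 'v) \<times> (int \<Rightarrow> real)) measure" where
  "samples n = (\<Pi>\<^sub>M t\<in>{1..int n}. borel) \<Otimes>\<^sub>M (\<Pi>\<^sub>M t\<in>{1..int n}. borel)"

definition sample :: "nat \<Rightarrow> 'a \<Rightarrow> (int \<Rightarrow> 'v) \<times> (int \<Rightarrow> real)" where
  "sample n \<omega> = ((\<lambda>t\<in>{1..int n}. Z n t \<omega>), (\<lambda>t\<in>{1..int n}. E t \<omega>))"

lemma band_count_measurable:
  "(\<lambda>p. band_count {1..int n} (fst p) (snd p) x v d) \<in> borel_measurable (samples n)"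
  unfolding band_count_def
proof (rule borel_measurable_sum)
  fix t assume t [measurable]: "t \<in> {1..int n}"
  show "(\<lambda>p. of_bool (snd p t \<le> x + v \<bullet> fst p t + d * norm (fst p t)) :: real) \<in> borel_measurable (samples n)"
    unfolding samples_def by measurable
qed

text \<open>The failure of one of the hypotheses of \<open>oscillation_from_grid\<close>, or of the
  bound b for the sum of the norms. Only finitely many conditions on the sample occur when U is
  finite, which makes the set measurable, while its complement controls all real x and all u in the
  ball.\<close>

definition exceptional :: "nat \<Rightarrow> 'v set \<Rightarrow> real \<Rightarrow> real \<Rightarrow> real \<Rightarrow> real \<Rightarrow> ((int \<Rightarrow> 'v) \<times> (int \<Rightarrow> real)) set" where
  "exceptional n U C d b r = {p \<in> space (samples n).
     (\<Sum>t\<in>{1..int n}. norm (fst p t)) > b \<or>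
     (\<Sum>t\<in>{1..int n}. of_bool (\<bar>snd p t\<bar> \<ge> real n / 2) + of_bool (C * norm (fst p t) \<ge> real n / 2)) > r \<or>
     (\<exists>v\<in>U. \<exists>j\<in>{- int (n\<^sup>2)..int (n\<^sup>2)}.
       band_count {1..int n} (fst p) (snd p) (real_of_int (j + 1) / real n) v d
         - band_count {1..int n} (fst p) (snd p) (real_of_int j / real n) 0 0
         - (v \<bullet> (\<Sum>t\<in>{1..int n}. fst p t)) * f (real_of_int j / real n) > r \<or>
       band_count {1..int n} (fst p) (snd p) (real_of_int (j + 1) / real n) 0 0
         - band_count {1..int n} (fst p) (snd p) (real_of_int j / real n) v (- d)
         + (v \<bullet> (\<Sum>t\<in>{1..int n}. fst p t)) * f (real_of_int j / real n) > r)}"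

lemma exceptional_measurable:
  assumes "finite U" shows "exceptional n U C d b r \<in> sets (samples n)"
proof -
  have c1: "(\<lambda>p. fst p t) \<in> borel_measurable (samples n)" if [measurable]: "t \<in> {1..int n}" for t
    unfolding samples_def by measurable
  have c2: "(\<lambda>p. snd p t) \<in> borel_measurable (samples n)" if [measurable]: "t \<in> {1..int n}" for t
    unfolding samples_def by measurable
  have norms: "(\<lambda>p. \<Sum>t\<in>{1..int n}. norm (fst p t)) \<in> borel_measurable (samples n)"
  proof (rule borel_measurable_sum)
    fix t assume "t \<in> {1..int n}"
    note [measurable] = c1[OF this]
    show "(\<lambda>p. norm (fst p t)) \<in> borel_measurable (samples n)" by measurable
  qed
  have sums: "(\<lambda>p. \<Sum>t\<in>{1..int n}. fst p t) \<in> borel_measurable (samples n)"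
    by (rule borel_measurable_sum) (rule c1)
  have tail: "(\<lambda>p. \<Sum>t\<in>{1..int n}. of_bool (\<bar>snd p t\<bar> \<ge> real n / 2) + of_bool (C * norm (fst p t) \<ge> real n / 2) :: real) \<in> borel_measurable (samples n)"
  proof (rule borel_measurable_sum)
    fix t assume "t \<in> {1..int n}"
    note [measurable] = c1[OF this] c2[OF this]
    show "(\<lambda>p. of_bool (\<bar>snd p t\<bar> \<ge> real n / 2) + of_bool (C * norm (fst p t) \<ge> real n / 2) :: real) \<in> borel_measurable (samples n)"
      by measurable
  qed
  show ?thesis unfolding exceptional_def
    by (intro predE pred_intros_logic pred_intros_finite assms finite_atLeastAtMost_int borel_measurable_pred_less
        borel_measurable_const borel_measurable_add borel_measurable_diff borel_measurable_times borel_measurable_inner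
        band_count_measurable norms sums tail)
qed

lemma not_exceptional:
  assumes n: "n > 0" and p: "(z, \<epsilon>) \<in> space (samples n)" "(z, \<epsilon>) \<notin> exceptional n U C d b r"
    and net: "\<And>u. norm u \<le> C \<Longrightarrow> \<exists>v\<in>U. norm (u - v) \<le> d \<and> norm v \<le> C" and C: "C \<ge> 0" and d: "d \<ge> 0"
    and q: "\<And>x. \<bar>x\<bar> \<ge> real n \<Longrightarrow> \<bar>f x\<bar> \<le> q" and u: "norm u \<le> C"
  shows "\<bar>(\<Sum>t\<in>{1..int n}. of_bool (\<epsilon> t \<le> x + u \<bullet> z t) - of_bool (\<epsilon> t \<le> x)) - (u \<bullet> (\<Sum>t\<in>{1..int n}. z t)) * f x\<bar>
    \<le> r + (d * K + C * L / real n + C * q) * b"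
proof -
  have ex: "(\<Sum>t\<in>{1..int n}. norm (z t)) \<le> b"
    "(\<Sum>t\<in>{1..int n}. of_bool (\<bar>\<epsilon> t\<bar> \<ge> real n / 2) + of_bool (C * norm (z t) \<ge> real n / 2)) \<le> r"
    "\<And>v j. v \<in> U \<Longrightarrow> j \<in> {- int (n\<^sup>2)..int (n\<^sup>2)} \<Longrightarrow>
       band_count {1..int n} z \<epsilon> (real_of_int (j + 1) / real n) v d - band_count {1..int n} z \<epsilon> (real_of_int j / real n) 0 0
         - (v \<bullet> (\<Sum>t\<in>{1..int n}. z t)) * f (real_of_int j / real n) \<le> r"
    "\<And>v j. v \<in> U \<Longrightarrow> j \<in> {- int (n\<^sup>2)..int (n\<^sup>2)} \<Longrightarrow>
       band_count {1..int n} z \<epsilon> (real_of_int (j + 1) / real n) 0 0 - band_count {1..int n} z \<epsilon> (real_of_int j / real n) v (- d)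
         + (v \<bullet> (\<Sum>t\<in>{1..int n}. z t)) * f (real_of_int j / real n) \<le> r"
    using p unfolding exceptional_def by (auto simp: not_less)
  have "q \<ge> 0" using q[of "real n"] by simp
  then have "(d * K + C * L / real n + C * q) * (\<Sum>t\<in>{1..int n}. norm (z t)) \<le> (d * K + C * L / real n + C * q) * b"
    using ex(1) d K_nonneg C L_nonneg by (intro mult_left_mono) auto
  moreover have "\<bar>(\<Sum>t\<in>{1..int n}. of_bool (\<epsilon> t \<le> x + u \<bullet> z t) - of_bool (\<epsilon> t \<le> x)) - (u \<bullet> (\<Sum>t\<in>{1..int n}. z t)) * f x\<bar>
    \<le> r + (d * K + C * L / real n + C * q) * (\<Sum>t\<in>{1..int n}. norm (z t))"
    by (rule oscillation_from_grid[OF n _ net C ex(3) ex(4) ex(2) f_bound f_lip q L_nonneg u]) auto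
  ultimately show ?thesis by linarith
qed

end

section \<open>Probability bounds at the nodes of the grid\<close>

context regression_array begin

lemmas s_ge = eventually_ge_of_sqrt_growth[OF c_pos s_growth]

text \<open>Chebyshev's inequality for E_t gives n terms of size 4V/n^2, and Markov's inequality is
  enough for Z_t. The factor 1/n is the reason for letting the grid extend to distance n.\<close>

lemma tail_expectation:
  assumes n: "n > 0" and C: "C \<ge> 0"
  shows "(\<Sum>t\<in>{1..int n}. expectation (\<lambda>\<omega>. of_bool (\<bar>E t \<omega>\<bar> \<ge> real n / 2) + of_bool (C * norm (Z n t \<omega>) \<ge> real n / 2)))
     \<le> (4 * V + 2 * C * (\<Sum>t\<in>{1..int n}. expectation (\<lambda>\<omega>. norm (Z n t \<omega>)))) / real n"
    and "t \<in> {1..int n} \<Longrightarrow> integrable M (\<lambda>\<omega>. of_bool (\<bar>E t \<omega>\<bar> \<ge> real n / 2) + of_bool (C * norm (Z n t \<omega>) \<ge> real n / 2) :: real)"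
proof -
  have int: "integrable M (\<lambda>\<omega>. of_bool (\<bar>E t \<omega>\<bar> \<ge> real n / 2) + of_bool (C * norm (Z n t \<omega>) \<ge> real n / 2) :: real)"
    if t: "t \<in> {1..int n}" for t
  proof -
    note [measurable] = Z_measurable[OF n t]
    show ?thesis by (rule integrable_const_bound[of _ 2]) (auto simp: of_bool_def)
  qed
  then show "t \<in> {1..int n} \<Longrightarrow> integrable M (\<lambda>\<omega>. of_bool (\<bar>E t \<omega>\<bar> \<ge> real n / 2) + of_bool (C * norm (Z n t \<omega>) \<ge> real n / 2) :: real)" .
  have "expectation (\<lambda>\<omega>. of_bool (\<bar>E t \<omega>\<bar> \<ge> real n / 2) + of_bool (C * norm (Z n t \<omega>) \<ge> real n / 2))
      \<le> 4 * V / (real n)\<^sup>2 + 2 * C / real n * expectation (\<lambda>\<omega>. norm (Z n t \<omega>))" if t: "t \<in> {1..int n}" for t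
  proof -
    let ?b = "\<lambda>\<omega>. 4 / (real n)\<^sup>2 * (E t \<omega>)\<^sup>2 + 2 * C / real n * norm (Z n t \<omega>)"
    have ib: "integrable M ?b" using E_square(1) Z_integrable[OF n t] by auto
    have pt: "of_bool (\<bar>E t \<omega>\<bar> \<ge> real n / 2) + of_bool (C * norm (Z n t \<omega>) \<ge> real n / 2) \<le> ?b \<omega>" for \<omega>
    proof (rule add_mono)
      show "of_bool (\<bar>E t \<omega>\<bar> \<ge> real n / 2) \<le> 4 / (real n)\<^sup>2 * (E t \<omega>)\<^sup>2"
      proof (cases "\<bar>E t \<omega>\<bar> \<ge> real n / 2")
        case True
        then have "(real n / 2)\<^sup>2 \<le> \<bar>E t \<omega>\<bar>\<^sup>2" by (intro power_mono) auto
        then show ?thesis using True n by (simp add: field_simps power2_eq_square)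
      qed simp
      show "of_bool (C * norm (Z n t \<omega>) \<ge> real n / 2) \<le> 2 * C / real n * norm (Z n t \<omega>)"
        using n C by (auto simp: of_bool_def field_simps)
    qed
    have "expectation (\<lambda>\<omega>. of_bool (\<bar>E t \<omega>\<bar> \<ge> real n / 2) + of_bool (C * norm (Z n t \<omega>) \<ge> real n / 2)) \<le> expectation ?b"
      by (rule integral_mono[OF int[OF t] ib pt])
    also have "\<dots> = 4 / (real n)\<^sup>2 * expectation (\<lambda>\<omega>. (E t \<omega>)\<^sup>2) + 2 * C / real n * expectation (\<lambda>\<omega>. norm (Z n t \<omega>))"
      using E_square(1) Z_integrable[OF n t] by simp
    also have "4 / (real n)\<^sup>2 * expectation (\<lambda>\<omega>. (E t \<omega>)\<^sup>2) \<le> 4 / (real n)\<^sup>2 * V"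
      by (intro mult_left_mono E_square(2)) simp
    finally show ?thesis by simp
  qed
  then have "(\<Sum>t\<in>{1..int n}. expectation (\<lambda>\<omega>. of_bool (\<bar>E t \<omega>\<bar> \<ge> real n / 2) + of_bool (C * norm (Z n t \<omega>) \<ge> real n / 2)))
     \<le> (\<Sum>t\<in>{1..int n}. 4 * V / (real n)\<^sup>2 + 2 * C / real n * expectation (\<lambda>\<omega>. norm (Z n t \<omega>)))"
    by (rule sum_mono)
  also have "\<dots> = real n * (4 * V / (real n)\<^sup>2) + 2 * C / real n * (\<Sum>t\<in>{1..int n}. expectation (\<lambda>\<omega>. norm (Z n t \<omega>)))"
    by (simp add: sum.distrib sum_distrib_left)
  also have "\<dots> = (4 * V + 2 * C * (\<Sum>t\<in>{1..int n}. expectation (\<lambda>\<omega>. norm (Z n t \<omega>)))) / real n"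
    using n by (simp add: field_simps power2_eq_square)
  finally show "(\<Sum>t\<in>{1..int n}. expectation (\<lambda>\<omega>. of_bool (\<bar>E t \<omega>\<bar> \<ge> real n / 2) + of_bool (C * norm (Z n t \<omega>) \<ge> real n / 2)))
     \<le> (4 * V + 2 * C * (\<Sum>t\<in>{1..int n}. expectation (\<lambda>\<omega>. norm (Z n t \<omega>)))) / real n" .
qed

text \<open>An excess above 2r at a node splits into the compensated part and the centred drift. The
  latter is at most r, so the martingale alone must exceed r, and its variation is bounded on the
  same event.\<close>

lemma grid_failure_imp_deviation:
  assumes n: "n > 0" and v: "norm v \<le> C" and d: "d \<ge> 0"
    and S: "(\<Sum>t\<in>{1..int n}. norm (Z n t \<omega>)) \<le> b"
    and S2: "(\<Sum>t\<in>{1..int n}. (norm (Z n t \<omega>))\<^sup>2) \<le> k"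
    and lin: "\<And>x. norm (\<Sum>t\<in>{1..int n}. (g (x - Y t \<omega>) - f x) *\<^sub>R Z n t \<omega>) \<le> k"
    and small: "K * (1 + d * b) + (L * C\<^sup>2 + C) * k \<le> r"
    and x0: "x0 = real_of_int j / real n" and x1: "x1 = real_of_int (j + 1) / real n"
  shows "band_count {1..int n} (\<lambda>t. Z n t \<omega>) (\<lambda>t. E t \<omega>) x1 v d - band_count {1..int n} (\<lambda>t. Z n t \<omega>) (\<lambda>t. E t \<omega>) x0 0 0
        - (v \<bullet> (\<Sum>t\<in>{1..int n}. Z n t \<omega>)) * f x0 > 2 * r
      \<Longrightarrow> deviation n x1 v d x0 0 0 \<omega> > r \<and> variation n x1 v d x0 0 0 \<omega> \<le> K * (1 + (C + d) * b)" (is "?U \<Longrightarrow> _")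
    and "band_count {1..int n} (\<lambda>t. Z n t \<omega>) (\<lambda>t. E t \<omega>) x1 0 0 - band_count {1..int n} (\<lambda>t. Z n t \<omega>) (\<lambda>t. E t \<omega>) x0 v (- d)
        + (v \<bullet> (\<Sum>t\<in>{1..int n}. Z n t \<omega>)) * f x0 > 2 * r
      \<Longrightarrow> deviation n x1 0 0 x0 v (- d) \<omega> > r \<and> variation n x1 0 0 x0 v (- d) \<omega> \<le> K * (1 + (C + d) * b)" (is "?L \<Longrightarrow> _")
proof -
  have C: "C \<ge> 0" using v norm_ge_zero order_trans by blast
  have x: "x1 - x0 = 1 / real n" unfolding x0 x1 by (simp add: diff_divide_distrib[symmetric])
  have lim: "K * (1 + d * (\<Sum>t\<in>{1..int n}. norm (Z n t \<omega>))) + L * C\<^sup>2 * (\<Sum>t\<in>{1..int n}. (norm (Z n t \<omega>))\<^sup>2)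
        + C * norm (\<Sum>t\<in>{1..int n}. (g (x0 - Y t \<omega>) - f x0) *\<^sub>R Z n t \<omega>) \<le> r"
  proof -
    have "K * (1 + d * (\<Sum>t\<in>{1..int n}. norm (Z n t \<omega>))) + L * C\<^sup>2 * (\<Sum>t\<in>{1..int n}. (norm (Z n t \<omega>))\<^sup>2)
        + C * norm (\<Sum>t\<in>{1..int n}. (g (x0 - Y t \<omega>) - f x0) *\<^sub>R Z n t \<omega>) \<le> K * (1 + d * b) + L * C\<^sup>2 * k + C * k"
      using S S2 lin[of x0] C d L_nonneg K_nonneg by (intro add_mono mult_left_mono order_refl) auto
    then show ?thesis using small by (simp add: distrib_right)
  qed
  have var: "K * (1 + (C + d) * (\<Sum>t\<in>{1..int n}. norm (Z n t \<omega>))) \<le> K * (1 + (C + d) * b)"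
    using S C d K_nonneg by (intro add_mono mult_left_mono order_refl) auto
  {
    assume ?U
    note est1 = compensator_estimates(1)[where ?f0.0 = "f x0" and z = "\<lambda>t. Z n t \<omega>" and y = "\<lambda>t. Y t \<omega>" and \<sigma> = 1,
        OF n refl G_lip G_lin L_nonneg v _ upper_drift[OF d x, where v = v and \<omega> = \<omega>]]
    note est = compensator_estimates(2)[where z = "\<lambda>t. Z n t \<omega>" and y = "\<lambda>t. Y t \<omega>" and \<sigma> = 1,
        OF n refl G_lip G_lin L_nonneg v _ upper_drift[OF d x, where v = v and \<omega> = \<omega>]]
    have "\<bar>(\<Sum>t\<in>{1..int n}. drift n x1 v d x0 0 0 t \<omega>) - 1 * ((v \<bullet> (\<Sum>t\<in>{1..int n}. Z n t \<omega>)) * f x0)\<bar> \<le> r"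
      by (rule order_trans[OF est1 lim]) simp
    then show "deviation n x1 v d x0 0 0 \<omega> > r \<and> variation n x1 v d x0 0 0 \<omega> \<le> K * (1 + (C + d) * b)"
      using \<open>?U\<close> est var unfolding band_count_diff variation_def by auto
  next
    assume ?L
    note est1 = compensator_estimates(1)[where ?f0.0 = "f x0" and z = "\<lambda>t. Z n t \<omega>" and y = "\<lambda>t. Y t \<omega>" and \<sigma> = "- 1",
        OF n refl G_lip G_lin L_nonneg v _ lower_drift[OF d x, where v = v and \<omega> = \<omega>]]
    note est = compensator_estimates(2)[where z = "\<lambda>t. Z n t \<omega>" and y = "\<lambda>t. Y t \<omega>" and \<sigma> = "- 1",
        OF n refl G_lip G_lin L_nonneg v _ lower_drift[OF d x, where v = v and \<omega> = \<omega>]]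
    have "\<bar>(\<Sum>t\<in>{1..int n}. drift n x1 0 0 x0 v (- d) t \<omega>) - (- 1) * ((v \<bullet> (\<Sum>t\<in>{1..int n}. Z n t \<omega>)) * f x0)\<bar> \<le> r"
      by (rule order_trans[OF est1 lim]) simp
    then show "deviation n x1 0 0 x0 v (- d) \<omega> > r \<and> variation n x1 0 0 x0 v (- d) \<omega> \<le> K * (1 + (C + d) * b)"
      using \<open>?L\<close> est var unfolding band_count_diff variation_def by auto
  }
qed

lemma sample_sums:
  "(\<Sum>t\<in>{1..int n}. h (fst (sample n \<omega>) t) (snd (sample n \<omega>) t)) = (\<Sum>t\<in>{1..int n}. h (Z n t \<omega>) (E t \<omega>))"
  by (rule sum.cong) (auto simp: sample_def)

lemma sample_in_exceptional:
  "sample n \<omega> \<in> exceptional n U C d b r \<Longrightarrow>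
     (\<Sum>t\<in>{1..int n}. norm (Z n t \<omega>)) > b \<or>
     (\<Sum>t\<in>{1..int n}. of_bool (\<bar>E t \<omega>\<bar> \<ge> real n / 2) + of_bool (C * norm (Z n t \<omega>) \<ge> real n / 2)) > r \<or>
     (\<exists>v\<in>U. \<exists>j\<in>{- int (n\<^sup>2)..int (n\<^sup>2)}.
       band_count {1..int n} (\<lambda>t. Z n t \<omega>) (\<lambda>t. E t \<omega>) (real_of_int (j + 1) / real n) v d
         - band_count {1..int n} (\<lambda>t. Z n t \<omega>) (\<lambda>t. E t \<omega>) (real_of_int j / real n) 0 0
         - (v \<bullet> (\<Sum>t\<in>{1..int n}. Z n t \<omega>)) * f (real_of_int j / real n) > r \<or>
       band_count {1..int n} (\<lambda>t. Z n t \<omega>) (\<lambda>t. E t \<omega>) (real_of_int (j + 1) / real n) 0 0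
         - band_count {1..int n} (\<lambda>t. Z n t \<omega>) (\<lambda>t. E t \<omega>) (real_of_int j / real n) v (- d)
         + (v \<bullet> (\<Sum>t\<in>{1..int n}. Z n t \<omega>)) * f (real_of_int j / real n) > r)"
proof -
  assume "sample n \<omega> \<in> exceptional n U C d b r"
  moreover have "band_count {1..int n} (fst (sample n \<omega>)) (snd (sample n \<omega>)) x v d
      = band_count {1..int n} (\<lambda>t. Z n t \<omega>) (\<lambda>t. E t \<omega>) x v d" for x v d
    unfolding band_count_def by (rule sample_sums[where h = "\<lambda>z e. of_bool (e \<le> x + v \<bullet> z + d * norm z)"])
  moreover have "(\<Sum>t\<in>{1..int n}. fst (sample n \<omega>) t) = (\<Sum>t\<in>{1..int n}. Z n t \<omega>)"
    by (rule sample_sums[where h = "\<lambda>z e. z"])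
  ultimately show ?thesis
    unfolding exceptional_def sample_sums[where h = "\<lambda>z e. norm z"]
      sample_sums[where h = "\<lambda>z e. of_bool (\<bar>e\<bar> \<ge> real n / 2) + of_bool (C * norm z \<ge> real n / 2)"] mem_Collect_eq
    by (simp only: conj_commute simp_thms)
qed

end

section \<open>Uniform bound for the oscillation\<close>

context regression_array begin

text \<open>Five events share the probability \<theta>: large first moments, large second moments, a
  large linear term, a heavy tail, and a large martingale at some node. Outside them no hypothesis
  of \<open>oscillation_from_grid\<close> fails.\<close>

theorem oscillation_small:
  assumes C: "C \<ge> 0" and \<eta>: "\<eta> > 0" and \<theta>: "\<theta> > 0"
  shows "eventually (\<lambda>n. \<exists>S\<in>sets (samples n). prob {\<omega>\<in>space M. sample n \<omega> \<in> S} \<le> \<theta> \<and>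
    (\<forall>z \<epsilon>. (z, \<epsilon>) \<in> space (samples n) - S \<longrightarrow> (\<forall>u x. norm u \<le> C \<longrightarrow>
      \<bar>(\<Sum>t\<in>{1..int n}. of_bool (\<epsilon> t \<le> x + u \<bullet> z t) - of_bool (\<epsilon> t \<le> x)) - (u \<bullet> (\<Sum>t\<in>{1..int n}. z t)) * f x\<bar>
      \<le> \<eta> * s n))) sequentially"
proof -
  \<comment> \<open>B1 makes the constant positive. The bound b comes from Markov's inequality at
    level \<theta>/5; d and k keep the net error and the quadratic and linear errors below \<eta>/16
    each, q keeps the contribution of f beyond the grid below \<eta>/8, and W bounds the variation
    in units of s n. The summands 1 in denominators guard against division by zero.\<close>
  define B1 where "B1 = max B 1"
  define b where "b = 5 * B1 / \<theta>"
  define d where "d = \<eta> / (16 * (K + 1) * b)"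
  define k where "k = \<eta> / (16 * (L * C\<^sup>2 + C + 1))"
  define q where "q = \<eta> / (8 * (C + 1) * b)"
  define W where "W = K * (1 + (C + d) * b)"
  define l where "l = min 1 (\<eta> / (8 * (W + 1)))"
  note K = K_nonneg and L = L_nonneg
  have B1: "B1 \<ge> B" "B1 > 0" by (auto simp: B1_def)
  have b: "b > 0" using B1 \<theta> by (simp add: b_def)
  have LC: "L * C\<^sup>2 + C \<ge> 0" using L C by simp
  have d: "d > 0" "K * (d * b) \<le> \<eta> / 16"
  proof -
    show "d > 0" using \<eta> K b by (simp add: d_def)
    have "K * (d * b) = \<eta> / 16 * (K / (K + 1))" unfolding d_def using b K by (simp add: divide_simps)
    also have "\<dots> \<le> \<eta> / 16 * 1" using K \<eta> by (intro mult_left_mono) auto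
    finally show "K * (d * b) \<le> \<eta> / 16" by simp
  qed
  have k: "k > 0" "(L * C\<^sup>2 + C) * k \<le> \<eta> / 16"
  proof -
    show "k > 0" using \<eta> LC unfolding k_def by (intro divide_pos_pos) auto
    have "(L * C\<^sup>2 + C) * k = \<eta> / 16 * ((L * C\<^sup>2 + C) / (L * C\<^sup>2 + C + 1))" by (simp add: k_def)
    also have "\<dots> \<le> \<eta> / 16 * 1" using LC \<eta> by (intro mult_left_mono) auto
    finally show "(L * C\<^sup>2 + C) * k \<le> \<eta> / 16" by simp
  qed
  have q: "q > 0" "C * q * b \<le> \<eta> / 8"
  proof -
    show "q > 0" using \<eta> C b by (simp add: q_def)
    have "C * q * b = \<eta> / 8 * (C / (C + 1))" unfolding q_def using b C by (simp add: divide_simps)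
    also have "\<dots> \<le> \<eta> / 8 * 1" using C \<eta> by (intro mult_left_mono) auto
    finally show "C * q * b \<le> \<eta> / 8" by simp
  qed
  have W: "W \<ge> 0" using K C d b by (simp add: W_def)
  have l: "l > 0" "l \<le> 1" "l * W \<le> \<eta> / 8"
  proof -
    show "l > 0" "l \<le> 1" using W \<eta> by (auto simp: l_def)
    have "l * W \<le> \<eta> / (8 * (W + 1)) * W" using W by (intro mult_right_mono) (auto simp: l_def)
    also have "\<dots> = \<eta> / 8 * (W / (W + 1))" by simp
    also have "\<dots> \<le> \<eta> / 8 * 1" using W \<eta> by (intro mult_left_mono) auto
    finally show "l * W \<le> \<eta> / 8" by simp
  qed
  have V: "V \<ge> 0" by (rule order_trans[OF _ E_square(2)[of 0]]) simp
  obtain U :: "'v set" where U: "finite U" "\<And>v. v \<in> U \<Longrightarrow> norm v \<le> C"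
      "\<And>u. norm u \<le> C \<Longrightarrow> \<exists>v\<in>U. norm (u - v) \<le> d"
    using finite_net[OF d(1), of C] by blast
  have net: "\<exists>v\<in>U. norm (u - v) \<le> d \<and> norm v \<le> C" if "norm u \<le> C" for u using U(2) U(3)[OF that] by blast
  obtain b0 where b0: "b0 > 0" "\<And>x. \<bar>x\<bar> \<ge> b0 \<Longrightarrow> \<bar>f x\<bar> \<le> q" using f_vanish[OF q(1)] by blast
  \<comment> \<open>Polynomially many nodes against an exponential of -sqrt n: this is where the
    growth of \<sigma>_n enters.\<close>
  have ev_grid: "eventually (\<lambda>n. real (card U) * (2 * (real n)\<^sup>2 + 1) * (2 * exp (- l * (\<eta> / 8) * (c * sqrt (real n)))) \<le> \<theta> / 5) sequentially"
  proof -
    define a0 where "a0 = l * (\<eta> / 8) * c"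
    define m0 where "m0 = real (card U)"
    have "a0 > 0" using l \<eta> c_pos by (simp add: a0_def)
    then have "(\<lambda>n. m0 * (2 * (real n)\<^sup>2 + 1) * (2 * exp (- a0 * sqrt (real n)))) \<longlonglongrightarrow> 0"
      by real_asymp
    then have "eventually (\<lambda>n. m0 * (2 * (real n)\<^sup>2 + 1) * (2 * exp (- a0 * sqrt (real n))) < \<theta> / 5) sequentially"
      by (rule order_tendstoD) (use \<theta> in simp)
    then show ?thesis by eventually_elim (simp add: a0_def m0_def mult.assoc)
  qed
  have ev_tail: "eventually (\<lambda>n. (4 * V + 2 * C * B1) / real n \<le> \<theta> / 5 * (\<eta> / 2)) sequentially"
  proof -
    have "(\<lambda>n. (4 * V + 2 * C * B1) / real n) \<longlonglongrightarrow> 0" by (rule lim_const_over_n)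
    then have "eventually (\<lambda>n. (4 * V + 2 * C * B1) / real n < \<theta> / 5 * (\<eta> / 2)) sequentially"
      by (rule order_tendstoD) (use \<theta> \<eta> in simp)
    then show ?thesis by eventually_elim simp
  qed
  have ev_mesh: "eventually (\<lambda>n. (C * L * b) / real n \<le> \<eta> / 8) sequentially"
  proof -
    have "(\<lambda>n. (C * L * b) / real n) \<longlonglongrightarrow> 0" by (rule lim_const_over_n)
    then have "eventually (\<lambda>n. (C * L * b) / real n < \<eta> / 8) sequentially"
      by (rule order_tendstoD) (use \<eta> in simp)
    then show ?thesis by eventually_elim simp
  qed
  have ev_f: "eventually (\<lambda>n. real n \<ge> b0) sequentially" by real_asymp
  have kt: "k * (\<theta> / 5) > 0" and t5: "\<theta> / 5 > 0" using k \<theta> by auto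
  from eventually_gt_at_top[of 0] s_ge[of 1] s_ge[of "K * 16 / \<eta>"] s_growth ev_grid ev_tail ev_mesh ev_f Z_mean
    Z_square[OF kt] linear_small[OF k(1) t5]
  show ?thesis
  proof eventually_elim
    case (elim n)
    then have n: "n > 0" and s1: "s n \<ge> 1" and Ks: "K \<le> \<eta> / 16 * s n" using \<eta> by (auto simp: field_simps)
    obtain N3 where N3: "N3 \<in> events" "prob N3 \<le> \<theta> / 5"
      "\<And>\<omega> x. \<omega> \<in> space M - N3 \<Longrightarrow> norm (\<Sum>t\<in>{1..int n}. (g (x - Y t \<omega>) - f x) *\<^sub>R Z n t \<omega>) \<le> k * s n"
      using elim(11) by blast
    define S where "S = exceptional n U C d (b * s n) (\<eta> / 2 * s n)"
    define N1 where "N1 = {\<omega>\<in>space M. (\<Sum>t\<in>{1..int n}. norm (Z n t \<omega>)) > b * s n}"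
    define N2 where "N2 = {\<omega>\<in>space M. (\<Sum>t\<in>{1..int n}. (norm (Z n t \<omega>))\<^sup>2) > k * s n}"
    define N4 where "N4 = {\<omega>\<in>space M. (\<Sum>t\<in>{1..int n}. of_bool (\<bar>E t \<omega>\<bar> \<ge> real n / 2) + of_bool (C * norm (Z n t \<omega>) \<ge> real n / 2)) > \<eta> / 2 * s n}"
    have N1: "N1 \<in> events" "prob N1 \<le> \<theta> / 5"
    proof -
      have "B * s n \<le> B1 * s n" using B1 s1 by (intro mult_right_mono) auto
      also have "\<dots> = \<theta> / 5 * (b * s n)" using \<theta> by (simp add: b_def)
      finally have m: "(\<Sum>t\<in>{1..int n}. expectation (\<lambda>\<omega>. norm (Z n t \<omega>))) \<le> \<theta> / 5 * (b * s n)" using elim(9) by linarith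
      show "N1 \<in> events" "prob N1 \<le> \<theta> / 5" unfolding N1_def
        by (rule markov_sum[OF Z_integrable[OF n] norm_ge_zero m]; use b s1 in simp)+
    qed
    have N2: "N2 \<in> events" "prob N2 \<le> \<theta> / 5"
    proof -
      have m: "(\<Sum>t\<in>{1..int n}. expectation (\<lambda>\<omega>. (norm (Z n t \<omega>))\<^sup>2)) \<le> \<theta> / 5 * (k * s n)" using elim(10) by (simp add: mult.commute mult.left_commute)
      show "N2 \<in> events" "prob N2 \<le> \<theta> / 5" unfolding N2_def
        by (rule markov_sum[OF Z_square_integrable[OF n] zero_le_power2 m]; use k s1 in simp)+
    qed
    have N4: "N4 \<in> events" "prob N4 \<le> \<theta> / 5"
    proof -
      have "(4 * V + 2 * C * (\<Sum>t\<in>{1..int n}. expectation (\<lambda>\<omega>. norm (Z n t \<omega>)))) / real n \<le> ((4 * V + 2 * C * B1) * s n) / real n"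
      proof (rule divide_right_mono)
        have "(\<Sum>t\<in>{1..int n}. expectation (\<lambda>\<omega>. norm (Z n t \<omega>))) \<le> B1 * s n"
          using elim(9) mult_right_mono[OF B1(1), of "s n"] s1 by linarith
        then have "2 * C * (\<Sum>t\<in>{1..int n}. expectation (\<lambda>\<omega>. norm (Z n t \<omega>))) \<le> 2 * C * (B1 * s n)"
          using C by (intro mult_left_mono) auto
        moreover have "4 * V * 1 \<le> 4 * V * s n" using V s1 by (intro mult_left_mono) auto
        ultimately show "4 * V + 2 * C * (\<Sum>t\<in>{1..int n}. expectation (\<lambda>\<omega>. norm (Z n t \<omega>))) \<le> (4 * V + 2 * C * B1) * s n"
          by (simp add: distrib_right)
      qed simp
      also have "\<dots> = (4 * V + 2 * C * B1) / real n * s n" by simp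
      also have "\<dots> \<le> \<theta> / 5 * (\<eta> / 2) * s n" using elim(6) s1 by (intro mult_right_mono) auto
      finally have m: "(\<Sum>t\<in>{1..int n}. expectation (\<lambda>\<omega>. of_bool (\<bar>E t \<omega>\<bar> \<ge> real n / 2) + of_bool (C * norm (Z n t \<omega>) \<ge> real n / 2))) \<le> \<theta> / 5 * (\<eta> / 2 * s n)"
        using tail_expectation(1)[OF n C] by (simp only: mult.assoc)
      show "N4 \<in> events" "prob N4 \<le> \<theta> / 5" unfolding N4_def
        by (rule markov_sum[OF tail_expectation(2)[OF n C] _ m]; use \<eta> s1 in simp)+
    qed
    define J where "J = {- int (n\<^sup>2)..int (n\<^sup>2)}"
    define D where "D = (\<lambda>(v, j).
       {\<omega>\<in>space M. deviation n (real_of_int (j + 1) / real n) v d (real_of_int j / real n) 0 0 \<omega> > \<eta> / 4 * s n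
          \<and> variation n (real_of_int (j + 1) / real n) v d (real_of_int j / real n) 0 0 \<omega> \<le> W * s n} \<union>
       {\<omega>\<in>space M. deviation n (real_of_int (j + 1) / real n) 0 0 (real_of_int j / real n) v (- d) \<omega> > \<eta> / 4 * s n
          \<and> variation n (real_of_int (j + 1) / real n) 0 0 (real_of_int j / real n) v (- d) \<omega> \<le> W * s n})"
    define N5 where "N5 = (\<Union>p\<in>U \<times> J. D p)"
    have fin: "finite (U \<times> J)" using U(1) by (simp add: J_def)
    have dev_ev: "{\<omega>\<in>space M. deviation n x1 v1 c1 x2 v2 c2 \<omega> > r \<and> variation n x1 v1 c1 x2 v2 c2 \<omega> \<le> r'} \<in> events"
      for x1 v1 c1 x2 v2 c2 r r'
    proof -
      note [measurable] = deviation_measurable[OF n, of x1 v1 c1 x2 v2 c2] variation_measurable[OF n, of x1 v1 c1 x2 v2 c2]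
      show ?thesis by measurable
    qed
    have Dm: "D p \<in> events" for p unfolding D_def by (cases p, simp only: prod.case, intro sets.Un dev_ev)
    \<comment> \<open>By the choice of l one has l * W \<le> \<eta>/8, so the second order term
      consumes at most half of the gain l * \<eta>/4.\<close>
    have exp_bound: "exp (- l * (\<eta> / 4 * s n) + l\<^sup>2 * (W * s n)) \<le> exp (- l * (\<eta> / 8) * (c * sqrt (real n)))"
    proof -
      have "l * (l * W) * s n \<le> l * (\<eta> / 8) * s n" using l s1 by (intro mult_right_mono mult_left_mono) auto
      moreover have "l * (\<eta> / 8) * (c * sqrt (real n)) \<le> l * (\<eta> / 8) * s n" using l \<eta> elim(4) by (intro mult_left_mono) auto
      moreover have "- l * (\<eta> / 4 * s n) + l\<^sup>2 * (W * s n) = l * (l * W) * s n - 2 * (l * (\<eta> / 8) * s n)"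
        by (simp add: power2_eq_square)
      moreover have "- l * (\<eta> / 8) * (c * sqrt (real n)) = - (l * (\<eta> / 8) * (c * sqrt (real n)))" by simp
      ultimately have "- l * (\<eta> / 4 * s n) + l\<^sup>2 * (W * s n) \<le> - l * (\<eta> / 8) * (c * sqrt (real n))" by linarith
      then show ?thesis by simp
    qed
    have Dp: "prob (D p) \<le> 2 * exp (- l * (\<eta> / 8) * (c * sqrt (real n)))" for p
    proof -
      have tail: "prob {\<omega>\<in>space M. deviation n x1 v1 c1 x2 v2 c2 \<omega> > \<eta> / 4 * s n \<and> variation n x1 v1 c1 x2 v2 c2 \<omega> \<le> W * s n}
         \<le> exp (- l * (\<eta> / 8) * (c * sqrt (real n)))" for x1 v1 c1 x2 v2 c2
        using deviation_tail[OF n, of l] l exp_bound by (meson less_imp_le order_trans)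
      show ?thesis unfolding D_def
        by (cases p, simp only: prod.case, rule order_trans[OF measure_Un_le[OF dev_ev dev_ev]])
           (use add_mono[OF tail tail] in \<open>simp only: mult_2\<close>)
    qed
    have N5: "N5 \<in> events" "prob N5 \<le> \<theta> / 5"
    proof -
      show "N5 \<in> events" unfolding N5_def by (rule sets.finite_UN[OF fin Dm])
      have "prob N5 \<le> (\<Sum>p\<in>U \<times> J. prob (D p))" unfolding N5_def
        by (rule measure_UNION_le[OF fin Dm])
      also have "\<dots> \<le> (\<Sum>p\<in>U \<times> J. 2 * exp (- l * (\<eta> / 8) * (c * sqrt (real n))))" by (rule sum_mono) (rule Dp)
      also have "\<dots> = real (card U * card J) * (2 * exp (- l * (\<eta> / 8) * (c * sqrt (real n))))"
        by (simp only: sum_constant card_cartesian_product)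
      also have "real (card U * card J) = real (card U) * (2 * (real n)\<^sup>2 + 1)"
        by (simp add: J_def nat_add_distrib distrib_left)
      also have "\<dots> * (2 * exp (- l * (\<eta> / 8) * (c * sqrt (real n)))) \<le> \<theta> / 5" by (rule elim(5))
      finally show "prob N5 \<le> \<theta> / 5" .
    qed
    have "{\<omega>\<in>space M. sample n \<omega> \<in> S} \<subseteq> N1 \<union> (N2 \<union> (N3 \<union> (N4 \<union> N5)))"
    proof (rule subsetI, rule ccontr)
      fix \<omega> assume "\<omega> \<in> {\<omega>\<in>space M. sample n \<omega> \<in> S}" and no: "\<omega> \<notin> N1 \<union> (N2 \<union> (N3 \<union> (N4 \<union> N5)))"
      then have \<omega>: "\<omega> \<in> space M" "sample n \<omega> \<in> exceptional n U C d (b * s n) (\<eta> / 2 * s n)" by (auto simp: S_def)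
      have g1: "(\<Sum>t\<in>{1..int n}. norm (Z n t \<omega>)) \<le> b * s n"
        and g2: "(\<Sum>t\<in>{1..int n}. (norm (Z n t \<omega>))\<^sup>2) \<le> k * s n"
        and g3: "\<And>x. norm (\<Sum>t\<in>{1..int n}. (g (x - Y t \<omega>) - f x) *\<^sub>R Z n t \<omega>) \<le> k * s n"
        and g4: "\<not> (\<Sum>t\<in>{1..int n}. of_bool (\<bar>E t \<omega>\<bar> \<ge> real n / 2) + of_bool (C * norm (Z n t \<omega>) \<ge> real n / 2)) > \<eta> / 2 * s n"
        using no \<omega>(1) N3(3)[of \<omega>] by (auto simp: N1_def N2_def N4_def not_less)
      \<comment> \<open>Three errors of \<eta>/16 each; the constant K from the mesh is the first of
        them, since s n is eventually large.\<close>
      have small: "K * (1 + d * (b * s n)) + (L * C\<^sup>2 + C) * (k * s n) \<le> \<eta> / 4 * s n"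
      proof -
        have "K * (1 + d * (b * s n)) + (L * C\<^sup>2 + C) * (k * s n) = K + K * (d * b) * s n + (L * C\<^sup>2 + C) * k * s n"
          by (simp add: distrib_left mult.assoc)
        also have "\<dots> \<le> \<eta> / 16 * s n + \<eta> / 16 * s n + \<eta> / 16 * s n"
          using Ks d(2) k(2) s1 by (intro add_mono mult_right_mono) auto
        also have "\<dots> \<le> \<eta> / 4 * s n" using \<eta> s1 by simp
        finally show ?thesis .
      qed
      have var: "K * (1 + (C + d) * (b * s n)) \<le> W * s n"
      proof -
        have "K * (1 + (C + d) * (b * s n)) \<le> K * (s n + (C + d) * (b * s n))" using s1 K by (intro mult_left_mono) auto
        then show ?thesis by (simp add: W_def algebra_simps)
      qed
      have half: "2 * (\<eta> / 4 * s n) = \<eta> / 2 * s n" by simp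
      from sample_in_exceptional[OF \<omega>(2)] g1 g4 obtain v j where v: "v \<in> U" and j: "j \<in> J"
        and fail: "band_count {1..int n} (\<lambda>t. Z n t \<omega>) (\<lambda>t. E t \<omega>) (real_of_int (j + 1) / real n) v d
         - band_count {1..int n} (\<lambda>t. Z n t \<omega>) (\<lambda>t. E t \<omega>) (real_of_int j / real n) 0 0
         - (v \<bullet> (\<Sum>t\<in>{1..int n}. Z n t \<omega>)) * f (real_of_int j / real n) > 2 * (\<eta> / 4 * s n) \<or>
       band_count {1..int n} (\<lambda>t. Z n t \<omega>) (\<lambda>t. E t \<omega>) (real_of_int (j + 1) / real n) 0 0
         - band_count {1..int n} (\<lambda>t. Z n t \<omega>) (\<lambda>t. E t \<omega>) (real_of_int j / real n) v (- d)
         + (v \<bullet> (\<Sum>t\<in>{1..int n}. Z n t \<omega>)) * f (real_of_int j / real n) > 2 * (\<eta> / 4 * s n)"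
        unfolding J_def half by (meson not_less)
      note gf = grid_failure_imp_deviation[OF n U(2)[OF v] less_imp_le[OF d(1)] g1 g2 g3 small refl refl, of j]
      have "\<omega> \<in> D (v, j)"
        using fail gf order_trans[OF _ var] \<omega>(1) unfolding D_def by blast
      then have "\<omega> \<in> N5" using v j by (auto simp: N5_def)
      then show False using no by simp
    qed
    then have "prob {\<omega>\<in>space M. sample n \<omega> \<in> S} \<le> prob (N1 \<union> (N2 \<union> (N3 \<union> (N4 \<union> N5))))"
      by (rule finite_measure_mono) (use N1 N2 N3 N4 N5 in auto)
    also have "\<dots> \<le> prob N1 + (prob N2 + (prob N3 + (prob N4 + prob N5)))"
      by (intro order_trans[OF measure_Un_le] add_left_mono order_refl)
         (use N1 N2 N3 N4 N5 in auto)
    also have "\<dots> \<le> \<theta>" using N1 N2 N3 N4 N5 by linarith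
    finally have probS: "prob {\<omega>\<in>space M. sample n \<omega> \<in> S} \<le> \<theta>" .
    have "\<bar>(\<Sum>t\<in>{1..int n}. of_bool (\<epsilon> t \<le> x + u \<bullet> z t) - of_bool (\<epsilon> t \<le> x)) - (u \<bullet> (\<Sum>t\<in>{1..int n}. z t)) * f x\<bar> \<le> \<eta> * s n"
      if p: "(z, \<epsilon>) \<in> space (samples n) - S" and u: "norm u \<le> C" for z \<epsilon> u x
    proof -
      have fq: "\<bar>f x\<bar> \<le> q" if "\<bar>x\<bar> \<ge> real n" for x using b0(2)[of x] that elim(8) by linarith
      have "\<bar>(\<Sum>t\<in>{1..int n}. of_bool (\<epsilon> t \<le> x + u \<bullet> z t) - of_bool (\<epsilon> t \<le> x)) - (u \<bullet> (\<Sum>t\<in>{1..int n}. z t)) * f x\<bar>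
        \<le> \<eta> / 2 * s n + (d * K + C * L / real n + C * q) * (b * s n)"
        by (rule not_exceptional[OF n _ _ net C _ fq u]) (use p d in \<open>auto simp: S_def\<close>)
      also have "(d * K + C * L / real n + C * q) * (b * s n) = (K * (d * b) + (C * L * b) / real n + C * q * b) * s n"
        by (simp add: algebra_simps)
      \<comment> \<open>Net radius, mesh and values beyond the grid; together with \<eta>/2 from the
        nodes they amount to 13/16 of \<eta>.\<close>
      also have "\<dots> \<le> (\<eta> / 16 + \<eta> / 8 + \<eta> / 8) * s n"
        using d(2) elim(7) q(2) s1 by (intro mult_right_mono add_mono) auto
      also have "\<eta> / 2 * s n + (\<eta> / 16 + \<eta> / 8 + \<eta> / 8) * s n \<le> \<eta> * s n" using \<eta> s1 by (simp add: field_simps)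
      finally show ?thesis by simp
    qed
    then show ?case using probS exceptional_measurable[OF U(1), of n C d "b * s n" "\<eta> / 2 * s n"]
      unfolding S_def[symmetric] by blast
  qed
qed

end

section \<open>Truncation of the linear process\<close>

context smooth_linear_process begin

text \<open>Truncation by zeros keeps the result a linear process, so that the facts about
  \<open>eps\<close> continue to apply; the shift by one is that of \<xi>.\<close>

definition trunc :: "nat \<Rightarrow> nat \<Rightarrow> real" where "trunc m i = (if i < m then a (Suc i) else 0)"

definition \<xi>_trunc :: "nat \<Rightarrow> int \<Rightarrow> 'a \<Rightarrow> real" where "\<xi>_trunc m t = eps (trunc m) e t"

text \<open>The mean square distance between \<xi>_t and its truncation, by stationarity the same
  for all t.\<close>

definition remainder :: "nat \<Rightarrow> real" where "remainder m = sqrt (s2 * (\<Sum>i. (a (Suc (i + m)))\<^sup>2))"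

lemma trunc_square: "summable (\<lambda>i. (trunc m i)\<^sup>2)"
  by (rule summable_comparison_test'[OF a_tail_square]) (auto simp: trunc_def)

lemma rest_square: "summable (\<lambda>i. (a (Suc i) - trunc m i)\<^sup>2)"
  by (rule summable_comparison_test'[OF a_tail_square]) (auto simp: trunc_def)

lemma remainder_tendsto: "remainder \<longlonglongrightarrow> 0"
proof -
  have "(\<lambda>m. sqrt (s2 * (\<Sum>i. (a (Suc (i + m)))\<^sup>2))) \<longlonglongrightarrow> sqrt (s2 * 0)"
    by (intro tendsto_intros suminf_exist_split2[OF a_tail_square])
  then show ?thesis unfolding remainder_def[abs_def] by simp
qed

lemma xi_trunc_measurable [measurable]: "\<xi>_trunc m t \<in> borel_measurable M"
  unfolding \<xi>_trunc_def by simp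

lemma xi_trunc_finite: "\<xi>_trunc m t \<omega> = (\<Sum>i<m. a (Suc i) * e (t - int i) \<omega>)"
  unfolding \<xi>_trunc_def eps_def by (subst suminf_finite[of "{..<m}"]) (auto simp: trunc_def)

lemma xi_trunc_local: "\<xi>_trunc m t \<in> borel_measurable (sigma_of M e {t - int m<..t})"
  unfolding xi_trunc_finite[abs_def]
  by (intro borel_measurable_sum borel_measurable_times borel_measurable_const measurable_sigma_of) auto

lemma truncation_error:
  "integrable M (\<lambda>\<omega>. \<bar>\<xi> t \<omega> - \<xi>_trunc m t \<omega>\<bar>)"
  "expectation (\<lambda>\<omega>. \<bar>\<xi> t \<omega> - \<xi>_trunc m t \<omega>\<bar>) \<le> remainder m"
proof -
  define h where "h i = a (Suc i) - trunc m i" for i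
  have hs: "summable (\<lambda>i. (h i)\<^sup>2)" unfolding h_def by (rule rest_square)
  have eq: "AE \<omega> in M. (\<xi> t \<omega> - \<xi>_trunc m t \<omega>)\<^sup>2 = (eps h e t \<omega>)\<^sup>2"
    using eps_summable_AE[OF a_tail_square, of t] eps_summable_AE[OF trunc_square, of m t]
  proof eventually_elim
    case (elim \<omega>)
    then show ?case unfolding xi_eq_eps \<xi>_trunc_def eps_def h_def by (simp add: suminf_diff left_diff_distrib)
  qed
  have int2: "integrable M (\<lambda>\<omega>. (\<xi> t \<omega> - \<xi>_trunc m t \<omega>)\<^sup>2)"
    by (rule integrable_cong_AE[THEN iffD2, OF _ _ eq]) (auto intro: eps_square_integrable[OF hs])
  show "integrable M (\<lambda>\<omega>. \<bar>\<xi> t \<omega> - \<xi>_trunc m t \<omega>\<bar>)"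
    by (rule square_integrable_imp_integrable) (use int2 in auto)
  have "(\<Sum>i. (h i)\<^sup>2) = (\<Sum>i. (h (i + m))\<^sup>2) + (\<Sum>i<m. (h i)\<^sup>2)"
    by (rule suminf_split_initial_segment[OF hs])
  also have "\<dots> = (\<Sum>i. (a (Suc (i + m)))\<^sup>2)" by (simp add: h_def trunc_def)
  finally have hsum: "(\<Sum>i. (h i)\<^sup>2) = (\<Sum>i. (a (Suc (i + m)))\<^sup>2)" .
  have "(expectation (\<lambda>\<omega>. \<bar>\<xi> t \<omega> - \<xi>_trunc m t \<omega>\<bar>))\<^sup>2 \<le> expectation (\<lambda>\<omega>. \<bar>\<xi> t \<omega> - \<xi>_trunc m t \<omega>\<bar>\<^sup>2)"
    by (rule expectation_square_le) (use int2 in auto)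
  also have "\<dots> = expectation (\<lambda>\<omega>. (eps h e t \<omega>)\<^sup>2)"
    by (rule integral_cong_AE) (use eq in auto)
  also have "\<dots> = s2 * (\<Sum>i. (a (Suc (i + m)))\<^sup>2)" unfolding eps_second_moment[OF hs] hsum ..
  finally show "expectation (\<lambda>\<omega>. \<bar>\<xi> t \<omega> - \<xi>_trunc m t \<omega>\<bar>) \<le> remainder m"
    unfolding remainder_def by (rule real_le_rsqrt)
qed

definition f_trunc :: "nat \<Rightarrow> real \<Rightarrow> real" where
  "f_trunc m x = expectation (\<lambda>\<omega>. g (x - \<xi>_trunc m 0 \<omega>))"

definition A_trunc :: "nat \<Rightarrow> real \<Rightarrow> int \<Rightarrow> 'a \<Rightarrow> real" where
  "A_trunc m x t \<omega> = g (x - \<xi>_trunc m (t - 1) \<omega>) - f_trunc m x"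

lemma f_trunc_eq: "expectation (\<lambda>\<omega>. g (x - \<xi>_trunc m t \<omega>)) = f_trunc m x"
  unfolding f_trunc_def \<xi>_trunc_def by (rule eps_transfer) measurable

lemma integrable_g_trunc: "integrable M (\<lambda>\<omega>. g (x - \<xi>_trunc m t \<omega>))"
  by (rule integrable_bounded[of _ K]) (auto simp: g_bound)

lemma f_trunc_bound: "\<bar>f_trunc m x\<bar> \<le> K"
proof -
  have "\<bar>f_trunc m x\<bar> \<le> expectation (\<lambda>\<omega>. \<bar>g (x - \<xi>_trunc m 0 \<omega>)\<bar>)" unfolding f_trunc_def by (rule integral_abs_bound)
  also have "\<dots> \<le> K" by (rule integral_le_const) (use integrable_g_trunc g_bound in \<open>auto intro!: AE_I2\<close>)
  finally show ?thesis .
qed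

lemma f_trunc_close: "\<bar>f x - f_trunc m x\<bar> \<le> L * remainder m"
proof -
  have "f x - f_trunc m x = expectation (\<lambda>\<omega>. g (x - \<xi> 0 \<omega>) - g (x - \<xi>_trunc m 0 \<omega>))"
    unfolding f_def f_trunc_def
    by (rule Bochner_Integration.integral_diff[symmetric]) (rule integrable_g_xi integrable_g_trunc)+
  then have "\<bar>f x - f_trunc m x\<bar> \<le> expectation (\<lambda>\<omega>. \<bar>g (x - \<xi> 0 \<omega>) - g (x - \<xi>_trunc m 0 \<omega>)\<bar>)"
    by (simp only: integral_abs_bound)
  also have "\<dots> \<le> expectation (\<lambda>\<omega>. L * \<bar>\<xi> 0 \<omega> - \<xi>_trunc m 0 \<omega>\<bar>)"
  proof (rule integral_mono)
    show "integrable M (\<lambda>\<omega>. \<bar>g (x - \<xi> 0 \<omega>) - g (x - \<xi>_trunc m 0 \<omega>)\<bar>)"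
      by (intro integrable_abs Bochner_Integration.integrable_diff integrable_g_xi integrable_g_trunc)
    show "integrable M (\<lambda>\<omega>. L * \<bar>\<xi> 0 \<omega> - \<xi>_trunc m 0 \<omega>\<bar>)"
      using truncation_error(1) by simp
    show "\<bar>g (x - \<xi> 0 \<omega>) - g (x - \<xi>_trunc m 0 \<omega>)\<bar> \<le> L * \<bar>\<xi> 0 \<omega> - \<xi>_trunc m 0 \<omega>\<bar>" for \<omega>
      using g_lipschitz[of "x - \<xi> 0 \<omega>" "x - \<xi>_trunc m 0 \<omega>"] by (simp add: abs_minus_commute)
  qed
  also have "\<dots> = L * expectation (\<lambda>\<omega>. \<bar>\<xi> 0 \<omega> - \<xi>_trunc m 0 \<omega>\<bar>)" by simp
  also have "\<dots> \<le> L * remainder m" by (intro mult_left_mono truncation_error L_nonneg)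
  finally show ?thesis .
qed

lemma A_trunc_measurable [measurable]: "A_trunc m x t \<in> borel_measurable M"
  unfolding A_trunc_def by measurable

lemma A_trunc_bound: "\<bar>A_trunc m x t \<omega>\<bar> \<le> 2 * K"
  using g_bound[of "x - \<xi>_trunc m (t - 1) \<omega>"] f_trunc_bound[of m x] unfolding A_trunc_def by linarith

lemma A_trunc_integrable: "integrable M (A_trunc m x t)"
  by (rule integrable_bounded[of _ "2 * K"]) (auto simp: A_trunc_bound)

lemma A_trunc_mean: "expectation (A_trunc m x t) = 0"
  unfolding A_trunc_def using integrable_g_trunc by (simp add: f_trunc_eq prob_space)

lemma A_trunc_product_integrable: "integrable M (\<lambda>\<omega>. A_trunc m x s \<omega> * A_trunc m x t \<omega>)"
  and A_trunc_product_bound: "\<bar>expectation (\<lambda>\<omega>. A_trunc m x s \<omega> * A_trunc m x t \<omega>)\<bar> \<le> 4 * K\<^sup>2"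
proof -
  have b: "\<bar>A_trunc m x s \<omega> * A_trunc m x t \<omega>\<bar> \<le> 4 * K\<^sup>2" for \<omega>
  proof -
    have "\<bar>A_trunc m x s \<omega> * A_trunc m x t \<omega>\<bar> \<le> (2 * K) * (2 * K)"
      unfolding abs_mult using K_nonneg by (intro mult_mono A_trunc_bound) auto
    then show ?thesis by (simp add: power2_eq_square)
  qed
  show i: "integrable M (\<lambda>\<omega>. A_trunc m x s \<omega> * A_trunc m x t \<omega>)"
    by (rule integrable_bounded[of _ "4 * K\<^sup>2"]) (use b in auto)
  have "\<bar>expectation (\<lambda>\<omega>. A_trunc m x s \<omega> * A_trunc m x t \<omega>)\<bar> \<le> expectation (\<lambda>\<omega>. \<bar>A_trunc m x s \<omega> * A_trunc m x t \<omega>\<bar>)"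
    by (rule integral_abs_bound)
  also have "\<dots> \<le> 4 * K\<^sup>2" by (rule integral_le_const[OF integrable_abs[OF i]]) (use b in \<open>auto intro!: AE_I2\<close>)
  finally show "\<bar>expectation (\<lambda>\<omega>. A_trunc m x s \<omega> * A_trunc m x t \<omega>)\<bar> \<le> 4 * K\<^sup>2" .
qed

text \<open>The term at time t depends only on the m innovations before t, and these ranges are
  disjoint for s and t at distance at least m.\<close>

lemma A_trunc_uncorrelated:
  assumes "\<bar>s - t\<bar> \<ge> int m"
  shows "expectation (\<lambda>\<omega>. A_trunc m x s \<omega> * A_trunc m x t \<omega>) = 0"
proof -
  have loc: "A_trunc m x t \<in> borel_measurable (sigma_of M e {t - 1 - int m<..t - 1})" for t
  proof -
    note [measurable] = xi_trunc_local[of m "t - 1"]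
    show ?thesis unfolding A_trunc_def[abs_def] by measurable
  qed
  have "indep_var borel (A_trunc m x s) borel (A_trunc m x t)"
    by (rule indep_var_disjoint[OF e_indep _ loc loc]) (use assms in auto)
  from indep_var_lebesgue_integral[OF this A_trunc_integrable A_trunc_integrable]
  show ?thesis by (simp add: A_trunc_mean)
qed

text \<open>Only pairs at distance below m are correlated. Their product is bounded by 2ab \<le> a^2
  + b^2, and each index has at most 2m such neighbours, so the double sum collapses to m times the
  sum of the squared weights.\<close>

lemma A_trunc_second_moment:
  fixes z :: "int \<Rightarrow> 'v::euclidean_space"
  assumes I: "finite I"
  shows "(\<integral>\<^sup>+\<omega>. ennreal ((norm (\<Sum>t\<in>I. A_trunc m x t \<omega> *\<^sub>R z t))\<^sup>2) \<partial>M)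
    \<le> ennreal (8 * K\<^sup>2 * real m * (\<Sum>t\<in>I. (norm (z t))\<^sup>2))"
proof -
  define N where "N s t = (of_bool (\<bar>s - t\<bar> < int m) :: real)" for s t
  have e: "(norm (\<Sum>t\<in>I. A_trunc m x t \<omega> *\<^sub>R z t))\<^sup>2
      = (\<Sum>s\<in>I. \<Sum>t\<in>I. (z s \<bullet> z t) * (A_trunc m x s \<omega> * A_trunc m x t \<omega>))" for \<omega>
    unfolding power2_norm_eq_inner inner_sum_left inner_sum_right sum_distrib_left
    by (rule trans[OF sum.swap]) (simp add: mult.commute mult.left_commute)
  have int: "integrable M (\<lambda>\<omega>. (norm (\<Sum>t\<in>I. A_trunc m x t \<omega> *\<^sub>R z t))\<^sup>2)"
    unfolding e by (intro Bochner_Integration.integrable_sum integrable_mult_right A_trunc_product_integrable)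
  have "expectation (\<lambda>\<omega>. (norm (\<Sum>t\<in>I. A_trunc m x t \<omega> *\<^sub>R z t))\<^sup>2)
     = (\<Sum>s\<in>I. \<Sum>t\<in>I. (z s \<bullet> z t) * expectation (\<lambda>\<omega>. A_trunc m x s \<omega> * A_trunc m x t \<omega>))"
    unfolding e by (simp add: Bochner_Integration.integral_sum Bochner_Integration.integrable_sum integrable_mult_right A_trunc_product_integrable)
  also have "\<dots> \<le> (\<Sum>s\<in>I. \<Sum>t\<in>I. 2 * K\<^sup>2 * (N s t * (norm (z s))\<^sup>2 + N t s * (norm (z t))\<^sup>2))"
  proof (intro sum_mono)
    fix s t
    show "(z s \<bullet> z t) * expectation (\<lambda>\<omega>. A_trunc m x s \<omega> * A_trunc m x t \<omega>)
       \<le> 2 * K\<^sup>2 * (N s t * (norm (z s))\<^sup>2 + N t s * (norm (z t))\<^sup>2)"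
    proof (cases "\<bar>s - t\<bar> < int m")
      case True
      have "(z s \<bullet> z t) * expectation (\<lambda>\<omega>. A_trunc m x s \<omega> * A_trunc m x t \<omega>)
         \<le> \<bar>z s \<bullet> z t\<bar> * \<bar>expectation (\<lambda>\<omega>. A_trunc m x s \<omega> * A_trunc m x t \<omega>)\<bar>"
        unfolding abs_mult[symmetric] by (rule abs_ge_self)
      also have "\<dots> \<le> (norm (z s) * norm (z t)) * (4 * K\<^sup>2)"
        by (intro mult_mono Cauchy_Schwarz_ineq2 A_trunc_product_bound) auto
      also have "\<dots> = 2 * K\<^sup>2 * (2 * norm (z s) * norm (z t))" by simp
      also have "\<dots> \<le> 2 * K\<^sup>2 * ((norm (z s))\<^sup>2 + (norm (z t))\<^sup>2)"
        by (intro mult_left_mono sum_squares_bound) simp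
      finally show ?thesis using True by (simp add: N_def abs_minus_commute)
    next
      case False
      then show ?thesis by (simp add: A_trunc_uncorrelated N_def)
    qed
  qed
  also have "\<dots> = 2 * K\<^sup>2 * ((\<Sum>s\<in>I. \<Sum>t\<in>I. N s t * (norm (z s))\<^sup>2) + (\<Sum>s\<in>I. \<Sum>t\<in>I. N t s * (norm (z t))\<^sup>2))"
    by (simp add: sum_distrib_left[symmetric] sum.distrib)
  also have "(\<Sum>s\<in>I. \<Sum>t\<in>I. N t s * (norm (z t))\<^sup>2) = (\<Sum>s\<in>I. \<Sum>t\<in>I. N s t * (norm (z s))\<^sup>2)"
    by (rule sum.swap)
  also have "2 * K\<^sup>2 * ((\<Sum>s\<in>I. \<Sum>t\<in>I. N s t * (norm (z s))\<^sup>2) + (\<Sum>s\<in>I. \<Sum>t\<in>I. N s t * (norm (z s))\<^sup>2))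
     = 4 * K\<^sup>2 * (\<Sum>s\<in>I. (\<Sum>t\<in>I. N s t) * (norm (z s))\<^sup>2)" by (simp add: sum_distrib_right)
  also have "\<dots> \<le> 4 * K\<^sup>2 * (\<Sum>s\<in>I. (2 * real m) * (norm (z s))\<^sup>2)"
  proof (intro mult_left_mono sum_mono mult_right_mono)
    fix s
    have "(\<Sum>t\<in>I. N s t) = real (card (I \<inter> {t. \<bar>s - t\<bar> < int m}))"
      using I by (simp add: N_def sum_of_bool_eq)
    also have "card (I \<inter> {t. \<bar>s - t\<bar> < int m}) \<le> card {s - int m<..<s + int m}"
      by (rule card_mono) auto
    also have "\<dots> \<le> 2 * m" by simp
    finally show "(\<Sum>t\<in>I. N s t) \<le> 2 * real m" by simp
  qed auto
  also have "\<dots> = 8 * K\<^sup>2 * real m * (\<Sum>s\<in>I. (norm (z s))\<^sup>2)" by (simp add: sum_distrib_left[symmetric])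
  finally have "expectation (\<lambda>\<omega>. (norm (\<Sum>t\<in>I. A_trunc m x t \<omega> *\<^sub>R z t))\<^sup>2) \<le> 8 * K\<^sup>2 * real m * (\<Sum>t\<in>I. (norm (z t))\<^sup>2)" .
  then show ?thesis using int by (subst nn_integral_eq_integral) (auto intro: ennreal_leI)
qed

end

text \<open>Markov's inequality with the inner moment computed for a frozen first coordinate, as
  needed for sums with random weights on one factor and errors on the other.\<close>

lemma (in prob_space) pair_markov:
  fixes h :: "'a \<times> 'a \<Rightarrow> real" and b :: "'a \<Rightarrow> real"
  assumes [measurable]: "h \<in> borel_measurable (M \<Otimes>\<^sub>M M)"
    and h: "\<And>\<omega>. \<omega> \<in> space M \<Longrightarrow> (\<integral>\<^sup>+\<omega>'. ennreal (h (\<omega>, \<omega>')) \<partial>M) \<le> ennreal (b \<omega>)"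
    and b: "integrable M b" "\<And>\<omega>. b \<omega> \<ge> 0" and r: "expectation b \<le> r * c" and c: "c > 0"
  shows "measure (M \<Otimes>\<^sub>M M) {p \<in> space (M \<Otimes>\<^sub>M M). h p > c} \<le> r"
proof -
  interpret P: pair_prob_space M M ..
  let ?A = "{p \<in> space (M \<Otimes>\<^sub>M M). h p > c}"
  have [measurable]: "?A \<in> sets (M \<Otimes>\<^sub>M M)" by measurable
  have "ennreal c * emeasure (M \<Otimes>\<^sub>M M) ?A = (\<integral>\<^sup>+p. ennreal c * indicator ?A p \<partial>(M \<Otimes>\<^sub>M M))"
    by (simp add: nn_integral_cmult)
  also have "\<dots> \<le> (\<integral>\<^sup>+p. ennreal (h p) \<partial>(M \<Otimes>\<^sub>M M))"
    by (rule nn_integral_mono) (auto simp: indicator_def intro!: ennreal_leI)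
  also have "\<dots> = (\<integral>\<^sup>+\<omega>. (\<integral>\<^sup>+\<omega>'. ennreal (h (\<omega>, \<omega>')) \<partial>M) \<partial>M)"
    by (rule nn_integral_fst[symmetric]) measurable
  also have "\<dots> \<le> (\<integral>\<^sup>+\<omega>. ennreal (b \<omega>) \<partial>M)" by (rule nn_integral_mono) (rule h)
  also have "\<dots> = ennreal (expectation b)" by (rule nn_integral_eq_integral) (use b in auto)
  also have "\<dots> \<le> ennreal (r * c)" using r by (rule ennreal_leI)
  finally have "ennreal (c * measure (M \<Otimes>\<^sub>M M) ?A) \<le> ennreal (r * c)"
    using c by (simp add: P.emeasure_eq_measure ennreal_mult')
  moreover have "r * c \<ge> 0" using r b(2) by (intro order_trans[OF Bochner_Integration.integral_nonneg r]) auto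
  ultimately have "c * measure (M \<Otimes>\<^sub>M M) ?A \<le> r * c" by (simp add: ennreal_le_iff)
  then show ?thesis using c by (simp add: mult.commute)
qed

section \<open>Regressors independent of the errors\<close>

lemma (in prob_space) weighted_pair_markov:
  fixes Z :: "int \<Rightarrow> 'a \<Rightarrow> 'v::euclidean_space" and Q :: "int \<Rightarrow> 'a \<Rightarrow> real"
  assumes I: "finite I" and Z: "\<And>t. t \<in> I \<Longrightarrow> Z t \<in> borel_measurable M" "\<And>t. t \<in> I \<Longrightarrow> integrable M (\<lambda>\<omega>. norm (Z t \<omega>))"
    and Q: "\<And>t. integrable M (Q t)" "\<And>t \<omega>. Q t \<omega> \<ge> 0" "\<And>t. expectation (Q t) \<le> q"
    and r: "q * (\<Sum>t\<in>I. expectation (\<lambda>\<omega>. norm (Z t \<omega>))) \<le> r * c" and c: "c > 0"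
  shows "{p \<in> space (M \<Otimes>\<^sub>M M). (\<Sum>t\<in>I. norm (Z t (fst p)) * Q t (snd p)) > c} \<in> sets (M \<Otimes>\<^sub>M M)"
    and "measure (M \<Otimes>\<^sub>M M) {p \<in> space (M \<Otimes>\<^sub>M M). (\<Sum>t\<in>I. norm (Z t (fst p)) * Q t (snd p)) > c} \<le> r"
proof -
  have q: "q \<ge> 0" by (rule order_trans[OF _ Q(3)[of 0]]) (use Q in simp)
  have "(\<lambda>p. norm (Z t (fst p)) * Q t (snd p)) \<in> borel_measurable (M \<Otimes>\<^sub>M M)" if "t \<in> I" for t
  proof -
    note [measurable] = Z(1)[OF that] borel_measurable_integrable[OF Q(1)]
    show ?thesis by measurable
  qed
  then have m [measurable]: "(\<lambda>p. \<Sum>t\<in>I. norm (Z t (fst p)) * Q t (snd p)) \<in> borel_measurable (M \<Otimes>\<^sub>M M)"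
    by (rule borel_measurable_sum)
  show "{p \<in> space (M \<Otimes>\<^sub>M M). (\<Sum>t\<in>I. norm (Z t (fst p)) * Q t (snd p)) > c} \<in> sets (M \<Otimes>\<^sub>M M)"
    by measurable
  show "measure (M \<Otimes>\<^sub>M M) {p \<in> space (M \<Otimes>\<^sub>M M). (\<Sum>t\<in>I. norm (Z t (fst p)) * Q t (snd p)) > c} \<le> r"
  proof (rule pair_markov[OF m, of "\<lambda>\<omega>. q * (\<Sum>t\<in>I. norm (Z t \<omega>))"])
    fix \<omega>
    have i: "integrable M (\<lambda>\<omega>'. \<Sum>t\<in>I. norm (Z t \<omega>) * Q t \<omega>')" using Q(1) by auto
    have "(\<integral>\<^sup>+\<omega>'. ennreal (\<Sum>t\<in>I. norm (Z t (fst (\<omega>, \<omega>'))) * Q t (snd (\<omega>, \<omega>'))) \<partial>M)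
       = ennreal (expectation (\<lambda>\<omega>'. \<Sum>t\<in>I. norm (Z t \<omega>) * Q t \<omega>'))"
      unfolding fst_conv snd_conv by (rule nn_integral_eq_integral[OF i]) (use Q(2) in \<open>auto intro!: AE_I2 sum_nonneg\<close>)
    also have "expectation (\<lambda>\<omega>'. \<Sum>t\<in>I. norm (Z t \<omega>) * Q t \<omega>') = (\<Sum>t\<in>I. norm (Z t \<omega>) * expectation (Q t))"
      using Q(1) by (simp add: Bochner_Integration.integral_sum)
    also have "\<dots> \<le> (\<Sum>t\<in>I. norm (Z t \<omega>) * q)" by (intro sum_mono mult_left_mono Q(3)) simp
    also have "\<dots> = q * (\<Sum>t\<in>I. norm (Z t \<omega>))" by (simp add: sum_distrib_left mult.commute)
    finally show "(\<integral>\<^sup>+\<omega>'. ennreal (\<Sum>t\<in>I. norm (Z t (fst (\<omega>, \<omega>'))) * Q t (snd (\<omega>, \<omega>'))) \<partial>M)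
      \<le> ennreal (q * (\<Sum>t\<in>I. norm (Z t \<omega>)))" by (simp add: ennreal_leI)
  next
    show "integrable M (\<lambda>\<omega>. q * (\<Sum>t\<in>I. norm (Z t \<omega>)))" using Z(2) by auto
    show "q * (\<Sum>t\<in>I. norm (Z t \<omega>)) \<ge> 0" for \<omega> using q by (intro mult_nonneg_nonneg sum_nonneg) auto
    show "expectation (\<lambda>\<omega>. q * (\<Sum>t\<in>I. norm (Z t \<omega>))) \<le> r * c"
      using r Z(2) by (simp add: Bochner_Integration.integral_sum)
  qed (rule c)
qed

section \<open>The linear term on the product space\<close>

context smooth_linear_process begin

lemma xi_tail_vanishes:
  assumes "p > 0"
  shows "eventually (\<lambda>b. \<forall>t. prob {\<omega>\<in>space M. \<bar>\<xi> t \<omega>\<bar> \<ge> b} \<le> p) at_top"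
proof -
  define v where "v = s2 * (\<Sum>i. (a (Suc i))\<^sup>2)"
  have "((\<lambda>b. v / b\<^sup>2) \<longlongrightarrow> 0) at_top" by real_asymp
  then have "eventually (\<lambda>b. v / b\<^sup>2 < p) at_top" by (rule order_tendstoD) (rule assms)
  then show ?thesis using eventually_gt_at_top[of 0]
  proof eventually_elim
    case (elim b)
    show ?case
    proof
      fix t
      have "prob {\<omega>\<in>space M. \<bar>\<xi> t \<omega>\<bar> \<ge> b} \<le> expectation (\<lambda>\<omega>. (\<xi> t \<omega>)\<^sup>2) / b\<^sup>2"
        by (rule second_moment_method) (use elim eps_square_integrable[OF a_tail_square] in \<open>auto simp: xi_eq_eps\<close>)
      also have "expectation (\<lambda>\<omega>. (\<xi> t \<omega>)\<^sup>2) = v" unfolding xi_eq_eps v_def by (rule eps_second_moment[OF a_tail_square])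
      finally show "prob {\<omega>\<in>space M. \<bar>\<xi> t \<omega>\<bar> \<ge> b} \<le> p" using elim by linarith
    qed
  qed
qed

text \<open>Moving x to y costs L * h for g and again for f; replacing f by its truncated version
  costs the remainder term, and replacing \<xi> the last one.\<close>

lemma A_trunc_approx:
  assumes "\<bar>x - y\<bar> \<le> h"
  shows "\<bar>(g (x - \<xi> (t - 1) \<omega>) - f x) - A_trunc m y t \<omega>\<bar>
    \<le> (2 * L * h + L * remainder m) + L * \<bar>\<xi> (t - 1) \<omega> - \<xi>_trunc m (t - 1) \<omega>\<bar>"
proof -
  have "L * \<bar>x - y\<bar> \<le> L * h" using assms L_nonneg by (rule mult_left_mono)
  moreover have "\<bar>g (x - \<xi> (t - 1) \<omega>) - g (y - \<xi> (t - 1) \<omega>)\<bar> \<le> L * \<bar>x - y\<bar>"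
    using g_lipschitz[of "x - \<xi> (t - 1) \<omega>" "y - \<xi> (t - 1) \<omega>"] by simp
  moreover have "\<bar>g (y - \<xi> (t - 1) \<omega>) - g (y - \<xi>_trunc m (t - 1) \<omega>)\<bar> \<le> L * \<bar>\<xi> (t - 1) \<omega> - \<xi>_trunc m (t - 1) \<omega>\<bar>"
    using g_lipschitz[of "y - \<xi> (t - 1) \<omega>" "y - \<xi>_trunc m (t - 1) \<omega>"] by (simp add: abs_minus_commute)
  ultimately show ?thesis using f_lipschitz[of x y] f_trunc_close[of y m] unfolding A_trunc_def by linarith
qed

text \<open>When the regressors are independent of the errors, hypothesis (3)(d) is automatic: the sequence
  \<open>A\<^sub>t(x)\<close> is approximated by an \<open>m\<close>-dependent one, whose weighted sums have second moment at most
  \<open>O(m)\<close> times the sum of the squared weights. The product measure realises this independence.\<close>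

lemma linear_small_pair:
  fixes Z :: "nat \<Rightarrow> int \<Rightarrow> 'a \<Rightarrow> 'v::euclidean_space"
  assumes D: "displacement_array M Z s B c"
    and r: "r > 0" and \<theta>: "\<theta> > 0"
  shows "eventually (\<lambda>n. \<exists>N\<in>sets (M \<Otimes>\<^sub>M M). measure (M \<Otimes>\<^sub>M M) N \<le> \<theta> \<and>
      (\<forall>p\<in>space (M \<Otimes>\<^sub>M M) - N. \<forall>x. norm (\<Sum>t\<in>{1..int n}. (g (x - \<xi> (t - 1) (snd p)) - f x) *\<^sub>R Z n t (fst p)) \<le> r * s n)) sequentially"
proof -
  interpret D: displacement_array M Z s B c by (rule D)
  note Z = D.Z_measurable D.Z_integrable D.Z_square_integrable
  \<comment> \<open>For |x| \<le> 2l the budget r is spent in four quarters: the node y (through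
    \<open>D y\<close>), the mesh h, the truncated mean (p1), and the truncation of \<xi>
    (\<kappa>1). For |x| > 2l it is halved between small values of g and f (q) and times with
    |\<xi>| \<ge> l (\<kappa>3, p0). The bound b is again Markov's.\<close>
  define B1 where "B1 = max B 1"
  define b where "b = 5 * B1 / \<theta>"
  define q where "q = r / (4 * b)"
  define \<kappa>3 where "\<kappa>3 = r / (2 * (K + 1))"
  define \<kappa>1 where "\<kappa>1 = r / (4 * (L + 1))"
  define p0 where "p0 = \<theta> * \<kappa>3 / (5 * B1)"
  define p1 where "p1 = min (\<theta> * \<kappa>1 / (5 * B1)) (r / (4 * (L + 1) * b))"
  define h where "h = r / (8 * (L + 1) * b)"
  have B1: "B1 \<ge> B" "B1 > 0" by (auto simp: B1_def)
  have b: "b > 0" using B1 \<theta> by (simp add: b_def)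
  have pos: "q > 0" "\<kappa>3 > 0" "\<kappa>1 > 0" "p0 > 0" "p1 > 0" "h > 0"
    using b r \<theta> B1 K_nonneg L_nonneg by (auto simp: q_def \<kappa>3_def \<kappa>1_def p0_def p1_def h_def)
  have frac: "c * (r / (k * (c + 1))) \<le> r / k" if "c \<ge> 0" "k > 0" for c k :: real
  proof -
    have "c * (r / (k * (c + 1))) = r / k * (c / (c + 1))" using that by (simp add: field_simps)
    also have "\<dots> \<le> r / k * 1" using that r by (intro mult_left_mono) auto
    finally show ?thesis by simp
  qed
  have qb: "2 * q * b = r / 2" using b by (simp add: q_def)
  have K3: "K * \<kappa>3 \<le> r / 2" unfolding \<kappa>3_def using frac[OF K_nonneg, of 2] by simp
  have L1: "L * \<kappa>1 \<le> r / 4" unfolding \<kappa>1_def using frac[OF L_nonneg, of 4] by simp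
  have Lh: "2 * L * h * b \<le> r / 4"
  proof -
    have "2 * L * h * b = 2 * (L * (r / (8 * (L + 1))))" unfolding h_def using b by simp
    then show ?thesis using frac[OF L_nonneg, of 8] by linarith
  qed
  obtain bg where bg: "bg > 0" "\<And>x. \<bar>x\<bar> \<ge> bg \<Longrightarrow> \<bar>g x\<bar> \<le> q" using g_vanishes[OF pos(1)] by blast
  obtain bf where bf: "bf > 0" "\<And>x. \<bar>x\<bar> \<ge> bf \<Longrightarrow> \<bar>f x\<bar> \<le> q" using f_vanishes[OF pos(1)] by blast
  \<comment> \<open>If |x| > 2l and |\<xi>| < l, then |x - \<xi>| > l as well, so both g and f are
    at most q; hence l is taken above both thresholds.\<close>
  have "eventually (\<lambda>l. (\<forall>t. prob {\<omega>\<in>space M. \<bar>\<xi> t \<omega>\<bar> \<ge> l} \<le> p0) \<and> l \<ge> max bg bf) at_top"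
    by (intro eventually_conj xi_tail_vanishes pos eventually_ge_at_top)
  then obtain l where l: "\<And>t. prob {\<omega>\<in>space M. \<bar>\<xi> t \<omega>\<bar> \<ge> l} \<le> p0" "l \<ge> bg" "l \<ge> bf"
    by (auto simp: eventually_at_top_linorder)
  obtain m where m: "remainder m < p1"
    using order_tendstoD(2)[OF remainder_tendsto pos(5)] by (auto simp: eventually_sequentially)
  have Lm: "L * remainder m * b \<le> r / 4"
  proof -
    have "L * remainder m * b \<le> L * (r / (4 * (L + 1) * b)) * b"
      using m L_nonneg b by (intro mult_right_mono mult_left_mono) (auto simp: p1_def)
    also have "\<dots> = L * (r / (4 * (L + 1)))" using b by simp
    finally show ?thesis using frac[OF L_nonneg, of 4] by linarith
  qed
  obtain \<Gamma> :: "real set" where \<Gamma>: "finite \<Gamma>" "\<And>x. \<bar>x\<bar> \<le> 2 * l \<Longrightarrow> \<exists>y\<in>\<Gamma>. \<bar>x - y\<bar> \<le> h"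
    using finite_net[OF pos(6), of "2 * l"] by (metis real_norm_def)
  \<comment> \<open>The share of one node in the probability \<theta>/5. The rate \<kappa>2 demanded
    of (3)(c) depends on it and on m, which is fixed before n grows.\<close>
  define \<theta>' where "\<theta>' = \<theta> / (5 * (real (card \<Gamma>) + 1))"
  define \<kappa>2 where "\<kappa>2 = \<theta>' * (r / 4)\<^sup>2 / (8 * K\<^sup>2 * real m + 1)"
  have \<theta>': "\<theta>' > 0" "real (card \<Gamma>) * \<theta>' \<le> \<theta> / 5"
  proof -
    show "\<theta>' > 0" using \<theta> by (simp add: \<theta>'_def add_nonneg_pos)
    have "real (card \<Gamma>) * \<theta>' = \<theta> / 5 * (real (card \<Gamma>) / (real (card \<Gamma>) + 1))" by (simp add: \<theta>'_def)
    also have "\<dots> \<le> \<theta> / 5 * 1" using \<theta> by (intro mult_left_mono) auto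
    finally show "real (card \<Gamma>) * \<theta>' \<le> \<theta> / 5" by simp
  qed
  have K8: "8 * K\<^sup>2 * real m \<ge> 0" by simp
  have \<kappa>2: "\<kappa>2 > 0" "8 * K\<^sup>2 * real m * \<kappa>2 \<le> \<theta>' * (r / 4)\<^sup>2"
  proof -
    show "\<kappa>2 > 0" unfolding \<kappa>2_def using \<theta>' r K8 by (intro divide_pos_pos mult_pos_pos add_nonneg_pos) auto
    have "8 * K\<^sup>2 * real m * \<kappa>2 = \<theta>' * (r / 4)\<^sup>2 * (8 * K\<^sup>2 * real m / (8 * K\<^sup>2 * real m + 1))" by (simp add: \<kappa>2_def)
    also have "\<dots> \<le> \<theta>' * (r / 4)\<^sup>2 * 1"
    proof (rule mult_left_mono)
      have "x / (x + 1) \<le> 1" if "x \<ge> 0" for x :: real using that by simp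
      from this[OF K8] show "8 * K\<^sup>2 * real m / (8 * K\<^sup>2 * real m + 1) \<le> 1" .
    qed (use \<theta>' in simp)
    finally show "8 * K\<^sup>2 * real m * \<kappa>2 \<le> \<theta>' * (r / 4)\<^sup>2" by simp
  qed
  from eventually_gt_at_top[of 0] eventually_ge_of_sqrt_growth[OF D.c_pos D.s_growth, of 1] D.Z_mean D.Z_square[OF \<kappa>2(1)] show ?thesis
  proof eventually_elim
    case (elim n)
    then have n: "n > 0" and s: "s n \<ge> 1" by auto
    let ?N = "M \<Otimes>\<^sub>M M" and ?I = "{1..int n}"
    interpret P: pair_prob_space M M ..
    have mean: "(\<Sum>t\<in>?I. expectation (\<lambda>\<omega>. norm (Z n t \<omega>))) \<le> B1 * s n"
      using elim(3) mult_right_mono[OF B1(1), of "s n"] s by linarith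
    have mean': "k * (\<Sum>t\<in>?I. expectation (\<lambda>\<omega>. norm (Z n t \<omega>))) \<le> \<theta> / 5 * (c * s n)" if "0 \<le> k" "k * B1 \<le> \<theta> / 5 * c" for k c
    proof -
      have "k * (\<Sum>t\<in>?I. expectation (\<lambda>\<omega>. norm (Z n t \<omega>))) \<le> k * (B1 * s n)" using mean that(1) by (rule mult_left_mono)
      also have "\<dots> = (k * B1) * s n" by simp
      also have "\<dots> \<le> (\<theta> / 5 * c) * s n" using that(2) s by (intro mult_right_mono) auto
      finally show ?thesis by simp
    qed
    define N0 where "N0 = {p \<in> space ?N. (\<Sum>t\<in>?I. norm (Z n t (fst p)) * 1) > b * s n}"
    define N1 where "N1 = {p \<in> space ?N. (\<Sum>t\<in>?I. norm (Z n t (fst p)) * \<bar>\<xi> (t - 1) (snd p) - \<xi>_trunc m (t - 1) (snd p)\<bar>) > \<kappa>1 * s n}"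
    define N3 where "N3 = {p \<in> space ?N. (\<Sum>t\<in>?I. norm (Z n t (fst p)) * of_bool (\<bar>\<xi> (t - 1) (snd p)\<bar> \<ge> l)) > \<kappa>3 * s n}"
    define D where "D y = {p \<in> space ?N. (norm (\<Sum>t\<in>?I. A_trunc m y t (snd p) *\<^sub>R Z n t (fst p)))\<^sup>2 > (r / 4 * s n)\<^sup>2}" for y
    define N2 where "N2 = (\<Union>y\<in>\<Gamma>. D y)"
    have N0: "N0 \<in> sets ?N" "measure ?N N0 \<le> \<theta> / 5"
    proof -
      have r: "1 * (\<Sum>t\<in>?I. expectation (\<lambda>\<omega>. norm (Z n t \<omega>))) \<le> \<theta> / 5 * (b * s n)"
        by (rule mean') (use \<theta> in \<open>auto simp: b_def\<close>)
      show "N0 \<in> sets ?N" "measure ?N N0 \<le> \<theta> / 5" unfolding N0_def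
        by (rule weighted_pair_markov[OF finite_atLeastAtMost_int Z(1)[OF n] Z(2)[OF n] _ _ _ r]; use b s in \<open>simp add: prob_space\<close>)+
    qed
    have N1: "N1 \<in> sets ?N" "measure ?N N1 \<le> \<theta> / 5"
    proof -
      have p1: "p1 * B1 \<le> \<theta> / 5 * \<kappa>1"
      proof -
        have "p1 * B1 \<le> (\<theta> * \<kappa>1 / (5 * B1)) * B1" using B1 by (intro mult_right_mono) (auto simp: p1_def)
        then show ?thesis using B1 by simp
      qed
      have e: "expectation (\<lambda>\<omega>. \<bar>\<xi> (t - 1) \<omega> - \<xi>_trunc m (t - 1) \<omega>\<bar>) \<le> p1" for t
        using truncation_error(2)[of "t - 1" m] m by linarith
      show "N1 \<in> sets ?N" "measure ?N N1 \<le> \<theta> / 5" unfolding N1_def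
        by (rule weighted_pair_markov[OF finite_atLeastAtMost_int Z(1)[OF n] Z(2)[OF n] truncation_error(1) abs_ge_zero e
              mean'[OF less_imp_le[OF pos(5)] p1]]; use pos s in simp)+
    qed
    have N3: "N3 \<in> sets ?N" "measure ?N N3 \<le> \<theta> / 5"
    proof -
      have p0: "p0 * B1 \<le> \<theta> / 5 * \<kappa>3" using B1 by (simp add: p0_def)
      have e: "expectation (\<lambda>\<omega>. of_bool (\<bar>\<xi> (t - 1) \<omega>\<bar> \<ge> l)) \<le> p0" for t
        using l(1)[of "t - 1"] by (subst expectation_of_bool) auto
      have i: "integrable M (\<lambda>\<omega>. of_bool (\<bar>\<xi> (t - 1) \<omega>\<bar> \<ge> l) :: real)" for t by (rule integrable_of_bool) measurable
      show "N3 \<in> sets ?N" "measure ?N N3 \<le> \<theta> / 5" unfolding N3_def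
        by (rule weighted_pair_markov[OF finite_atLeastAtMost_int Z(1)[OF n] Z(2)[OF n] i _ e
              mean'[OF less_imp_le[OF pos(4)] p0]]; use pos s in simp)+
    qed
    have Dm: "D y \<in> sets ?N" and Dp: "measure ?N (D y) \<le> \<theta>'" for y
    proof -
      have "(\<lambda>p. A_trunc m y t (snd p) *\<^sub>R Z n t (fst p)) \<in> borel_measurable ?N" if "t \<in> ?I" for t
      proof -
        note [measurable] = Z(1)[OF n that]
        show ?thesis by measurable
      qed
      then have [measurable]: "(\<lambda>p. \<Sum>t\<in>?I. A_trunc m y t (snd p) *\<^sub>R Z n t (fst p)) \<in> borel_measurable ?N"
        by (rule borel_measurable_sum)
      show "D y \<in> sets ?N" unfolding D_def by measurable
      show "measure ?N (D y) \<le> \<theta>'" unfolding D_def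
      proof (rule pair_markov[of _ "\<lambda>\<omega>. 8 * K\<^sup>2 * real m * (\<Sum>t\<in>?I. (norm (Z n t \<omega>))\<^sup>2)"])
        show "(\<integral>\<^sup>+\<omega>'. ennreal ((norm (\<Sum>t\<in>?I. A_trunc m y t (snd (\<omega>, \<omega>')) *\<^sub>R Z n t (fst (\<omega>, \<omega>'))))\<^sup>2) \<partial>M)
          \<le> ennreal (8 * K\<^sup>2 * real m * (\<Sum>t\<in>?I. (norm (Z n t \<omega>))\<^sup>2))" for \<omega>
          unfolding fst_conv snd_conv by (rule A_trunc_second_moment) simp
        show "integrable M (\<lambda>\<omega>. 8 * K\<^sup>2 * real m * (\<Sum>t\<in>?I. (norm (Z n t \<omega>))\<^sup>2))"
          by (intro integrable_mult_right Bochner_Integration.integrable_sum Z(3)[OF n])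
        show "8 * K\<^sup>2 * real m * (\<Sum>t\<in>?I. (norm (Z n t \<omega>))\<^sup>2) \<ge> 0" for \<omega>
          using K8 by (intro mult_nonneg_nonneg[OF K8] sum_nonneg) auto
        show "(r / 4 * s n)\<^sup>2 > 0" using r s by simp
        have "expectation (\<lambda>\<omega>. 8 * K\<^sup>2 * real m * (\<Sum>t\<in>?I. (norm (Z n t \<omega>))\<^sup>2))
           = 8 * K\<^sup>2 * real m * (\<Sum>t\<in>?I. expectation (\<lambda>\<omega>. (norm (Z n t \<omega>))\<^sup>2))"
          using Z(3)[OF n] by (simp add: Bochner_Integration.integral_sum)
        also have "\<dots> \<le> 8 * K\<^sup>2 * real m * (\<kappa>2 * s n)" using elim(4) by (rule mult_left_mono) simp
        also have "\<dots> = 8 * K\<^sup>2 * real m * \<kappa>2 * s n" by simp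
        also have "\<dots> \<le> \<theta>' * (r / 4)\<^sup>2 * (s n)\<^sup>2"
        proof (rule mult_mono[OF \<kappa>2(2)])
          \<comment> \<open>The second moment is of order s n only, while the threshold is of order
            (s n)^2; s n \<ge> 1 bridges the two.\<close>
          have "s n * 1 \<le> s n * s n" using s by (intro mult_left_mono) auto
          then show "s n \<le> (s n)\<^sup>2" by (simp add: power2_eq_square)
        qed (use s \<theta>' in auto)
        finally show "expectation (\<lambda>\<omega>. 8 * K\<^sup>2 * real m * (\<Sum>t\<in>?I. (norm (Z n t \<omega>))\<^sup>2)) \<le> \<theta>' * (r / 4 * s n)\<^sup>2"
          by (simp only: power_mult_distrib mult.assoc)
      qed measurable
    qed
    have N2: "N2 \<in> sets ?N" "measure ?N N2 \<le> \<theta> / 5"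
    proof -
      show "N2 \<in> sets ?N" unfolding N2_def by (rule sets.finite_UN[OF \<Gamma>(1) Dm])
      have "measure ?N N2 \<le> (\<Sum>y\<in>\<Gamma>. measure ?N (D y))" unfolding N2_def by (rule measure_UNION_le[OF \<Gamma>(1) Dm])
      also have "\<dots> \<le> (\<Sum>y\<in>\<Gamma>. \<theta>')" by (rule sum_mono) (rule Dp)
      also have "\<dots> \<le> \<theta> / 5" using \<theta>'(2) by simp
      finally show "measure ?N N2 \<le> \<theta> / 5" .
    qed
    let ?bad = "N0 \<union> (N1 \<union> (N2 \<union> N3))"
    have "measure ?N ?bad \<le> measure ?N N0 + (measure ?N N1 + (measure ?N N2 + measure ?N N3))"
      by (intro order_trans[OF measure_Un_le] add_left_mono order_refl) (use N0 N1 N2 N3 in auto)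
    also have "\<dots> \<le> \<theta>" using N0 N1 N2 N3 \<theta> by linarith
    finally have bad: "measure ?N ?bad \<le> \<theta>" .
    have "norm (\<Sum>t\<in>?I. (g (x - \<xi> (t - 1) (snd p)) - f x) *\<^sub>R Z n t (fst p)) \<le> r * s n"
      if p: "p \<in> space ?N - ?bad" for p x
    proof -
      define z where "z t = Z n t (fst p)" for t
      define S where "S = (\<Sum>t\<in>?I. norm (z t))"
      have g0: "S \<le> b * s n"
        and g1: "(\<Sum>t\<in>?I. norm (z t) * \<bar>\<xi> (t - 1) (snd p) - \<xi>_trunc m (t - 1) (snd p)\<bar>) \<le> \<kappa>1 * s n"
        and g3: "(\<Sum>t\<in>?I. norm (z t) * of_bool (\<bar>\<xi> (t - 1) (snd p)\<bar> \<ge> l)) \<le> \<kappa>3 * s n"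
        using p unfolding N0_def N1_def N3_def z_def S_def by (auto simp: not_less)
      have g2: "norm (\<Sum>t\<in>?I. A_trunc m y t (snd p) *\<^sub>R z t) \<le> r / 4 * s n" if "y \<in> \<Gamma>" for y
      proof -
        have "(norm (\<Sum>t\<in>?I. A_trunc m y t (snd p) *\<^sub>R z t))\<^sup>2 \<le> (r / 4 * s n)\<^sup>2"
          using p that unfolding N2_def D_def z_def by (auto simp: not_less)
        then show ?thesis by (rule power2_le_imp_le) (use r s in auto)
      qed
      have S0: "S \<ge> 0" unfolding S_def by (rule sum_nonneg) simp
      have wsum: "(\<Sum>t\<in>?I. (c + k * w t) * norm (z t)) = c * S + k * (\<Sum>t\<in>?I. norm (z t) * w t)"
        for c k :: real and w :: "int \<Rightarrow> real"
        unfolding S_def sum_distrib_left sum.distrib[symmetric] by (intro sum.cong refl) (simp add: algebra_simps)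
      show ?thesis unfolding z_def[symmetric]
      proof (cases "\<bar>x\<bar> \<le> 2 * l")
        case True
        obtain y where y: "y \<in> \<Gamma>" "\<bar>x - y\<bar> \<le> h" using \<Gamma>(2)[OF True] by blast
        let ?d = "\<lambda>t. (g (x - \<xi> (t - 1) (snd p)) - f x) - A_trunc m y t (snd p)"
        have "(\<Sum>t\<in>?I. (g (x - \<xi> (t - 1) (snd p)) - f x) *\<^sub>R z t)
           = (\<Sum>t\<in>?I. A_trunc m y t (snd p) *\<^sub>R z t) + (\<Sum>t\<in>?I. ?d t *\<^sub>R z t)"
          unfolding sum.distrib[symmetric] by (rule sum.cong) (auto simp: scaleR_left_distrib[symmetric])
        then have "norm (\<Sum>t\<in>?I. (g (x - \<xi> (t - 1) (snd p)) - f x) *\<^sub>R z t)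
           \<le> norm (\<Sum>t\<in>?I. A_trunc m y t (snd p) *\<^sub>R z t) + norm (\<Sum>t\<in>?I. ?d t *\<^sub>R z t)"
          by (simp only: norm_triangle_ineq)
        moreover have "norm (\<Sum>t\<in>?I. ?d t *\<^sub>R z t) \<le> (\<Sum>t\<in>?I. ((2 * L * h + L * remainder m)
            + L * \<bar>\<xi> (t - 1) (snd p) - \<xi>_trunc m (t - 1) (snd p)\<bar>) * norm (z t))"
          by (rule order_trans[OF norm_sum sum_mono], unfold norm_scaleR real_norm_def)
             (intro mult_right_mono A_trunc_approx y norm_ge_zero)
        moreover have "(\<Sum>t\<in>?I. ((2 * L * h + L * remainder m)
            + L * \<bar>\<xi> (t - 1) (snd p) - \<xi>_trunc m (t - 1) (snd p)\<bar>) * norm (z t))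
            = (2 * L * h + L * remainder m) * S + L * (\<Sum>t\<in>?I. norm (z t) * \<bar>\<xi> (t - 1) (snd p) - \<xi>_trunc m (t - 1) (snd p)\<bar>)"
          by (rule wsum)
        moreover have "(2 * L * h + L * remainder m) * S \<le> (r / 4 + r / 4) * s n"
        proof -
          have "remainder m \<ge> 0" unfolding remainder_def using s2_nonneg
            by (intro real_sqrt_ge_zero mult_nonneg_nonneg suminf_nonneg summable_ignore_initial_segment[OF a_tail_square]) auto
          then have "(2 * L * h + L * remainder m) * S \<le> (2 * L * h + L * remainder m) * (b * s n)"
            using g0 L_nonneg pos by (intro mult_left_mono) auto
          also have "\<dots> = (2 * L * h * b + L * remainder m * b) * s n" by (simp add: algebra_simps)
          also have "\<dots> \<le> (r / 4 + r / 4) * s n" using Lh Lm s by (intro mult_right_mono add_mono) auto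
          finally show ?thesis .
        qed
        moreover have "L * (\<Sum>t\<in>?I. norm (z t) * \<bar>\<xi> (t - 1) (snd p) - \<xi>_trunc m (t - 1) (snd p)\<bar>) \<le> r / 4 * s n"
        proof -
          have "L * (\<Sum>t\<in>?I. norm (z t) * \<bar>\<xi> (t - 1) (snd p) - \<xi>_trunc m (t - 1) (snd p)\<bar>) \<le> L * (\<kappa>1 * s n)"
            using g1 L_nonneg by (rule mult_left_mono)
          also have "\<dots> = L * \<kappa>1 * s n" by simp
          also have "\<dots> \<le> r / 4 * s n" using L1 s by (intro mult_right_mono) auto
          finally show ?thesis .
        qed
        moreover have "r / 4 * s n + ((r / 4 + r / 4) * s n + r / 4 * s n) = r * s n" by (simp add: algebra_simps)
        ultimately show "norm (\<Sum>t\<in>?I. (g (x - \<xi> (t - 1) (snd p)) - f x) *\<^sub>R z t) \<le> r * s n"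
          using g2[OF y(1)] by linarith
      next
        case False
        have l0: "l > 0" using bg l by linarith
        have fx: "\<bar>f x\<bar> \<le> q" using bf(2)[of x] False l l0 by linarith
        have w: "\<bar>g (x - \<xi> (t - 1) (snd p)) - f x\<bar> \<le> 2 * q + K * of_bool (\<bar>\<xi> (t - 1) (snd p)\<bar> \<ge> l)" for t
        proof (cases "\<bar>\<xi> (t - 1) (snd p)\<bar> \<ge> l")
          case True
          then show ?thesis using fx g_bound[of "x - \<xi> (t - 1) (snd p)"] pos(1) by simp
        next
          case no: False
          have "\<bar>g (x - \<xi> (t - 1) (snd p))\<bar> \<le> q" by (rule bg(2)) (use no False l in linarith)
          then show ?thesis using no fx by simp
        qed
        have "norm (\<Sum>t\<in>?I. (g (x - \<xi> (t - 1) (snd p)) - f x) *\<^sub>R z t)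
          \<le> (\<Sum>t\<in>?I. (2 * q + K * of_bool (\<bar>\<xi> (t - 1) (snd p)\<bar> \<ge> l)) * norm (z t))"
          by (rule order_trans[OF norm_sum sum_mono], unfold norm_scaleR real_norm_def) (intro mult_right_mono w norm_ge_zero)
        also have "\<dots> = 2 * q * S + K * (\<Sum>t\<in>?I. norm (z t) * of_bool (\<bar>\<xi> (t - 1) (snd p)\<bar> \<ge> l))"
          by (rule wsum)
        also have "\<dots> \<le> 2 * q * (b * s n) + K * (\<kappa>3 * s n)"
          using g0 g3 pos K_nonneg by (intro add_mono mult_left_mono) auto
        also have "\<dots> = (2 * q * b + K * \<kappa>3) * s n" by (simp add: algebra_simps)
        also have "\<dots> \<le> r * s n" using qb K3 s by (intro mult_right_mono) auto
        finally show "norm (\<Sum>t\<in>?I. (g (x - \<xi> (t - 1) (snd p)) - f x) *\<^sub>R z t) \<le> r * s n" .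
      qed
    qed
    then show ?case using bad N0 N1 N2 N3 by (intro bexI[of _ ?bad]) auto
  qed
qed

end

lemma (in prob_space) distr_pair_snd:
  assumes "sigma_finite_measure N" shows "distr (M \<Otimes>\<^sub>M N) N snd = N"
proof (intro measure_eqI)
  interpret N: sigma_finite_measure N by fact
  fix A assume A: "A \<in> sets (distr (M \<Otimes>\<^sub>M N) N snd)"
  then have "emeasure (distr (M \<Otimes>\<^sub>M N) N snd) A = emeasure (M \<Otimes>\<^sub>M N) (space M \<times> A)"
    by (auto simp: emeasure_distr space_pair_measure dest: sets.sets_into_space intro!: arg_cong[where f = "emeasure (M \<Otimes>\<^sub>M N)"])
  also have "\<dots> = emeasure N A"
    using A by (simp add: N.emeasure_pair_measure_Times emeasure_space_1)
  finally show "emeasure (distr (M \<Otimes>\<^sub>M N) N snd) A = emeasure N A" .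
qed simp

section \<open>The two instances of the regression array\<close>

context smooth_linear_process begin

lemma eps_second_moment_stationary:
  "integrable M (\<lambda>\<omega>. (\<epsilon> t \<omega>)\<^sup>2)" "expectation (\<lambda>\<omega>. (\<epsilon> t \<omega>)\<^sup>2) = s2 * (\<Sum>i. (a i)\<^sup>2)"
  by (rule eps_square_integrable[OF a_square]) (rule eps_second_moment[OF a_square])

lemma regression_array_predictable:
  fixes Z :: "nat \<Rightarrow> int \<Rightarrow> 'a \<Rightarrow> 'v::euclidean_space"
  assumes Zp: "\<And>n t. n > 0 \<Longrightarrow> t \<in> {1..int n} \<Longrightarrow> Z n t \<in> borel_measurable (past (t - 1))"
    and D: "displacement_array M Z s B c"
    and lin: "\<And>r \<theta>. r > 0 \<Longrightarrow> \<theta> > 0 \<Longrightarrow> eventually (\<lambda>n. \<exists>N\<in>events. prob N \<le> \<theta> \<and>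
      (\<forall>\<omega>\<in>space M - N. \<forall>x. norm (\<Sum>t\<in>{1..int n}. (g (x - \<xi> (t - 1) \<omega>) - f x) *\<^sub>R Z n t \<omega>) \<le> r * s n)) sequentially"
  shows "regression_array M Z s B c \<epsilon> (\<lambda>t. \<xi> (t - 1)) G g f K L (s2 * (\<Sum>i. (a i)\<^sup>2))"
proof (intro regression_array.intro D regression_array_axioms.intro)
  fix n :: nat and l x1 x2 c1 c2 :: real and v1 v2 :: 'v
  assume n: "n > 0" and l: "0 \<le> l" "l \<le> 1"
  have lev: "(\<lambda>\<omega>. x + v \<bullet> Z n t \<omega> + d * norm (Z n t \<omega>)) \<in> borel_measurable (past (t - 1))"
    if "t \<in> {1..int n}" for t x v d
  proof -
    note [measurable] = Zp[OF n that]
    show ?thesis by measurable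
  qed
  show "(\<integral>\<^sup>+\<omega>. ennreal (exp (\<Sum>t\<in>{1..int n}.
         l * (of_bool (\<epsilon> t \<omega> \<le> x1 + v1 \<bullet> Z n t \<omega> + c1 * norm (Z n t \<omega>))
              - of_bool (\<epsilon> t \<omega> \<le> x2 + v2 \<bullet> Z n t \<omega> + c2 * norm (Z n t \<omega>))
              - (G (x1 + v1 \<bullet> Z n t \<omega> + c1 * norm (Z n t \<omega>) - \<xi> (t - 1) \<omega>) - G (x2 + v2 \<bullet> Z n t \<omega> + c2 * norm (Z n t \<omega>) - \<xi> (t - 1) \<omega>)))
         - l\<^sup>2 * \<bar>G (x1 + v1 \<bullet> Z n t \<omega> + c1 * norm (Z n t \<omega>) - \<xi> (t - 1) \<omega>) - G (x2 + v2 \<bullet> Z n t \<omega> + c2 * norm (Z n t \<omega>) - \<xi> (t - 1) \<omega>)\<bar>)) \<partial>M) \<le> 1"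
    using exp_supermartingale[OF l, of n "\<lambda>t \<omega>. x1 + v1 \<bullet> Z n t \<omega> + c1 * norm (Z n t \<omega>)" "\<lambda>t \<omega>. x2 + v2 \<bullet> Z n t \<omega> + c2 * norm (Z n t \<omega>)", OF lev lev]
    unfolding compensator_def by blast
qed (use lin in \<open>auto simp: G_lipschitz G_linearization f_bound f_lipschitz f_vanishes eps_second_moment_stationary\<close>)

text \<open>For a frozen first coordinate the levels are constants, hence trivially known in
  advance, and the exponential inequality holds slice by slice in the second coordinate. The linear
  condition comes from \<open>linear_small_pair\<close>.\<close>

lemma regression_array_pair:
  fixes Z :: "nat \<Rightarrow> int \<Rightarrow> 'a \<Rightarrow> 'v::euclidean_space"
  assumes D: "displacement_array M Z s B c"
  shows "regression_array (M \<Otimes>\<^sub>M M) (\<lambda>n t p. Z n t (fst p)) s B c (\<lambda>t p. \<epsilon> t (snd p)) (\<lambda>t p. \<xi> (t - 1) (snd p))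
     G g f K L (s2 * (\<Sum>i. (a i)\<^sup>2))"
proof -
  interpret D: displacement_array M Z s B c by (rule D)
  note Z = D.Z_measurable and Z1 = D.Z_integrable and Z2 = D.Z_square_integrable
  interpret P: pair_prob_space M M ..
  have d1: "distr (M \<Otimes>\<^sub>M M) M fst = M" by (rule distr_pair_fst)
  have d2: "distr (M \<Otimes>\<^sub>M M) M snd = M" by (rule distr_pair_snd) unfold_locales
  have i1: "integrable (M \<Otimes>\<^sub>M M) (\<lambda>p. h (fst p))" "integral\<^sup>L (M \<Otimes>\<^sub>M M) (\<lambda>p. h (fst p)) = expectation h"
    if "integrable M h" for h :: "'a \<Rightarrow> real"
  proof -
    have [measurable]: "h \<in> borel_measurable M" using that by simp
    show "integrable (M \<Otimes>\<^sub>M M) (\<lambda>p. h (fst p))" using that by (subst (asm) d1[symmetric]) (simp add: integrable_distr_eq)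
    show "integral\<^sup>L (M \<Otimes>\<^sub>M M) (\<lambda>p. h (fst p)) = expectation h"
      by (subst (2) d1[symmetric]) (simp add: integral_distr)
  qed
  have i2: "integrable (M \<Otimes>\<^sub>M M) (\<lambda>p. h (snd p))" "integral\<^sup>L (M \<Otimes>\<^sub>M M) (\<lambda>p. h (snd p)) = expectation h"
    if "integrable M h" for h :: "'a \<Rightarrow> real"
  proof -
    have [measurable]: "h \<in> borel_measurable M" using that by simp
    show "integrable (M \<Otimes>\<^sub>M M) (\<lambda>p. h (snd p))" using that by (subst (asm) d2[symmetric]) (simp add: integrable_distr_eq)
    show "integral\<^sup>L (M \<Otimes>\<^sub>M M) (\<lambda>p. h (snd p)) = expectation h"
      by (subst (2) d2[symmetric]) (simp add: integral_distr)
  qed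
  show ?thesis
  proof unfold_locales
    fix n :: nat and l x1 x2 c1 c2 :: real and v1 v2 :: 'v
    assume n: "n > 0" and l: "0 \<le> l" "l \<le> 1"
    define A where "A t \<omega> = x1 + v1 \<bullet> Z n t \<omega> + c1 * norm (Z n t \<omega>)" for t \<omega>
    define B where "B t \<omega> = x2 + v2 \<bullet> Z n t \<omega> + c2 * norm (Z n t \<omega>)" for t \<omega>
    let ?T = "\<lambda>t p. l * (of_bool (\<epsilon> t (snd p) \<le> A t (fst p)) - of_bool (\<epsilon> t (snd p) \<le> B t (fst p))
              - (G (A t (fst p) - \<xi> (t - 1) (snd p)) - G (B t (fst p) - \<xi> (t - 1) (snd p))))
         - l\<^sup>2 * \<bar>G (A t (fst p) - \<xi> (t - 1) (snd p)) - G (B t (fst p) - \<xi> (t - 1) (snd p))\<bar>"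
    have "(\<lambda>p. ?T t p) \<in> borel_measurable (M \<Otimes>\<^sub>M M)" if "t \<in> {1..int n}" for t
    proof -
      note [measurable] = Z[OF n that]
      have [measurable]: "A t \<in> borel_measurable M" "B t \<in> borel_measurable M" unfolding A_def B_def by measurable
      show ?thesis by measurable
    qed
    then have [measurable]: "(\<lambda>p. \<Sum>t\<in>{1..int n}. ?T t p) \<in> borel_measurable (M \<Otimes>\<^sub>M M)"
      by (rule borel_measurable_sum)
    have "(\<integral>\<^sup>+p. ennreal (exp (\<Sum>t\<in>{1..int n}. ?T t p)) \<partial>(M \<Otimes>\<^sub>M M))
       = (\<integral>\<^sup>+\<omega>. (\<integral>\<^sup>+\<omega>'. ennreal (exp (\<Sum>t\<in>{1..int n}. ?T t (\<omega>, \<omega>'))) \<partial>M) \<partial>M)"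
      by (rule nn_integral_fst[symmetric]) measurable
    also have "\<dots> \<le> (\<integral>\<^sup>+\<omega>. 1 \<partial>M)"
    proof (rule nn_integral_mono)
      fix \<omega>
      show "(\<integral>\<^sup>+\<omega>'. ennreal (exp (\<Sum>t\<in>{1..int n}. ?T t (\<omega>, \<omega>'))) \<partial>M) \<le> 1"
        using exp_supermartingale[OF l, of n "\<lambda>t \<omega>'. A t \<omega>" "\<lambda>t \<omega>'. B t \<omega>"]
        unfolding compensator_def fst_conv snd_conv by simp
    qed
    also have "\<dots> = 1" by (simp add: emeasure_space_1)
    finally show "(\<integral>\<^sup>+\<omega>. ennreal (exp (\<Sum>t\<in>{1..int n}.
         l * (of_bool (\<epsilon> t (snd \<omega>) \<le> x1 + v1 \<bullet> Z n t (fst \<omega>) + c1 * norm (Z n t (fst \<omega>)))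
              - of_bool (\<epsilon> t (snd \<omega>) \<le> x2 + v2 \<bullet> Z n t (fst \<omega>) + c2 * norm (Z n t (fst \<omega>)))
              - (G (x1 + v1 \<bullet> Z n t (fst \<omega>) + c1 * norm (Z n t (fst \<omega>)) - \<xi> (t - 1) (snd \<omega>)) - G (x2 + v2 \<bullet> Z n t (fst \<omega>) + c2 * norm (Z n t (fst \<omega>)) - \<xi> (t - 1) (snd \<omega>))))
         - l\<^sup>2 * \<bar>G (x1 + v1 \<bullet> Z n t (fst \<omega>) + c1 * norm (Z n t (fst \<omega>)) - \<xi> (t - 1) (snd \<omega>)) - G (x2 + v2 \<bullet> Z n t (fst \<omega>) + c2 * norm (Z n t (fst \<omega>)) - \<xi> (t - 1) (snd \<omega>))\<bar>)) \<partial>(M \<Otimes>\<^sub>M M)) \<le> 1"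
      unfolding A_def B_def .
  next
    fix n :: nat and t :: int assume "n > 0" "t \<in> {1..int n}"
    note [measurable] = Z[OF this]
    show "(\<lambda>p. Z n t (fst p)) \<in> borel_measurable (M \<Otimes>\<^sub>M M)" by measurable
    show "integrable (M \<Otimes>\<^sub>M M) (\<lambda>p. norm (Z n t (fst p)))" by (rule i1[OF Z1]) fact+
    show "integrable (M \<Otimes>\<^sub>M M) (\<lambda>p. (norm (Z n t (fst p)))\<^sup>2)" by (rule i1[OF Z2]) fact+
  next
    show "eventually (\<lambda>n. (\<Sum>t\<in>{1..int n}. integral\<^sup>L (M \<Otimes>\<^sub>M M) (\<lambda>p. norm (Z n t (fst p)))) \<le> B * s n) sequentially"
      using D.Z_mean eventually_gt_at_top[of 0] by eventually_elim (simp add: i1(2)[OF Z1])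
  next
    fix r :: real assume "r > 0"
    show "eventually (\<lambda>n. (\<Sum>t\<in>{1..int n}. integral\<^sup>L (M \<Otimes>\<^sub>M M) (\<lambda>p. (norm (Z n t (fst p)))\<^sup>2)) \<le> r * s n) sequentially"
      using D.Z_square[OF \<open>r > 0\<close>] eventually_gt_at_top[of 0] by eventually_elim (simp add: i1(2)[OF Z2])
  next
    fix r \<theta> :: real assume "r > 0" "\<theta> > 0"
    show "eventually (\<lambda>n. \<exists>N\<in>sets (M \<Otimes>\<^sub>M M). measure (M \<Otimes>\<^sub>M M) N \<le> \<theta> \<and>
      (\<forall>p\<in>space (M \<Otimes>\<^sub>M M) - N. \<forall>x. norm (\<Sum>t\<in>{1..int n}. (g (x - \<xi> (t - 1) (snd p)) - f x) *\<^sub>R Z n t (fst p)) \<le> r * s n)) sequentially"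
      by (rule linear_small_pair[OF D \<open>r > 0\<close> \<open>\<theta> > 0\<close>])
  next
    fix t
    show "integrable (M \<Otimes>\<^sub>M M) (\<lambda>p. (\<epsilon> t (snd p))\<^sup>2)"
      by (rule i2(1)[OF eps_second_moment_stationary(1)])
    show "integral\<^sup>L (M \<Otimes>\<^sub>M M) (\<lambda>p. (\<epsilon> t (snd p))\<^sup>2) \<le> s2 * (\<Sum>i. (a i)\<^sup>2)"
      unfolding i2(2)[OF eps_second_moment_stationary(1)] eps_second_moment_stationary(2) by simp
  qed (use D.c_pos D.s_growth in \<open>auto simp: G_lipschitz G_linearization f_bound f_lipschitz f_vanishes\<close>)
qed

end

text \<open>Pulls a bad set of samples back to an event on which u may then depend on \<omega>,
  because the bound holds simultaneously for all u in the ball.\<close>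

lemma (in prob_space) sample_event:
  fixes Z :: "int \<Rightarrow> 'a \<Rightarrow> 'v::euclidean_space" and E :: "int \<Rightarrow> 'a \<Rightarrow> real"
    and I :: "int set" and f :: "real \<Rightarrow> real"
  defines "P \<equiv> (\<Pi>\<^sub>M t\<in>I. borel :: 'v measure) \<Otimes>\<^sub>M (\<Pi>\<^sub>M t\<in>I. borel :: real measure)"
  assumes S: "S \<in> sets P"
    and Z: "\<And>t. t \<in> I \<Longrightarrow> Z t \<in> borel_measurable M" and E: "\<And>t. t \<in> I \<Longrightarrow> E t \<in> borel_measurable M"
    and pr: "prob {\<omega>\<in>space M. ((\<lambda>t\<in>I. Z t \<omega>), (\<lambda>t\<in>I. E t \<omega>)) \<in> S} \<le> \<theta>"
    and bound: "\<And>z \<epsilon> u x. (z, \<epsilon>) \<in> space P - S \<Longrightarrow> norm u \<le> C \<Longrightarrow>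
      \<bar>(\<Sum>t\<in>I. of_bool (\<epsilon> t \<le> x + u \<bullet> z t) - of_bool (\<epsilon> t \<le> x)) - (u \<bullet> (\<Sum>t\<in>I. z t)) * f x\<bar> \<le> r"
  shows "\<exists>N\<in>events. prob N \<le> \<theta> \<and> (\<forall>\<omega>\<in>space M - N. \<forall>u x. norm u \<le> C \<longrightarrow>
      \<bar>(\<Sum>t\<in>I. of_bool (E t \<omega> \<le> x + u \<bullet> Z t \<omega>) - of_bool (E t \<omega> \<le> x)) - (u \<bullet> (\<Sum>t\<in>I. Z t \<omega>)) * f x\<bar> \<le> r)"
proof -
  let ?s = "\<lambda>\<omega>. ((\<lambda>t\<in>I. Z t \<omega>), (\<lambda>t\<in>I. E t \<omega>))"
  have s [measurable]: "?s \<in> measurable M P" unfolding P_def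
    by (intro measurable_Pair measurable_restrict Z E)
  show ?thesis
  proof (intro bexI[of _ "{\<omega>\<in>space M. ?s \<omega> \<in> S}"] conjI ballI allI impI)
    show "{\<omega>\<in>space M. ?s \<omega> \<in> S} \<in> events" using S by measurable
    fix \<omega> u x assume \<omega>: "\<omega> \<in> space M - {\<omega>\<in>space M. ?s \<omega> \<in> S}" and u: "norm (u::'v) \<le> C"
    then have "?s \<omega> \<in> space P - S" using measurable_space[OF s] by auto
    from bound[OF this u, of x]
    show "\<bar>(\<Sum>t\<in>I. of_bool (E t \<omega> \<le> x + u \<bullet> Z t \<omega>) - of_bool (E t \<omega> \<le> x)) - (u \<bullet> (\<Sum>t\<in>I. Z t \<omega>)) * f x\<bar> \<le> r"
      by (simp cong: sum.cong)
  qed (rule pr)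
qed

lemma (in prob_space) distr_pair_of_independent_copy:
  assumes ind: "indep_set (sets A) (sets B)" and sp: "space A = space M" "space B = space M"
    and U: "U \<in> measurable A S" and V: "V \<in> measurable B T"
  shows "distr M (S \<Otimes>\<^sub>M T) (\<lambda>\<omega>. (U \<omega>, V \<omega>)) = distr (M \<Otimes>\<^sub>M M) (S \<Otimes>\<^sub>M T) (\<lambda>p. (U (fst p), V (snd p)))"
proof -
  have m: "U \<in> measurable M S" "V \<in> measurable M T"
    using indep_setD_ev1[OF ind] indep_setD_ev2[OF ind] sp U V by (auto intro: measurable_of_coarser)
  interpret T: prob_space "distr M T V" by (rule prob_space_distr) (rule m)
  have "distr M S U \<Otimes>\<^sub>M distr M T V = distr (M \<Otimes>\<^sub>M M) (S \<Otimes>\<^sub>M T) (\<lambda>(x, y). (U x, V y))"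
    by (rule pair_measure_distr[OF m]) unfold_locales
  then show ?thesis
    using distr_pair_of_indep_set[OF ind sp U V] by (simp add: case_prod_beta')
qed

section \<open>Transfer of the oscillation bound to the original space\<close>

context smooth_linear_process begin

lemma oscillation_predictable:
  fixes Z :: "nat \<Rightarrow> int \<Rightarrow> 'a \<Rightarrow> 'v::euclidean_space"
  assumes Zp: "\<And>n t. n > 0 \<Longrightarrow> t \<in> {1..int n} \<Longrightarrow> Z n t \<in> borel_measurable (past (t - 1))"
    and D: "displacement_array M Z s B c"
    and lin: "\<And>r \<theta>. r > 0 \<Longrightarrow> \<theta> > 0 \<Longrightarrow> eventually (\<lambda>n. \<exists>N\<in>events. prob N \<le> \<theta> \<and>
      (\<forall>\<omega>\<in>space M - N. \<forall>x. norm (\<Sum>t\<in>{1..int n}. (g (x - \<xi> (t - 1) \<omega>) - f x) *\<^sub>R Z n t \<omega>) \<le> r * s n)) sequentially"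
    and bounds: "C \<ge> 0" "\<eta> > 0" "\<theta> > 0"
  shows "eventually (\<lambda>n. \<exists>N\<in>events. prob N \<le> \<theta> \<and> (\<forall>\<omega>\<in>space M - N. \<forall>u x. norm u \<le> C \<longrightarrow>
      \<bar>(\<Sum>t\<in>{1..int n}. of_bool (\<epsilon> t \<omega> \<le> x + u \<bullet> Z n t \<omega>) - of_bool (\<epsilon> t \<omega> \<le> x)) - (u \<bullet> (\<Sum>t\<in>{1..int n}. Z n t \<omega>)) * f x\<bar>
      \<le> \<eta> * s n)) sequentially"
proof -
  interpret R: regression_array M Z s B c \<epsilon> "\<lambda>t. \<xi> (t - 1)" G g f K L "s2 * (\<Sum>i. (a i)\<^sup>2)"
    by (intro regression_array_predictable Zp D lin)
  show ?thesis using R.oscillation_small[OF bounds] eventually_gt_at_top[of 0]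
  proof eventually_elim
    case (elim n)
    then obtain S where S: "S \<in> sets (R.samples n)" "prob {\<omega>\<in>space M. R.sample n \<omega> \<in> S} \<le> \<theta>"
      and bound: "\<And>z \<epsilon> u x. (z, \<epsilon>) \<in> space (R.samples n) - S \<Longrightarrow> norm u \<le> C \<Longrightarrow>
      \<bar>(\<Sum>t\<in>{1..int n}. of_bool (\<epsilon> t \<le> x + u \<bullet> z t) - of_bool (\<epsilon> t \<le> x)) - (u \<bullet> (\<Sum>t\<in>{1..int n}. z t)) * f x\<bar>
      \<le> \<eta> * s n" by blast
    show ?case
      by (intro sample_event[where S = S] S[unfolded R.samples_def R.sample_def] R.Z_measurable elim(2) eps_measurable
          bound[unfolded R.samples_def])
  qed
qed

text \<open>The bad set found on the square lies in the space of samples, and the sample has the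
  same law on M as on the square. So its probability carries over, while the bound outside it is a
  deterministic statement about samples.\<close>

lemma oscillation_independent:
  fixes Z :: "nat \<Rightarrow> int \<Rightarrow> 'a \<Rightarrow> 'v::euclidean_space"
  assumes ind: "indep_set (sets A) (sets (sigma_of M \<epsilon> UNIV))" and A: "space A = space M"
    and ZA: "\<And>n t. n > 0 \<Longrightarrow> t \<in> {1..int n} \<Longrightarrow> Z n t \<in> borel_measurable A"
    and D: "displacement_array M Z s B c"
    and bounds: "C \<ge> 0" "\<eta> > 0" "\<theta> > 0"
  shows "eventually (\<lambda>n. \<exists>N\<in>events. prob N \<le> \<theta> \<and> (\<forall>\<omega>\<in>space M - N. \<forall>u x. norm u \<le> C \<longrightarrow>
      \<bar>(\<Sum>t\<in>{1..int n}. of_bool (\<epsilon> t \<omega> \<le> x + u \<bullet> Z n t \<omega>) - of_bool (\<epsilon> t \<omega> \<le> x)) - (u \<bullet> (\<Sum>t\<in>{1..int n}. Z n t \<omega>)) * f x\<bar>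
      \<le> \<eta> * s n)) sequentially"
proof -
  note ZM = displacement_array.Z_measurable[OF D]
  interpret R: regression_array "M \<Otimes>\<^sub>M M" "\<lambda>n t p. Z n t (fst p)" s B c "\<lambda>t p. \<epsilon> t (snd p)" "\<lambda>t p. \<xi> (t - 1) (snd p)"
      G g f K L "s2 * (\<Sum>i. (a i)\<^sup>2)"
    by (rule regression_array_pair[OF D])
  show ?thesis using R.oscillation_small[OF bounds] eventually_gt_at_top[of 0]
  proof eventually_elim
    case (elim n)
    then obtain S where S: "S \<in> sets (R.samples n)" "measure (M \<Otimes>\<^sub>M M) {p\<in>space (M \<Otimes>\<^sub>M M). R.sample n p \<in> S} \<le> \<theta>"
      and bound: "\<And>z \<epsilon> u x. (z, \<epsilon>) \<in> space (R.samples n) - S \<Longrightarrow> norm u \<le> C \<Longrightarrow>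
      \<bar>(\<Sum>t\<in>{1..int n}. of_bool (\<epsilon> t \<le> x + u \<bullet> z t) - of_bool (\<epsilon> t \<le> x)) - (u \<bullet> (\<Sum>t\<in>{1..int n}. z t)) * f x\<bar>
      \<le> \<eta> * s n" by blast
    let ?PZ = "\<Pi>\<^sub>M t\<in>{1..int n}. (borel :: 'v measure)" and ?PE = "\<Pi>\<^sub>M t\<in>{1..int n}. (borel :: real measure)"
    define U where "U \<omega> = (\<lambda>t\<in>{1..int n}. Z n t \<omega>)" for \<omega>
    define W where "W \<omega> = (\<lambda>t\<in>{1..int n}. \<epsilon> t \<omega>)" for \<omega>
    have U: "U \<in> measurable A ?PZ" unfolding U_def by (intro measurable_restrict ZA elim)
    have W: "W \<in> measurable (sigma_of M \<epsilon> UNIV) ?PE" unfolding W_def by (intro measurable_restrict measurable_sigma_of) simp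
    have UM [measurable]: "U \<in> measurable M ?PZ" unfolding U_def by (intro measurable_restrict ZM elim)
    have WM [measurable]: "W \<in> measurable M ?PE" unfolding W_def by (intro measurable_restrict eps_measurable)
    have Sm: "S \<in> sets (?PZ \<Otimes>\<^sub>M ?PE)" using S(1) by (simp add: R.samples_def)
    have "prob {\<omega>\<in>space M. (U \<omega>, W \<omega>) \<in> S} = measure (distr M (?PZ \<Otimes>\<^sub>M ?PE) (\<lambda>\<omega>. (U \<omega>, W \<omega>))) S"
      using Sm by (subst measure_distr) (auto intro!: arg_cong[where f = prob])
    also have "\<dots> = measure (distr (M \<Otimes>\<^sub>M M) (?PZ \<Otimes>\<^sub>M ?PE) (\<lambda>p. (U (fst p), W (snd p)))) S"
      by (subst distr_pair_of_independent_copy[OF ind A _ U W]) simp_all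
    also have "\<dots> = measure (M \<Otimes>\<^sub>M M) {p\<in>space (M \<Otimes>\<^sub>M M). R.sample n p \<in> S}"
    proof -
      have "(\<lambda>p. (U (fst p), W (snd p))) \<in> measurable (M \<Otimes>\<^sub>M M) (?PZ \<Otimes>\<^sub>M ?PE)" by measurable
      from measure_distr[OF this Sm] show ?thesis
        by (simp add: R.sample_def U_def W_def vimage_def Int_def conj_commute)
    qed
    finally have pr: "prob {\<omega>\<in>space M. ((\<lambda>t\<in>{1..int n}. Z n t \<omega>), (\<lambda>t\<in>{1..int n}. \<epsilon> t \<omega>)) \<in> S} \<le> \<theta>"
      using S(2) by (simp add: U_def W_def)
    show ?case
      by (intro sample_event[where S = S] Sm ZM elim(2) eps_measurable pr bound[unfolded R.samples_def])
  qed
qed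

end

text \<open>Right continuity allows the supremum over all reals to be replaced by a countable one;
  this makes the suprema of the empirical processes measurable.\<close>

lemma cSUP_eq_SUP_rat:
  fixes h :: "real \<Rightarrow> real"
  assumes cont: "\<And>x. (h \<longlongrightarrow> h x) (at_right x)" and bdd: "bdd_above (range h)"
  shows "(SUP x. h x) = (SUP q. h (of_rat q))"
proof (rule antisym)
  have bdd': "bdd_above (range (\<lambda>q. h (of_rat q)))" by (rule bdd_above_mono[OF bdd]) auto
  show "(SUP q. h (of_rat q)) \<le> (SUP x. h x)"
    by (rule cSUP_least) (auto intro: cSUP_upper[OF _ bdd])
  show "(SUP x. h x) \<le> (SUP q. h (of_rat q))"
  proof (rule cSUP_least)
    fix x
    show "h x \<le> (SUP q. h (of_rat q))"
    proof (rule ccontr)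
      assume "\<not> ?thesis"
      then have "eventually (\<lambda>y. h y > (SUP q. h (of_rat q))) (at_right x)"
        using order_tendstoD(1)[OF cont[of x]] by simp
      then obtain b where b: "b > x" "\<And>y. x < y \<Longrightarrow> y < b \<Longrightarrow> h y > (SUP q. h (of_rat q))"
        by (auto simp: eventually_at_right_field)
      obtain q where "x < of_rat q" "of_rat q < b" using of_rat_dense[OF b(1)] by blast
      then have "h (of_rat q) > (SUP q. h (of_rat q))" by (rule b(2))
      then show False using cSUP_upper[OF _ bdd', of q] by simp
    qed
  qed simp
qed

lemma tendsto_of_bool_at_right:
  fixes r x :: real
  shows "((\<lambda>y. of_bool (r \<le> y) :: real) \<longlongrightarrow> of_bool (r \<le> x)) (at_right x)"
proof (rule tendsto_eventually)
  show "eventually (\<lambda>y. of_bool (r \<le> y) = (of_bool (r \<le> x) :: real)) (at_right x)"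
  proof (cases "r \<le> x")
    case True
    then show ?thesis by (auto simp: eventually_at_right_field intro!: exI[of _ "x + 1"])
  next
    case False
    then show ?thesis by (auto simp: eventually_at_right_field intro!: exI[of _ r])
  qed
qed

lemma bigo_one_imp_le:
  fixes w s :: "nat \<Rightarrow> real"
  assumes "(\<lambda>n. 1 / s n * w n) \<in> O(\<lambda>_. 1)" "eventually (\<lambda>n. s n \<ge> 1) sequentially"
  shows "\<exists>B. eventually (\<lambda>n. w n \<le> B * s n) sequentially"
proof -
  obtain B where "eventually (\<lambda>n. norm (1 / s n * w n) \<le> B * norm (1::real)) sequentially"
    using landau_o.bigE[OF assms(1)] by blast
  then have "eventually (\<lambda>n. w n \<le> B * s n) sequentially" using assms(2)
  proof eventually_elim
    case (elim n)
    then have "w n / s n \<le> B" using divide_right_mono[OF abs_ge_self[of "w n"], of "s n"] by simp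
    then show ?case using elim by (simp add: field_simps)
  qed
  then show ?thesis by blast
qed

lemma smallo_one_imp_le:
  fixes w s :: "nat \<Rightarrow> real"
  assumes "(\<lambda>n. 1 / s n * w n) \<in> o(\<lambda>_. 1)" "eventually (\<lambda>n. s n \<ge> 1) sequentially" "r > 0"
  shows "eventually (\<lambda>n. w n \<le> r * s n) sequentially"
  using landau_o.smallD[OF assms(1,3)] assms(2)
proof eventually_elim
  case (elim n)
  then have "w n / s n \<le> r" using divide_right_mono[OF abs_ge_self[of "w n"], of "s n"] by simp
  then show ?case using elim by (simp add: field_simps)
qed

lemma borel_measurable_matrix_vector:
  fixes A :: "real ^ 'n ^ 'm"
  assumes "X \<in> borel_measurable M" shows "(\<lambda>\<omega>. A *v X \<omega>) \<in> borel_measurable M"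
  by (rule measurable_compose[OF assms borel_measurable_continuous_onI])
     (rule linear_continuous_on[OF matrix_vector_mul_bounded_linear])

section \<open>Residual empirical processes\<close>

lemma three_times_smoothD:
  assumes "three_times_smooth G"
  shows "\<exists>K L. (\<forall>x. (G has_real_derivative deriv G x) (at x)) \<and> (\<forall>x. \<bar>deriv G x\<bar> \<le> K) \<and>
    (\<forall>x y. \<bar>deriv G x - deriv G y\<bar> \<le> L * \<bar>x - y\<bar>)"
proof -
  have smooth: "(deriv ^^ k) G field_differentiable (at x)" "bounded (range ((deriv ^^ Suc k) G))" if "k < 3" for k x
    using assms that unfolding three_times_smooth_def by blast+
  have d0: "(G has_real_derivative deriv G x) (at x)" for x
    using smooth(1)[of 0 x] by (simp add: DERIV_deriv_iff_field_differentiable)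
  have d1: "(deriv G has_real_derivative deriv (deriv G) x) (at x)" for x
    using smooth(1)[of 1 x] by (simp add: DERIV_deriv_iff_field_differentiable)
  obtain K where K: "\<And>x. \<bar>deriv G x\<bar> \<le> K" using smooth(2)[of 0] by (auto simp: bounded_iff)
  obtain L where L: "\<And>x. \<bar>deriv (deriv G) x\<bar> \<le> L" using smooth(2)[of 1] by (auto simp: bounded_iff)
  have "\<bar>deriv G x - deriv G y\<bar> \<le> L * \<bar>x - y\<bar>" for x y
    using field_differentiable_bound[of UNIV "deriv G" "deriv (deriv G)" L x y] d1 L by simp
  with d0 K show ?thesis by blast
qed

lemma invertible_matrix_inv_right: "invertible A \<Longrightarrow> A ** matrix_inv A = mat 1"
  unfolding invertible_def matrix_inv_def by (rule someI2_ex) auto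

theorem theorem2p1:
  fixes M :: "'a measure"
    and e :: "int \<Rightarrow> 'a \<Rightarrow> real"
    and a :: "nat \<Rightarrow> real"
    and H :: real
    and L0 :: "real \<Rightarrow> real"
    and X :: "int \<Rightarrow> 'a \<Rightarrow> real ^ 'p"
    and y :: "int \<Rightarrow> 'a \<Rightarrow> real"
    and \<beta> :: "real ^ 'p"
    and bhat :: "nat \<Rightarrow> 'a \<Rightarrow> real ^ 'p"
    and \<delta> :: "nat \<Rightarrow> real ^ 'p ^ 'p"
  assumes "prob_space M"
    and e_indep: "prob_space.indep_vars M (\<lambda>_. borel) e UNIV"
    and e_ident: "\<forall>t. distr M borel (e t) = distr M borel (e 0)"
    and e_mean: "integrable M (e 0)" "prob_space.expectation M (e 0) = 0"
    and e_var: "integrable M (\<lambda>\<omega>. (e 0 \<omega>)\<^sup>2)"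
    and L0: "slowly_varying L0"
    and H: "H < 1"
    and a_0: "a 0 = 1"
    and a_k: "\<forall>k\<ge>1. a k = real k powr (H - 3/2) * L0 (real k)"
    and a_sq: "summable (\<lambda>i. (a i)\<^sup>2)"
    and X_rv: "\<forall>t\<ge>1. X t \<in> borel_measurable M"
    and X_dep: "(\<forall>t\<ge>1. X t \<in> borel_measurable (generated_sigma M (eps a e) {..t - 1})) \<or>
                prob_space.indep_set M (sets (generated_sigma M X {1..}))
                                       (sets (generated_sigma M (eps a e) UNIV))"
    and model: "\<forall>t\<ge>1. \<forall>\<omega>\<in>space M. y t \<omega> = \<beta> \<bullet> X t \<omega> + eps a e t \<omega>"
    and bhat_rv: "\<forall>n. bhat n \<in> borel_measurable M"
    and A1: "(H < 1/2 \<and> sigma_lim M a e > 0) \<or>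
             (H = 1/2 \<and> sigma_lim M a e > 0 \<and> summable (\<lambda>j. \<bar>a j\<bar>)) \<or>
             (1/2 < H \<and> H < 1)"
    and A2: "three_times_smooth (G0 M e)"
            "integrable (distr M borel (e 0)) (\<lambda>x. x ^ 4)"
    and \<delta>_inv: "\<forall>n\<ge>1. invertible (\<delta> n)"
    and A3a: "bounded_in_prob M (\<lambda>n \<omega>. matrix_inv (\<delta> n) *v (bhat n \<omega> - \<beta>))"
    and A3b: "\<forall>n\<ge>1. \<forall>t\<in>{1..int n}. integrable M (\<lambda>\<omega>. norm (transpose (\<delta> n) *v X t \<omega>))"
             "(\<lambda>n. 1 / sigma_n M a e n *
                 (\<Sum>t\<in>{1..int n}. prob_space.expectation M (\<lambda>\<omega>. norm (transpose (\<delta> n) *v X t \<omega>))))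
              \<in> O(\<lambda>_. 1)"
    and A3c: "\<forall>n\<ge>1. \<forall>t\<in>{1..int n}. integrable M (\<lambda>\<omega>. (norm (transpose (\<delta> n) *v X t \<omega>))\<^sup>2)"
             "(\<lambda>n. 1 / sigma_n M a e n *
                 (\<Sum>t\<in>{1..int n}. prob_space.expectation M (\<lambda>\<omega>. (norm (transpose (\<delta> n) *v X t \<omega>))\<^sup>2)))
              \<in> o(\<lambda>_. 1)"
    and A3d: "negligible_in_prob M (\<lambda>n \<omega>. 1 / sigma_n M a e n *
                 (SUP x. norm (\<Sum>t\<in>{1..int n}. A_dev M a e t x \<omega> *\<^sub>R (transpose (\<delta> n) *v X t \<omega>))))"
  shows "negligible_in_prob M (\<lambda>n \<omega>. SUP x.
            \<bar>K_hat M a e y X bhat n x \<omega> - K_proc M a e n x \<omega>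
               - R_term M a e X \<beta> bhat n \<omega> * deriv (F_eps M a e) x\<bar>)
         \<and> bounded_in_prob M (R_term M a e X \<beta> bhat)"
proof -
  interpret prob_space M by fact
  interpret lp: linear_process M e
    by unfold_locales (use e_indep e_ident e_mean e_var in auto)
  obtain K L where KL: "\<And>x. (G0 M e has_real_derivative deriv (G0 M e) x) (at x)" "\<And>x. \<bar>deriv (G0 M e) x\<bar> \<le> K"
    "\<And>x y. \<bar>deriv (G0 M e) x - deriv (G0 M e) y\<bar> \<le> L * \<bar>x - y\<bar>"
    using three_times_smoothD[OF A2(1)] by blast
  interpret sp: smooth_linear_process M e a "G0 M e" "deriv (G0 M e)" K L
    by unfold_locales (use a_sq a_0 KL in auto)
  define s where "s = sigma_n M a e"
  define Z where "Z n t \<omega> = transpose (\<delta> n) *v X t \<omega>" for n t \<omega>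
  define u where "u n \<omega> = matrix_inv (\<delta> n) *v (bhat n \<omega> - \<beta>)" for n \<omega>
  let ?g = "deriv (G0 M e)"

  \<comment> \<open>For H < 1/2 absolute summability is derived from the form of the coefficients,
    for H = 1/2 it is assumed, and for H > 1/2 the divergence of the partial sums takes its
    place.\<close>
  have "\<exists>c>0. eventually (\<lambda>n. sigma_n M a e n \<ge> c * sqrt (real n)) sequentially"
    using A1
  proof (elim disjE conjE)
    assume "H < 1/2" "sigma_lim M a e > 0"
    then show ?thesis by (intro lp.sigma_n_growth_short_memory regularly_varying_abs_summable[OF L0 _ a_k])
  next
    assume "summable (\<lambda>j. \<bar>a j\<bar>)" "sigma_lim M a e > 0"
    then show ?thesis by (rule lp.sigma_n_growth_short_memory)
  next
    assume "1/2 < H"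
    then show ?thesis
      by (intro lp.sigma_n_growth_long_memory a_sq lp.s2_pos DERIV_isCont[OF KL(1)]
          regularly_varying_partial_sums_ge_1[OF L0 _ a_k])
  qed
  then obtain c where c: "c > 0" "eventually (\<lambda>n. s n \<ge> c * sqrt (real n)) sequentially"
    unfolding s_def by blast
  note s1 = eventually_ge_of_sqrt_growth[OF c, of 1]

  have Xm: "X t \<in> borel_measurable M" if "t \<in> {1..int n}" for t n using X_rv that by simp
  have Zm: "Z n t \<in> borel_measurable M" if "n > 0" "t \<in> {1..int n}" for n t
    unfolding Z_def by (intro borel_measurable_matrix_vector Xm[OF that(2)])
  have Z1: "integrable M (\<lambda>\<omega>. norm (Z n t \<omega>))" if "n > 0" "t \<in> {1..int n}" for n t
    using A3b(1) that unfolding Z_def by simp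
  have Z2: "integrable M (\<lambda>\<omega>. (norm (Z n t \<omega>))\<^sup>2)" if "n > 0" "t \<in> {1..int n}" for n t
    using A3c(1) that unfolding Z_def by simp
  obtain B where B: "eventually (\<lambda>n. (\<Sum>t\<in>{1..int n}. expectation (\<lambda>\<omega>. norm (Z n t \<omega>))) \<le> B * s n) sequentially"
    using bigo_one_imp_le[OF A3b(2)[folded s_def] s1] unfolding Z_def by blast
  have sq: "eventually (\<lambda>n. (\<Sum>t\<in>{1..int n}. expectation (\<lambda>\<omega>. (norm (Z n t \<omega>))\<^sup>2)) \<le> r * s n) sequentially" if "r > 0" for r
    using smallo_one_imp_le[OF A3c(2)[folded s_def] s1 that] unfolding Z_def .

  have D: "displacement_array M Z s B c"
    by unfold_locales (intro Zm Z1 Z2 c B sq; assumption)+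

  have linear_small: "eventually (\<lambda>n. \<exists>N\<in>events. prob N \<le> \<theta> \<and>
      (\<forall>\<omega>\<in>space M - N. \<forall>x. norm (\<Sum>t\<in>{1..int n}. (?g (x - sp.\<xi> (t - 1) \<omega>) - sp.f x) *\<^sub>R Z n t \<omega>) \<le> r * s n)) sequentially"
    if r: "r > 0" and \<theta>: "\<theta> > 0" for r \<theta> :: real
  proof -
    define W where "W n \<omega> = 1 / s n * (SUP x. norm (\<Sum>t\<in>{1..int n}. A_dev M a e t x \<omega> *\<^sub>R Z n t \<omega>))" for n \<omega>
    have W [measurable]: "\<And>n. W n \<in> borel_measurable M"
      and lim: "(\<lambda>n. prob {\<omega>\<in>space M. norm (W n \<omega>) > r}) \<longlonglongrightarrow> 0"
      using A3d r unfolding negligible_in_prob_def W_def s_def Z_def by auto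
    have "eventually (\<lambda>n. prob {\<omega>\<in>space M. norm (W n \<omega>) > r} < \<theta>) sequentially"
      using order_tendstoD(2)[OF lim \<theta>] .
    then show ?thesis using s1
    proof eventually_elim
      case (elim n)
      show ?case
      proof (intro bexI[of _ "{\<omega>\<in>space M. norm (W n \<omega>) > r}"] conjI ballI allI)
        show "prob {\<omega>\<in>space M. norm (W n \<omega>) > r} \<le> \<theta>" using elim by simp
        fix \<omega> x assume \<omega>: "\<omega> \<in> space M - {\<omega>\<in>space M. norm (W n \<omega>) > r}"
        let ?h = "\<lambda>x. norm (\<Sum>t\<in>{1..int n}. A_dev M a e t x \<omega> *\<^sub>R Z n t \<omega>)"
        have "?h x \<le> (\<Sum>t\<in>{1..int n}. 2 * K * norm (Z n t \<omega>))" for x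
        proof (rule order_trans[OF norm_sum sum_mono], unfold norm_scaleR real_norm_def, rule mult_right_mono)
          fix t show "\<bar>A_dev M a e t x \<omega>\<bar> \<le> 2 * K"
            unfolding sp.A_dev_eq using sp.g_bound[of "x - sp.\<xi> (t - 1) \<omega>"] sp.f_bound[of x] by linarith
        qed simp
        \<comment> \<open>The \<open>SUP\<close> in (3)(d) bounds its members only after the family
          is known to be bounded.\<close>
        then have "bdd_above (range ?h)" by (intro bdd_aboveI2)
        then have "?h x \<le> (SUP x. ?h x)" by (rule cSUP_upper[rotated]) simp
        also have "\<dots> \<le> r * s n"
        proof -
          have "\<bar>W n \<omega>\<bar> \<le> r" using \<omega> by (simp add: not_less)
          then have "1 / s n * (SUP x. ?h x) \<le> r" unfolding W_def by (rule order_trans[OF abs_ge_self])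
          then show ?thesis using elim by (simp add: field_simps)
        qed
        finally show "norm (\<Sum>t\<in>{1..int n}. (?g (x - sp.\<xi> (t - 1) \<omega>) - sp.f x) *\<^sub>R Z n t \<omega>) \<le> r * s n"
          unfolding sp.A_dev_eq .
      qed measurable
    qed
  qed

  have oscillation: "eventually (\<lambda>n. \<exists>N\<in>events. prob N \<le> \<theta> \<and> (\<forall>\<omega>\<in>space M - N. \<forall>u x. norm u \<le> C \<longrightarrow>
      \<bar>(\<Sum>t\<in>{1..int n}. of_bool (sp.\<epsilon> t \<omega> \<le> x + u \<bullet> Z n t \<omega>) - of_bool (sp.\<epsilon> t \<omega> \<le> x)) - (u \<bullet> (\<Sum>t\<in>{1..int n}. Z n t \<omega>)) * sp.f x\<bar>
      \<le> \<eta> * s n)) sequentially"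
    if bounds: "C \<ge> 0" "\<eta> > 0" "\<theta> > 0" for C \<eta> \<theta> :: real
    using X_dep
  proof
    assume X: "\<forall>t\<ge>1. X t \<in> borel_measurable (generated_sigma M (eps a e) {..t - 1})"
    have Zp: "Z n t \<in> borel_measurable (lp.past (t - 1))" if "n > 0" "t \<in> {1..int n}" for n t
    proof -
      \<comment> \<open>Predictability is assumed for the \<sigma>-field of the \<epsilon>; being a
        function of the innovations up to its own time, each \<epsilon> stays within the larger
        \<open>past\<close>.\<close>
      have "sets (sigma_of M (eps a e) {..t - 1}) \<subseteq> sets (lp.past (t - 1))"
        by (rule sigma_of_least) (auto intro: lp.measurable_past_mono[OF lp.eps_measurable_past])
      moreover have "X t \<in> borel_measurable (sigma_of M (eps a e) {..t - 1})"
        using X that by (simp add: generated_sigma_eq)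
      ultimately have "X t \<in> borel_measurable (lp.past (t - 1))" by (auto intro: measurable_of_coarser)
      then show ?thesis unfolding Z_def by (rule borel_measurable_matrix_vector)
    qed
    show ?thesis
      by (intro sp.oscillation_predictable[OF _ D] Zp linear_small bounds)
  next
    assume ind: "indep_set (sets (generated_sigma M X {1..})) (sets (generated_sigma M (eps a e) UNIV))"
    have ZA: "Z n t \<in> borel_measurable (sigma_of M X {1..})" if "n > 0" "t \<in> {1..int n}" for n t
      unfolding Z_def by (intro borel_measurable_matrix_vector measurable_sigma_of) (use that in auto)
    show ?thesis
      by (intro sp.oscillation_independent[where A = "sigma_of M X {1..}", OF _ _ _ D] ZA bounds
          ind[unfolded generated_sigma_eq] space_sigma_of)
  qed

  have u_rv: "\<And>n. u n \<in> borel_measurable M"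
    and u_bounded: "\<And>\<theta>. \<theta> > 0 \<Longrightarrow> \<exists>C. eventually (\<lambda>n. prob {\<omega>\<in>space M. norm (u n \<omega>) > C} < \<theta>) sequentially"
    using A3a unfolding bounded_in_prob_def u_def by auto
  have u_tail: "\<exists>C\<ge>0. eventually (\<lambda>n. prob {\<omega>\<in>space M. norm (u n \<omega>) > C} < \<theta>) sequentially" if \<theta>: "\<theta> > 0" for \<theta>
  proof -
    obtain C where C: "eventually (\<lambda>n. prob {\<omega>\<in>space M. norm (u n \<omega>) > C} < \<theta>) sequentially"
      using u_bounded[OF \<theta>] by blast
    \<comment> \<open>The constant from boundedness in probability might be negative; raising it to
      0 only shrinks the event.\<close>
    have "prob {\<omega>\<in>space M. norm (u n \<omega>) > max C 0} \<le> prob {\<omega>\<in>space M. norm (u n \<omega>) > C}" for n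
      using u_rv[of n] by (intro finite_measure_mono) auto
    then have "eventually (\<lambda>n. prob {\<omega>\<in>space M. norm (u n \<omega>) > max C 0} < \<theta>) sequentially"
      using C by (auto elim!: eventually_mono intro: le_less_trans)
    then show ?thesis by (intro exI[of _ "max C 0"]) auto
  qed
  \<comment> \<open>The normalisation by \<delta>_n is moved to the regressors by transposition:
    \<delta>_n u paired with X_t equals u paired with
    \<open>transpose (\<delta> n) *v X t\<close>.\<close>
  have shift: "(bhat n \<omega> - \<beta>) \<bullet> X t \<omega> = u n \<omega> \<bullet> Z n t \<omega>" if "n > 0" for n t \<omega>
  proof -
    have "\<delta> n ** matrix_inv (\<delta> n) = mat 1" using \<delta>_inv that by (intro invertible_matrix_inv_right) simp
    then have "bhat n \<omega> - \<beta> = \<delta> n *v u n \<omega>" by (simp add: u_def matrix_vector_mul_assoc)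
    also have "\<dots> = u n \<omega> v* transpose (\<delta> n)" by simp
    finally show ?thesis by (simp only: Z_def dot_lmul_matrix)
  qed
  have R_eq: "R_term M a e X \<beta> bhat n \<omega> = 1 / s n * (u n \<omega> \<bullet> (\<Sum>t\<in>{1..int n}. Z n t \<omega>))" if "n > 0" for n \<omega>
    unfolding R_term_def s_def inner_sum_right shift[OF that] ..
  have R_rv [measurable]: "R_term M a e X \<beta> bhat n \<in> borel_measurable M" for n
  proof -
    have [measurable]: "(\<lambda>\<omega>. \<Sum>t\<in>{1..int n}. X t \<omega>) \<in> borel_measurable M" by (intro borel_measurable_sum Xm)
    have [measurable]: "bhat n \<in> borel_measurable M" using bhat_rv by simp
    show ?thesis unfolding R_term_def[abs_def] by measurable
  qed

  \<comment> \<open>The centring by F cancels between the two empirical processes, leaving only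
    differences of indicators.\<close>
  define D where "D n x \<omega> = (\<Sum>t\<in>{1..int n}. of_bool (residual y X bhat n t \<omega> \<le> x) - of_bool (sp.\<epsilon> t \<omega> \<le> x) :: real)" for n x \<omega>
  define h where "h n x \<omega> = \<bar>1 / s n * D n x \<omega> - R_term M a e X \<beta> bhat n \<omega> * sp.f x\<bar>" for n x \<omega>
  have h_eq: "\<bar>K_hat M a e y X bhat n x \<omega> - K_proc M a e n x \<omega> - R_term M a e X \<beta> bhat n \<omega> * deriv (F_eps M a e) x\<bar> = h n x \<omega>" for n x \<omega>
    unfolding h_def D_def K_hat_def K_proc_def s_def sp.deriv_F_eps
    by (simp add: sum_subtractf diff_divide_distrib)
  have h_bdd: "bdd_above (range (\<lambda>x. h n x \<omega>))" for n \<omega>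
  proof (rule bdd_aboveI2)
    fix x
    have "\<bar>D n x \<omega>\<bar> \<le> (\<Sum>t\<in>{1..int n}. 1)" unfolding D_def by (rule order_trans[OF sum_abs sum_mono]) auto
    then have "\<bar>1 / s n * D n x \<omega>\<bar> \<le> \<bar>1 / s n\<bar> * real n" unfolding abs_mult by (intro mult_left_mono) auto
    moreover have "\<bar>R_term M a e X \<beta> bhat n \<omega> * sp.f x\<bar> \<le> \<bar>R_term M a e X \<beta> bhat n \<omega>\<bar> * K"
      unfolding abs_mult by (intro mult_left_mono sp.f_bound) simp
    ultimately show "h n x \<omega> \<le> \<bar>1 / s n\<bar> * real n + \<bar>R_term M a e X \<beta> bhat n \<omega>\<bar> * K" unfolding h_def by linarith
  qed
  have h_cont: "((\<lambda>x. h n x \<omega>) \<longlongrightarrow> h n x \<omega>) (at_right x)" for n x \<omega>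
  proof -
    have "L-lipschitz_on UNIV sp.f" using sp.f_lipschitz sp.L_nonneg by (auto simp: lipschitz_on_def dist_real_def)
    then have "continuous_on UNIV sp.f" by (rule lipschitz_on_continuous_on)
    then have "(sp.f \<longlongrightarrow> sp.f x) (at x)" by (simp add: continuous_on_def)
    then have "(sp.f \<longlongrightarrow> sp.f x) (at_right x)" by (rule filterlim_mono[OF _ order_refl at_le]) simp
    then show ?thesis unfolding h_def D_def by (intro tendsto_intros tendsto_of_bool_at_right)
  qed
  have h_rv [measurable]: "h n x \<in> borel_measurable M" for n x
  proof -
    have "(\<lambda>\<omega>. of_bool (residual y X bhat n t \<omega> \<le> x) - of_bool (sp.\<epsilon> t \<omega> \<le> x) :: real) \<in> borel_measurable M"
      if t: "t \<in> {1..int n}" for t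
    proof -
      note [measurable] = Xm[OF t]
      have [measurable]: "bhat n \<in> borel_measurable M" using bhat_rv by simp
      have "(\<lambda>\<omega>. \<beta> \<bullet> X t \<omega> + sp.\<epsilon> t \<omega>) \<in> borel_measurable M" by measurable
      \<comment> \<open>Measurability of y_t is read off from the model equation, which holds on
        \<open>space M\<close> only.\<close>
      then have [measurable]: "y t \<in> borel_measurable M"
        by (rule measurable_cong[THEN iffD2, rotated]) (use model t in auto)
      show ?thesis unfolding residual_def by measurable
    qed
    then have [measurable]: "D n x \<in> borel_measurable M" unfolding D_def[abs_def] by (rule borel_measurable_sum)
    show ?thesis unfolding h_def[abs_def] by measurable
  qed
  have sup_rv: "(\<lambda>\<omega>. SUP x. h n x \<omega>) \<in> borel_measurable M" for n
  proof -
    have "(\<lambda>\<omega>. SUP q. h n (of_rat q) \<omega>) \<in> borel_measurable M"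
      by (rule borel_measurable_cSUP) (auto intro!: bdd_above_mono[OF h_bdd])
    then show ?thesis unfolding cSUP_eq_SUP_rat[OF h_cont h_bdd] .
  qed
  have residual_eq: "residual y X bhat n t \<omega> \<le> x \<longleftrightarrow> sp.\<epsilon> t \<omega> \<le> x + u n \<omega> \<bullet> Z n t \<omega>"
    if "n > 0" "t \<in> {1..int n}" "\<omega> \<in> space M" for n t \<omega> x
  proof -
    have "residual y X bhat n t \<omega> = sp.\<epsilon> t \<omega> - (bhat n \<omega> - \<beta>) \<bullet> X t \<omega>"
      using model that by (simp add: residual_def inner_diff_left)
    then show ?thesis unfolding shift[OF that(1)] by auto
  qed

  have "negligible_in_prob M (\<lambda>n \<omega>. SUP x. h n x \<omega>)"
    unfolding negligible_in_prob_def
  proof (intro conjI allI impI sup_rv)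
    fix \<eta> :: real assume \<eta>: "\<eta> > 0"
    show "(\<lambda>n. prob {\<omega>\<in>space M. norm (SUP x. h n x \<omega>) > \<eta>}) \<longlonglongrightarrow> 0"
    proof (rule LIMSEQ_I)
      fix \<theta> :: real assume \<theta>: "\<theta> > 0"
      then obtain C where C: "C \<ge> 0" "eventually (\<lambda>n. prob {\<omega>\<in>space M. norm (u n \<omega>) > C} < \<theta> / 2) sequentially"
        using u_tail[of "\<theta> / 2"] by auto
      have t2: "\<theta> / 2 > 0" using \<theta> by simp
      have "eventually (\<lambda>n. norm (prob {\<omega>\<in>space M. norm (SUP x. h n x \<omega>) > \<eta>} - 0) < \<theta>) sequentially"
        using C(2) oscillation[OF C(1) \<eta> t2] s1 eventually_gt_at_top[of 0]
      proof eventually_elim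
        case (elim n)
        note [measurable] = u_rv[of n]
        obtain N where N: "N \<in> events" "prob N \<le> \<theta> / 2"
          and osc: "\<And>\<omega> u x. \<omega> \<in> space M - N \<Longrightarrow> norm u \<le> C \<Longrightarrow>
      \<bar>(\<Sum>t\<in>{1..int n}. of_bool (sp.\<epsilon> t \<omega> \<le> x + u \<bullet> Z n t \<omega>) - of_bool (sp.\<epsilon> t \<omega> \<le> x)) - (u \<bullet> (\<Sum>t\<in>{1..int n}. Z n t \<omega>)) * sp.f x\<bar>
      \<le> \<eta> * s n" using elim(2) by blast
        let ?U = "{\<omega>\<in>space M. norm (u n \<omega>) > C}"
        have "{\<omega>\<in>space M. norm (SUP x. h n x \<omega>) > \<eta>} \<subseteq> N \<union> ?U"
        proof (rule subsetI, rule ccontr)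
          fix \<omega> assume 1: "\<omega> \<in> {\<omega>\<in>space M. norm (SUP x. h n x \<omega>) > \<eta>}" and 2: "\<omega> \<notin> N \<union> ?U"
          have "h n x \<omega> \<le> \<eta>" for x
          proof -
            have "D n x \<omega> = (\<Sum>t\<in>{1..int n}. of_bool (sp.\<epsilon> t \<omega> \<le> x + u n \<omega> \<bullet> Z n t \<omega>) - of_bool (sp.\<epsilon> t \<omega> \<le> x))"
              unfolding D_def using 1 elim(4) by (intro sum.cong refl) (simp add: residual_eq)
            then have "h n x \<omega> = \<bar>1 / s n * ((\<Sum>t\<in>{1..int n}. of_bool (sp.\<epsilon> t \<omega> \<le> x + u n \<omega> \<bullet> Z n t \<omega>) - of_bool (sp.\<epsilon> t \<omega> \<le> x))
                - (u n \<omega> \<bullet> (\<Sum>t\<in>{1..int n}. Z n t \<omega>)) * sp.f x)\<bar>"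
              unfolding h_def R_eq[OF elim(4)] by (simp add: right_diff_distrib mult.assoc)
            also have "\<dots> \<le> 1 / s n * (\<eta> * s n)"
              unfolding abs_mult using osc[of \<omega> "u n \<omega>" x] 1 2 elim(3) by (intro mult_mono) auto
            also have "\<dots> = \<eta>" using elim(3) by simp
            finally show ?thesis .
          qed
          then have "(SUP x. h n x \<omega>) \<le> \<eta>" by (intro cSUP_least) auto
          \<comment> \<open>Evaluating at x = 0 shows that the supremum is nonnegative, so the norm
            in \<open>negligible_in_prob\<close> does not change it.\<close>
          moreover have "0 \<le> (SUP x. h n x \<omega>)"
            by (rule order_trans[OF _ cSUP_upper[OF _ h_bdd, of 0]]) (auto simp: h_def)
          ultimately show False using 1 by simp
        qed
        then have "prob {\<omega>\<in>space M. norm (SUP x. h n x \<omega>) > \<eta>} \<le> prob (N \<union> ?U)"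
          by (rule finite_measure_mono) (use N in auto)
        also have "\<dots> \<le> prob N + prob ?U" by (rule measure_Un_le) (use N in auto)
        also have "\<dots> < \<theta>" using N elim(1) by linarith
        finally show ?case by simp
      qed
      then show "\<exists>n0. \<forall>n\<ge>n0. norm (prob {\<omega>\<in>space M. norm (SUP x. h n x \<omega>) > \<eta>} - 0) < \<theta>"
        by (simp add: eventually_sequentially)
    qed
  qed
  moreover have "bounded_in_prob M (R_term M a e X \<beta> bhat)"
    unfolding bounded_in_prob_def
  proof (intro conjI allI impI R_rv)
    fix \<theta> :: real assume \<theta>: "\<theta> > 0"
    then obtain C where C: "C \<ge> 0" "eventually (\<lambda>n. prob {\<omega>\<in>space M. norm (u n \<omega>) > C} < \<theta> / 2) sequentially"
      using u_tail[of "\<theta> / 2"] by auto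
    \<comment> \<open>Markov's inequality at level \<theta>/2 for the sum of the norms; the other
      half of \<theta> pays for a large u.\<close>
    define b where "b = 2 * max B 1 / \<theta>"
    have b: "b > 0" using \<theta> by (simp add: b_def)
    show "\<exists>C. eventually (\<lambda>n. prob {\<omega>\<in>space M. norm (R_term M a e X \<beta> bhat n \<omega>) > C} < \<theta>) sequentially"
    proof (intro exI[of _ "C * b"])
      show "eventually (\<lambda>n. prob {\<omega>\<in>space M. norm (R_term M a e X \<beta> bhat n \<omega>) > C * b} < \<theta>) sequentially"
        using C(2) B s1 eventually_gt_at_top[of 0]
      proof eventually_elim
        case (elim n)
        note [measurable] = u_rv[of n]
        let ?U = "{\<omega>\<in>space M. norm (u n \<omega>) > C}"
        let ?S = "{\<omega>\<in>space M. (\<Sum>t\<in>{1..int n}. norm (Z n t \<omega>)) > b * s n}"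
        have "B * s n \<le> max B 1 * s n" using elim(3) by (intro mult_right_mono) auto
        then have m: "(\<Sum>t\<in>{1..int n}. expectation (\<lambda>\<omega>. norm (Z n t \<omega>))) \<le> \<theta> / 2 * (b * s n)"
          using elim(2) \<theta> by (simp add: b_def)
        have S: "?S \<in> events" "prob ?S \<le> \<theta> / 2"
          by (rule markov_sum[OF Z1[OF elim(4)] norm_ge_zero m]; use b elim(3) in simp)+
        have "{\<omega>\<in>space M. norm (R_term M a e X \<beta> bhat n \<omega>) > C * b} \<subseteq> ?S \<union> ?U"
        proof (rule subsetI, rule ccontr)
          fix \<omega> assume 1: "\<omega> \<in> {\<omega>\<in>space M. norm (R_term M a e X \<beta> bhat n \<omega>) > C * b}" and 2: "\<omega> \<notin> ?S \<union> ?U"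
          have "\<bar>u n \<omega> \<bullet> (\<Sum>t\<in>{1..int n}. Z n t \<omega>)\<bar> \<le> norm (u n \<omega>) * norm (\<Sum>t\<in>{1..int n}. Z n t \<omega>)"
            by (rule Cauchy_Schwarz_ineq2)
          also have "\<dots> \<le> C * (b * s n)"
            using 1 2 C(1) by (intro mult_mono order_trans[OF norm_sum]) auto
          finally have "1 / s n * \<bar>u n \<omega> \<bullet> (\<Sum>t\<in>{1..int n}. Z n t \<omega>)\<bar> \<le> 1 / s n * (C * (b * s n))"
            using elim(3) by (intro mult_left_mono) auto
          then have "\<bar>R_term M a e X \<beta> bhat n \<omega>\<bar> \<le> C * b"
            unfolding R_eq[OF elim(4)] abs_mult using elim(3) by simp
          then show False using 1 by simp
        qed
        then have "prob {\<omega>\<in>space M. norm (R_term M a e X \<beta> bhat n \<omega>) > C * b} \<le> prob (?S \<union> ?U)"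
          by (rule finite_measure_mono) (use S in auto)
        also have "\<dots> \<le> prob ?S + prob ?U" by (rule measure_Un_le) (use S in auto)
        also have "\<dots> < \<theta>" using S elim(1) by linarith
        finally show ?case .
      qed
    qed
  qed
  ultimately show ?thesis unfolding h_eq by blast
qed

end
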